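(* Let $\mathcal{C}$ be an involution invariant (random) edge cover of the Poisson weighted infinite tree $\mathcal{T}$ with root $\phi$ and edge lengths $\xi(\cdot,\cdot)$. Write $\mathcal{C}(\phi)$ for the set of vertices of $\mathcal{T}$ adjacent to the root $\phi$ in $\mathcal{C}$. Then $$\mathrm{E}\Bigl[\sum_{v\in\mathcal{C}(\phi)}\xi(\phi,v)\Bigr]\ \ge\ \mathrm{E}\Bigl[\sum_{v\in\mathcal{C}_{\mathrm{opt}}(\phi)}\xi(\phi,v)\Bigr].$$
   Context: PWIT. Let $\mathcal{V}$ be the set of finite words over $\mathbb{N}=\{1,2,\dots\}$, $\phi$ the empty word, $|v|$ the length of $v$, $v.i$ concatenation. The Poisson weighted infinite tree (PWIT) $\mathcal{T}$ is the tree on $\mathcal{V}$ with root $\phi$ and edges $\{v,v.i\}$, $v\in\mathcal{V}$, $i\in\mathbb{N}$, where the edge $\{v,v.i\}$ has length $\xi(v,v.i)=\xi(v.i,v)=\xi^v_i$, and $(\xi^v_1<\xi^v_2<\cdots)$, $v\in\mathcal{V}$, are independent Poisson processes of rate 1 on $[0,\infty)$. Write $u\sim v$ for adjacency, $x^+=\max\{x,0\}$. Stationary process $X$. Let $F_*$ be the c.d.f. with $1-F_*(y)=W(1)e^{-y}$ for $y\ge0$ and $1-F_*(y)=1$ for $y<0$, where $W$ is the inverse of $x\mapsto xe^x$ on $[0,\infty)$. $X$ assigns to each directed edge $(u,v)$ of $\mathcal{T}$ a nonnegative random variable $X(u,v)$, jointly with $\mathcal{T}$, such that (i) $X(u,v)=\min\{(\xi(v,w)-X(v,w))^+: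 w\sim v,\ w\ne u\}$ for every directed edge $(u,v)$; (ii) for each $d\ge1$, the variables $X(v,w)$ with $|v|=d-1$ and $w$ a child of $v$ are i.i.d. with c.d.f. $F_*$ and independent of the lengths of all edges joining vertices of depth at most $d$. Edge cover $\mathcal{C}_{\mathrm{opt}}$. For each vertex $v$, $\mathcal{C}_{\mathrm{opt}}(v)=\operatorname{arg\,min}_{y\sim v}(\xi(v,y)-X(v,y))^+$ (the set of minimizers), and $\mathcal{C}_{\mathrm{opt}}=\bigcup_v\{\{v,w\}:w\in\mathcal{C}_{\mathrm{opt}}(v)\}$. Involution invariance. An edge cover of a graph is a set of edges such that each vertex is an endpoint of at least one of them. A random edge cover $\mathcal{C}$ of $\mathcal{T}$ is a random set of edges, defined jointly with $\mathcal{T}$, that is a.s. an edge cover. View $(\mathcal{T},\mathcal{C})$ as a random rooted network $G$ (considered up to rooted isomorphism) with edge lengths and edge marks $e\mapsto\mathbf{1}\{e\in\mathcal{C}\}$. $\mathcal{C}$ is involution invariant if for every nonnegative Borel function $f$ on isomorphism classes of such marked connected networks with an ordered pair of distinguished vertices, $\mathrm{E}\sum_{x\sim\phi}f(G,\phi,x)=\mathrm{E}\sum_{x\sim\phi}f(G,x,\phi)$. *)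

theory Defs
  imports "HOL-Probability.Probability"
begin

section \<open>Marked networks and local convergence\<close>

text \<open>
  The values of \<open>len\<close> and \<open>mark\<close> only matter on pairs of adjacent vertices. The mark of an edge
  is a truth value, with the discrete topology on marks.
\<close>

record 'v network =
  verts :: "'v set"
  adj :: "'v \<Rightarrow> 'v \<Rightarrow> bool"
  len :: "'v \<Rightarrow> 'v \<Rightarrow> real"
  mark :: "'v \<Rightarrow> 'v \<Rightarrow> bool"

definition walk :: "'v network \<Rightarrow> 'v \<Rightarrow> 'v \<Rightarrow> 'v list \<Rightarrow> bool" where
  "walk G u v p \<longleftrightarrow>
     p \<noteq> [] \<and> hd p = u \<and> last p = v \<and> set p \<subseteq> verts G \<and> successively (adj G) p"

definition walk_len :: "'v network \<Rightarrow> 'v list \<Rightarrow> real" where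
  "walk_len G p = (\<Sum>i<length p - 1. len G (p ! i) (p ! Suc i))"

definition net_dist :: "'v network \<Rightarrow> 'v \<Rightarrow> 'v \<Rightarrow> real" where
  "net_dist G u v = Inf {walk_len G p | p. walk G u v p}"

definition net_ball :: "'v network \<Rightarrow> 'v \<Rightarrow> real \<Rightarrow> 'v set" where
  "net_ball G u r = {v \<in> verts G. net_dist G u v \<le> r}"

text \<open>
  Local finiteness is in the sense of the length metric: vertices may have infinite degree,
  but only finitely many vertices lie within any given distance.
\<close>

definition is_network :: "'v network \<Rightarrow> bool" where
  "is_network G \<longleftrightarrow>
     (\<forall>u v. adj G u v \<longrightarrow> u \<in> verts G \<and> v \<in> verts G \<and> u \<noteq> v \<and> adj G v u \<and>
        0 < len G u v \<and> len G u v = len G v u \<and> mark G u v = mark G v u) \<and>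
     (\<forall>u\<in>verts G. \<forall>v\<in>verts G. \<exists>p. walk G u v p) \<and>
     (\<forall>u\<in>verts G. \<forall>r. finite (net_ball G u r))"

type_synonym 'v network2 = "'v network \<times> 'v \<times> 'v"

definition networks2 :: "'v network2 set" where
  "networks2 = {(G, a, b). is_network G \<and> a \<in> verts G \<and> b \<in> verts G}"

text \<open>
  Isomorphism of the subgraphs induced on \<open>A\<close> and \<open>B\<close>, respecting marks but not
  necessarily lengths.
\<close>

definition marked_iso_on ::
  "'v network \<Rightarrow> 'v set \<Rightarrow> 'w network \<Rightarrow> 'w set \<Rightarrow> ('v \<Rightarrow> 'w) \<Rightarrow> bool" where
  "marked_iso_on G A H B \<gamma> \<longleftrightarrow>
     bij_betw \<gamma> A B \<and>
     (\<forall>u\<in>A. \<forall>v\<in>A. adj H (\<gamma> u) (\<gamma> v) = adj G u v) \<and>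
     (\<forall>u\<in>A. \<forall>v\<in>A. adj G u v \<longrightarrow> mark H (\<gamma> u) (\<gamma> v) = mark G u v)"

definition network2_iso :: "'v network2 \<Rightarrow> 'w network2 \<Rightarrow> bool" where
  "network2_iso = (\<lambda>(G, a, b) (H, c, d).
     \<exists>\<gamma>. marked_iso_on G (verts G) H (verts H) \<gamma> \<and> \<gamma> a = c \<and> \<gamma> b = d \<and>
       (\<forall>u v. adj G u v \<longrightarrow> len H (\<gamma> u) (\<gamma> v) = len G u v))"

text \<open>
  Local convergence: for every radius \<open>r\<close> that is a continuity point of the limit (no vertex at
  distance exactly \<open>r\<close> from the first distinguished vertex), the balls of radius \<open>r\<close> are eventually
  isomorphic, and along these isomorphisms the edge lengths converge. Only radii for which the
  ball contains the second distinguished vertex are considered; smaller balls then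
  converge as well.
\<close>

definition local_conv :: "(nat \<Rightarrow> 'v network2) \<Rightarrow> 'v network2 \<Rightarrow> bool" where
  "local_conv = (\<lambda>S (G, a, b).
     \<forall>r. net_dist G a b < r \<and> (\<forall>v\<in>verts G. net_dist G a v \<noteq> r) \<longrightarrow>
       (\<exists>\<gamma>. (\<forall>\<^sub>F n in sequentially. case S n of (H, c, d) \<Rightarrow>
               marked_iso_on G (net_ball G a r) H (net_ball H c r) (\<gamma> n) \<and>
               \<gamma> n a = c \<and> \<gamma> n b = d) \<and>
            (\<forall>u\<in>net_ball G a r. \<forall>v\<in>net_ball G a r. adj G u v \<longrightarrow>
               (\<lambda>n. len (fst (S n)) (\<gamma> n u) (\<gamma> n v)) \<longlonglongrightarrow> len G u v)))"

text \<open>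
  The topology of local convergence. It is carried by networks rather than by
  isomorphism classes, but its open sets, hence its Borel sets and Borel functions, do
  not distinguish isomorphic networks (\<open>network2_borel_iso_invariant\<close> below). So
  Borel functions here are the same thing as Borel functions on isomorphism classes.
  Networks are countable, so for a countably infinite \<open>'v\<close> every isomorphism class is
  represented.
\<close>

definition local_open :: "'v network2 set \<Rightarrow> bool" where
  "local_open U \<longleftrightarrow> U \<subseteq> networks2 \<and>
     (\<forall>g\<in>U. \<forall>S. range S \<subseteq> networks2 \<and> local_conv S g \<longrightarrow>
        (\<forall>\<^sub>F n in sequentially. S n \<in> U))"

definition local_topology :: "'v network2 topology" where
  "local_topology = topology local_open"

definition network2_borel :: "'v network2 measure" where
  "network2_borel = sigma networks2 {U. openin local_topology U}"

lemma openin_local_topology: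
  fixes U :: "'v network2 set"
  shows "openin local_topology U \<longleftrightarrow> local_open U"
proof -
  have "istopology (local_open :: 'v network2 set \<Rightarrow> bool)"
    unfolding istopology_def
  proof (intro conjI allI impI)
    fix A B :: "'v network2 set" assume "local_open A" "local_open B"
    then show "local_open (A \<inter> B)"
      unfolding local_open_def by (auto simp: eventually_conj_iff)
  next
    fix \<K> :: "'v network2 set set" assume K: "\<forall>K\<in>\<K>. local_open K"
    show "local_open (\<Union>\<K>)"
      unfolding local_open_def
    proof (intro conjI ballI allI impI)
      show "\<Union>\<K> \<subseteq> networks2" using K by (auto simp: local_open_def)
    next
      fix g S assume "g \<in> \<Union>\<K>" and S: "range S \<subseteq> networks2 \<and> local_conv S g"
      then obtain A where A: "A \<in> \<K>" "g \<in> A" by blast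
      then have "\<forall>\<^sub>F n in sequentially. S n \<in> A"
        using K S by (auto simp: local_open_def)
      then show "\<forall>\<^sub>F n in sequentially. S n \<in> \<Union>\<K>"
        by (rule eventually_mono) (use A in blast)
    qed
  qed
  then show ?thesis by (simp add: local_topology_def topology_inverse')
qed

lemma walk_map_iso:
  assumes iso: "marked_iso_on G (verts G) H (verts H) \<gamma>"
    and len: "\<forall>u v. adj G u v \<longrightarrow> len H (\<gamma> u) (\<gamma> v) = len G u v"
    and w: "walk G u v p"
  shows "walk H (\<gamma> u) (\<gamma> v) (map \<gamma> p)" "walk_len H (map \<gamma> p) = walk_len G p"
proof -
  have p: "set p \<subseteq> verts G" "successively (adj G) p" "p \<noteq> []"
    using w by (auto simp: walk_def)
  have "successively (\<lambda>x y. adj H (\<gamma> x) (\<gamma> y)) p"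
    by (rule successively_mono[OF p(2)]) (use iso p(1) in \<open>auto simp: marked_iso_on_def subset_iff\<close>)
  moreover have "\<gamma> ` set p \<subseteq> verts H"
    using iso p(1) by (auto simp: marked_iso_on_def bij_betw_def)
  ultimately show "walk H (\<gamma> u) (\<gamma> v) (map \<gamma> p)"
    using w by (auto simp: walk_def successively_map hd_map last_map)
  show "walk_len H (map \<gamma> p) = walk_len G p"
    unfolding walk_len_def
    using p len by (auto intro!: sum.cong simp: successively_conv_nth)
qed

lemma network2_iso_sym:
  assumes "network2_iso (G, a, b) (H, c, d)" "(G, a, b) \<in> networks2" "(H, c, d) \<in> networks2"
  shows "network2_iso (H, c, d) (G, a, b)"
proof -
  from assms(1) obtain \<gamma> where iso: "marked_iso_on G (verts G) H (verts H) \<gamma>"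
    and c: "c = \<gamma> a" "d = \<gamma> b" and len: "\<forall>u v. adj G u v \<longrightarrow> len H (\<gamma> u) (\<gamma> v) = len G u v"
    by (auto simp: network2_iso_def)
  define \<delta> where "\<delta> = inv_into (verts G) \<gamma>"
  have bij: "bij_betw \<gamma> (verts G) (verts H)" using iso by (simp add: marked_iso_on_def)
  have bij': "bij_betw \<delta> (verts H) (verts G)" unfolding \<delta>_def by (rule bij_betw_inv_into[OF bij])
  have d1: "\<gamma> (\<delta> u) = u" "\<delta> u \<in> verts G" if "u \<in> verts H" for u
    using that bij bij' by (auto simp: \<delta>_def bij_betw_inv_into_right bij_betwE)
  have d2: "\<delta> (\<gamma> u) = u" if "u \<in> verts G" for u
    using that bij by (auto simp: \<delta>_def bij_betw_inv_into_left)
  have adjH: "u \<in> verts H \<and> v \<in> verts H" if "adj H u v" for u v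
    using assms(3) that by (auto simp: networks2_def is_network_def)
  have 1: "adj G (\<delta> u) (\<delta> v) = adj H u v" if "u \<in> verts H" "v \<in> verts H" for u v
    using iso d1[OF that(1)] d1[OF that(2)] unfolding marked_iso_on_def by metis
  have 2: "mark G (\<delta> u) (\<delta> v) = mark H u v" if "adj H u v" for u v
    using iso d1[of u] d1[of v] adjH[OF that] that unfolding marked_iso_on_def by metis
  have 3: "len G (\<delta> u) (\<delta> v) = len H u v" if "adj H u v" for u v
    using len d1[of u] d1[of v] adjH[OF that] that 1 by metis
  have "marked_iso_on H (verts H) G (verts G) \<delta>"
    using bij' 1 2 by (auto simp: marked_iso_on_def)
  moreover have "\<delta> c = a" "\<delta> d = b" using assms(2) c d2 by (auto simp: networks2_def)
  ultimately show ?thesis using 3 by (auto simp: network2_iso_def)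
qed

lemma net_dist_iso:
  fixes G H :: "'v network"
  assumes "network2_iso (G, a, b) (H, c, d)" "(G, a, b) \<in> networks2" "(H, c, d) \<in> networks2"
  shows "net_dist H c d = net_dist G a b"
proof -
  have *: "{walk_len G p | p. walk G a b p} \<subseteq> {walk_len H p | p. walk H c d p}"
    if i: "network2_iso (G, a, b) (H, c, d)"
    for G H :: "'v network" and a b c d
  proof -
    from i obtain \<gamma> where \<gamma>: "marked_iso_on G (verts G) H (verts H) \<gamma>"
      "c = \<gamma> a" "d = \<gamma> b" "\<forall>u v. adj G u v \<longrightarrow> len H (\<gamma> u) (\<gamma> v) = len G u v"
      by (auto simp: network2_iso_def)
    show ?thesis
      using walk_map_iso[OF \<gamma>(1,4)] unfolding \<gamma>(2,3) by (smt (verit) Collect_mono)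
  qed
  have "{walk_len G p | p. walk G a b p} = {walk_len H p | p. walk H c d p}"
    using *[OF assms(1)] *[OF network2_iso_sym[OF assms]] by blast
  then show ?thesis by (simp add: net_dist_def)
qed

lemma local_conv_const_iso:
  assumes iso: "network2_iso g h" and g: "g \<in> networks2" and h: "h \<in> networks2"
  shows "local_conv (\<lambda>_. h) g"
proof -
  obtain G a b where G: "g = (G, a, b)" by (cases g)
  obtain H c d where H: "h = (H, c, d)" by (cases h)
  note gh = G H
  from iso obtain \<gamma> where \<gamma>: "marked_iso_on G (verts G) H (verts H) \<gamma>"
      "c = \<gamma> a" "d = \<gamma> b" "\<forall>u v. adj G u v \<longrightarrow> len H (\<gamma> u) (\<gamma> v) = len G u v"
    by (auto simp: network2_iso_def gh)
  have bij: "bij_betw \<gamma> (verts G) (verts H)" using \<gamma>(1) by (simp add: marked_iso_on_def)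
  have dist: "net_dist H c (\<gamma> v) = net_dist G a v" if "v \<in> verts G" for v
  proof (rule net_dist_iso)
    show "network2_iso (G, a, v) (H, c, \<gamma> v)" using \<gamma> by (auto simp: network2_iso_def)
    show "(G, a, v) \<in> networks2" "(H, c, \<gamma> v) \<in> networks2"
      using g h gh that bij by (auto simp: networks2_def bij_betwE)
  qed
  have img: "\<gamma> ` net_ball G a r = net_ball H c r" for r
  proof -
    have "net_ball H c r = {w \<in> \<gamma> ` verts G. net_dist H c w \<le> r}"
      using bij by (simp add: net_ball_def bij_betw_def)
    also have "\<dots> = \<gamma> ` net_ball G a r" using dist by (auto simp: net_ball_def)
    finally show ?thesis by simp
  qed
  have sub: "net_ball G a r \<subseteq> verts G" for r by (auto simp: net_ball_def)
  have "marked_iso_on G (net_ball G a r) H (net_ball H c r) \<gamma>" for r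
    unfolding marked_iso_on_def
  proof (intro conjI)
    show "bij_betw \<gamma> (net_ball G a r) (net_ball H c r)"
      by (rule bij_betw_subset[OF bij sub img])
  qed (use \<gamma>(1) sub[of r] in \<open>auto simp: marked_iso_on_def subset_iff\<close>)
  then have "\<exists>\<delta>. (\<forall>\<^sub>F n in sequentially.
        marked_iso_on G (net_ball G a r) H (net_ball H c r) (\<delta> n) \<and> \<delta> n a = c \<and> \<delta> n b = d) \<and>
      (\<forall>u\<in>net_ball G a r. \<forall>v\<in>net_ball G a r. adj G u v \<longrightarrow>
        (\<lambda>n. len H (\<delta> n u) (\<delta> n v)) \<longlonglongrightarrow> len G u v)" for r
    using \<gamma>(2-4) by (intro exI[of _ "\<lambda>_. \<gamma>"]) simp
  then show ?thesis unfolding local_conv_def gh by simp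
qed

lemma local_open_iso:
  assumes "local_open U" "network2_iso g h" "g \<in> networks2" "h \<in> networks2" "g \<in> U"
  shows "h \<in> U"
proof -
  have "local_conv (\<lambda>_. h) g" by (rule local_conv_const_iso[OF assms(2-4)])
  moreover have "range (\<lambda>_::nat. h) \<subseteq> networks2" using assms(4) by simp
  ultimately have "\<forall>\<^sub>F n::nat in sequentially. h \<in> U"
    using assms(1,5) unfolding local_open_def by blast
  then show ?thesis by simp
qed

lemma network2_borel_iso_invariant:
  fixes f :: "'v network2 \<Rightarrow> ennreal"
  assumes f: "f \<in> borel_measurable network2_borel"
    and iso: "network2_iso g h" and g: "g \<in> networks2" and h: "h \<in> networks2"
  shows "f g = f h"
proof -
  let ?O = "{U :: 'v network2 set. openin local_topology U}"
  obtain G a b where G: "g = (G, a, b)" by (cases g)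
  obtain H c d where H: "h = (H, c, d)" by (cases h)
  have iso': "network2_iso h g"
    using network2_iso_sym[of G a b H c d] iso g h by (simp only: G H)
  have sub: "?O \<subseteq> Pow networks2"
    by (auto simp: openin_local_topology local_open_def)
  have op: "(g \<in> U) = (h \<in> U)" if "local_open U" for U
    using local_open_iso[OF that iso g h] local_open_iso[OF that iso' h g] by (rule iffI)
  have sat: "(g \<in> A) = (h \<in> A)" if "A \<in> sigma_sets networks2 ?O" for A
    using that
  proof induction
    case (Basic A)
    then show ?case using op by (simp add: openin_local_topology)
  qed (use g h in simp_all)
  have "space network2_borel = (networks2 :: 'v network2 set)"
    "sets network2_borel = sigma_sets networks2 ?O"
    using sub by (simp_all add: network2_borel_def space_measure_of sets_measure_of)
  then have "f -` {f g} \<inter> networks2 \<in> sigma_sets networks2 ?O"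
    using measurable_sets[OF f, of "{f g}"] by simp
  from sat[OF this] show ?thesis using g h by simp
qed


section \<open>The Poisson weighted infinite tree\<close>

text \<open>
  Vertices are words over the natural numbers. Children are numbered from 0,
  so the points of the Poisson process at \<open>v\<close> are \<open>l v 0 < l v 1 < \<dots>\<close>, and \<open>l v i\<close>
  is the length of the edge joining \<open>v\<close> to \<open>v @ [i]\<close>.
\<close>

type_synonym vertex = "nat list"
type_synonym lengths = "vertex \<Rightarrow> nat \<Rightarrow> real"

definition tree_adj :: "vertex \<Rightarrow> vertex \<Rightarrow> bool" where
  "tree_adj u v \<longleftrightarrow> (\<exists>i. v = u @ [i]) \<or> (\<exists>i. u = v @ [i])"

definition tree_edges :: "vertex set set" where
  "tree_edges = {{u, v} | u v. tree_adj u v}"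

definition edge_len :: "lengths \<Rightarrow> vertex \<Rightarrow> vertex \<Rightarrow> real" where
  "edge_len l u v =
     (if length u < length v then l (butlast v) (last v) else l (butlast u) (last u))"

lemma edge_len_child [simp]: "edge_len l v (v @ [i]) = l v i" "edge_len l (v @ [i]) v = l v i"
  by (simp_all add: edge_len_def)

text \<open>
  The points \<open>T 0 < T 1 < \<dots>\<close> of a Poisson process on \<open>[0, \<infinity>)\<close>: the first point and the
  successive gaps are independent exponential variables.
\<close>

definition poisson_process :: "'a measure \<Rightarrow> real \<Rightarrow> ('a \<Rightarrow> nat \<Rightarrow> real) \<Rightarrow> bool" where
  "poisson_process M c T \<longleftrightarrow>
     (let gap = (\<lambda>i \<omega>. T \<omega> i - (case i of 0 \<Rightarrow> 0 | Suc j \<Rightarrow> T \<omega> j)) in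
       prob_space.indep_vars M (\<lambda>_. borel) gap UNIV \<and>
       (\<forall>i. distributed M lborel (gap i) (\<lambda>x. ennreal (exponential_density c x))))"

definition PWIT :: "'a measure \<Rightarrow> ('a \<Rightarrow> lengths) \<Rightarrow> bool" where
  "PWIT M \<xi> \<longleftrightarrow> prob_space M \<and>
     (\<forall>v. poisson_process M 1 (\<lambda>\<omega>. \<xi> \<omega> v)) \<and>
     prob_space.indep_vars M (\<lambda>_. Pi\<^sub>M UNIV (\<lambda>_. borel)) (\<lambda>v \<omega>. \<xi> \<omega> v) UNIV"


section \<open>Involution invariant edge covers\<close>

definition edge_cover :: "'v set \<Rightarrow> 'v set set \<Rightarrow> 'v set set \<Rightarrow> bool" where
  "edge_cover V E F \<longleftrightarrow> F \<subseteq> E \<and> (\<forall>v\<in>V. \<exists>e\<in>F. v \<in> e)"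

definition random_edge_cover :: "'a measure \<Rightarrow> ('a \<Rightarrow> vertex set set) \<Rightarrow> bool" where
  "random_edge_cover M C \<longleftrightarrow>
     (\<forall>e\<in>tree_edges. {\<omega> \<in> space M. e \<in> C \<omega>} \<in> sets M) \<and>
     (AE \<omega> in M. edge_cover UNIV tree_edges (C \<omega>))"

definition cover_nbrs :: "'v set set \<Rightarrow> 'v \<Rightarrow> 'v set" where
  "cover_nbrs F v = {w. {v, w} \<in> F}"

definition tree_network :: "lengths \<Rightarrow> vertex set set \<Rightarrow> vertex network" where
  "tree_network l F =
     \<lparr>verts = UNIV, adj = tree_adj, len = edge_len l, mark = (\<lambda>u v. {u, v} \<in> F)\<rparr>"

text \<open>
  \<open>tree_network (\<xi> \<omega>) (C \<omega>)\<close> satisfies \<open>is_network\<close> almost surely only; the values of \<open>f\<close>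
  outside \<open>networks2\<close> therefore do not matter.
\<close>

definition involution_invariant ::
  "'a measure \<Rightarrow> ('a \<Rightarrow> lengths) \<Rightarrow> ('a \<Rightarrow> vertex set set) \<Rightarrow> bool" where
  "involution_invariant M \<xi> C \<longleftrightarrow>
     (\<forall>f :: vertex network2 \<Rightarrow> ennreal. f \<in> borel_measurable network2_borel \<longrightarrow>
        (\<integral>\<^sup>+\<omega>. (\<integral>\<^sup>+x. f (tree_network (\<xi> \<omega>) (C \<omega>), [], x) \<partial>count_space {x. tree_adj x []}) \<partial>M) =
        (\<integral>\<^sup>+\<omega>. (\<integral>\<^sup>+x. f (tree_network (\<xi> \<omega>) (C \<omega>), x, []) \<partial>count_space {x. tree_adj x []}) \<partial>M))"


section \<open>The stationary process and the optimal edge cover\<close>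

definition lambert_W :: "real \<Rightarrow> real" where
  "lambert_W = the_inv_into {0..} (\<lambda>x. x * exp x)"

definition F_star :: "real \<Rightarrow> real" where
  "F_star y = 1 - (if y \<ge> 0 then lambert_W 1 * exp (- y) else 1)"

definition is_minimum :: "real set \<Rightarrow> real \<Rightarrow> bool" where
  "is_minimum S m \<longleftrightarrow> m \<in> S \<and> (\<forall>s\<in>S. m \<le> s)"

definition recursion :: "lengths \<Rightarrow> (vertex \<Rightarrow> vertex \<Rightarrow> real) \<Rightarrow> bool" where
  "recursion l x \<longleftrightarrow> (\<forall>u v. tree_adj u v \<longrightarrow>
     is_minimum {max (edge_len l v w - x v w) 0 | w. tree_adj v w \<and> w \<noteq> u} (x u v))"

text \<open>
  In the last clause the pair \<open>(v, i)\<close> stands for the edge from \<open>v\<close> to \<open>v @ [i]\<close>; its endpoints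
  have depth at most \<open>d\<close> iff \<open>length v < d\<close>.
\<close>

definition stationary_process ::
  "'a measure \<Rightarrow> ('a \<Rightarrow> lengths) \<Rightarrow> ('a \<Rightarrow> vertex \<Rightarrow> vertex \<Rightarrow> real) \<Rightarrow> bool" where
  "stationary_process M \<xi> X \<longleftrightarrow>
     (\<forall>u v. tree_adj u v \<longrightarrow> (\<lambda>\<omega>. X \<omega> u v) \<in> borel_measurable M) \<and>
     (AE \<omega> in M. \<forall>u v. tree_adj u v \<longrightarrow> 0 \<le> X \<omega> u v) \<and>
     (AE \<omega> in M. recursion (\<xi> \<omega>) (X \<omega>)) \<and>
     (\<forall>d\<ge>1. let L = {(v, i). length v = d - 1}; K = {(v, i). length v < d} in
        prob_space.indep_vars M (\<lambda>_. borel) (\<lambda>(v, i) \<omega>. X \<omega> v (v @ [i])) L \<and>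
        (\<forall>(v, i)\<in>L. cdf (distr M borel (\<lambda>\<omega>. X \<omega> v (v @ [i]))) = F_star) \<and>
        prob_space.indep_var M
          (Pi\<^sub>M L (\<lambda>_. borel)) (\<lambda>\<omega>. \<lambda>(v, i)\<in>L. X \<omega> v (v @ [i]))
          (Pi\<^sub>M K (\<lambda>_. borel)) (\<lambda>\<omega>. \<lambda>(v, i)\<in>K. \<xi> \<omega> v i))"

definition C_opt_at :: "lengths \<Rightarrow> (vertex \<Rightarrow> vertex \<Rightarrow> real) \<Rightarrow> vertex \<Rightarrow> vertex set" where
  "C_opt_at l x v =
     {y. is_arg_min (\<lambda>y. max (edge_len l v y - x v y) 0) (\<lambda>y. tree_adj v y) y}"

definition C_opt :: "lengths \<Rightarrow> (vertex \<Rightarrow> vertex \<Rightarrow> real) \<Rightarrow> vertex set set" where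
  "C_opt l x = (\<Union>v. {{v, w} | w. w \<in> C_opt_at l x v})"

lemma tree_adj_sym: "tree_adj u v \<longleftrightarrow> tree_adj v u"
  by (auto simp: tree_adj_def)

lemma edge_len_sym: "tree_adj u v \<Longrightarrow> edge_len l u v = edge_len l v u"
  by (auto simp: tree_adj_def)

lemma C_opt_at_iff:
  assumes rec: "recursion l x" and nn: "\<And>u v. tree_adj u v \<Longrightarrow> 0 \<le> x u v"
  shows "w \<in> C_opt_at l x v \<longleftrightarrow> tree_adj v w \<and> edge_len l v w \<le> x v w + x w v"
proof (cases "tree_adj v w")
  case True
  let ?g = "\<lambda>y. max (edge_len l v y - x v y) 0"
  have m: "is_minimum {?g y | y. tree_adj v y \<and> y \<noteq> w} (x w v)"
    using rec True by (auto simp: recursion_def tree_adj_sym[of w v])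
  have "w \<in> C_opt_at l x v \<longleftrightarrow> (\<forall>y. tree_adj v y \<longrightarrow> ?g w \<le> ?g y)"
    using True by (auto simp: C_opt_at_def is_arg_min_def not_less)
  also have "\<dots> \<longleftrightarrow> (\<forall>s\<in>{?g y | y. tree_adj v y \<and> y \<noteq> w}. ?g w \<le> s)"
    by blast
  also have "\<dots> \<longleftrightarrow> ?g w \<le> x w v"
    using m unfolding is_minimum_def by (meson order_trans)
  also have "\<dots> \<longleftrightarrow> edge_len l v w \<le> x v w + x w v"
    using nn[of w v] True by (auto simp: tree_adj_sym[of w v])
  finally show ?thesis using True by simp
qed (auto simp: C_opt_at_def is_arg_min_def)

text \<open>
  Hence the neighbours of \<open>v\<close> in the edge set \<open>C_opt\<close> are exactly the minimizers at \<open>v\<close>.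
\<close>

lemma cover_nbrs_C_opt:
  assumes rec: "recursion l x" and nn: "\<And>u v. tree_adj u v \<Longrightarrow> 0 \<le> x u v"
  shows "cover_nbrs (C_opt l x) v = C_opt_at l x v"
proof -
  have iff: "w \<in> C_opt_at l x v \<longleftrightarrow> tree_adj v w \<and> edge_len l v w \<le> x v w + x w v" for v w
    by (rule C_opt_at_iff[OF rec]) (rule nn)
  have "w \<in> C_opt_at l x v \<longleftrightarrow> v \<in> C_opt_at l x w" for v w
    unfolding iff using edge_len_sym[of v w l] tree_adj_sym[of v w] by auto
  then show ?thesis
    by (auto simp: cover_nbrs_def C_opt_def doubleton_eq_iff)
qed


section \<open>Cost at the root\<close>

text \<open>
  The cost depends only on the joint law of lengths and cover, so covers that are coupled
  with the tree on different probability spaces can be compared.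
\<close>

definition root_cost :: "'a measure \<Rightarrow> ('a \<Rightarrow> lengths) \<Rightarrow> ('a \<Rightarrow> vertex set set) \<Rightarrow> ennreal" where
  "root_cost M \<xi> C =
     (\<integral>\<^sup>+\<omega>. (\<integral>\<^sup>+v. ennreal (edge_len (\<xi> \<omega>) [] v) \<partial>count_space (cover_nbrs (C \<omega>) [])) \<partial>M)"

end

theory Submission
  imports Defs
begin

text \<open>
  For a function \<open>h\<close> of directed edges let \<open>best h\<close> send \<open>(u, v)\<close> to the minimum of
  \<open>(len v w - h v w)\<^sup>+\<close> over the neighbours \<open>w \<noteq> u\<close> of \<open>v\<close>; the stationary process \<open>X\<close> is a fixed point
  of \<open>best\<close>. Since \<open>best\<close> is antitone, iterating it from \<open>0\<close> encloses \<open>X\<close> between increasing lower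
  and decreasing upper iterates. For a Poisson process whose points carry i.i.d. marks of mean \<open>m\<close>
  the minimum exceeds \<open>x\<close> with probability \<open>exp (- x - m)\<close>, so the means of the iterates evolve by
  \<open>m \<mapsto> exp (- m)\<close>, both kinds of iterates converge to the same limit, and \<open>X\<close> is a Borel function of
  the tree. Hence the optimal cover can be realized on the probability space that carries \<open>C\<close>, and
  the involution invariance of the tree itself is inherited from that of \<open>C\<close>.

  At the root, let \<open>y v = \<xi> v - X \<phi> v\<close>, so that \<open>X v \<phi>\<close> is the minimum of \<open>(y w)\<^sup>+\<close> over \<open>w \<noteq> v\<close>. A
  comparison of finitely many cases shows that the set of minimizers of \<open>(y v)\<^sup>+\<close> minimizes the sum
  of \<open>y v + X v \<phi>\<close> over \<open>v \<in> A\<close> among all nonempty sets \<open>A\<close>. By involution invariance the terms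
  \<open>X v \<phi>\<close> and \<open>- X \<phi> v\<close> cancel in expectation, which leaves the cost.
\<close>

section \<open>Iterates of the recursion\<close>

text \<open>Involution invariance can only be tested with Borel functions of a whole network and two
  of its vertices, so the iterates are defined for an arbitrary adjacency and length function and
  not just for the tree. Subtraction in \<open>ennreal\<close> is truncated, which supplies the
  positive part. The map \<open>m \<mapsto> exp (- m)\<close> reverses order, so a lower iterate
  takes two steps at a time. What has to be excluded is a 2-cycle of this map; the limit of the
  means then solves \<open>a = exp (- a)\<close>, so it is W(1), the mean of \<open>F_star\<close>.
  The optimality at the root needs the absence of ties: two minimizers with a common positive value
  would both be selected, and dropping one of them would lower the sum. Cancelling in expectation
  needs finite terms. The values on the edges of a cover that point to the root are bounded by the
  lengths of these edges and one further length, so a finite cost suffices. All inequalities are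
  written without subtraction.\<close>

definition best :: "('v \<Rightarrow> 'v \<Rightarrow> bool) \<Rightarrow> ('v \<Rightarrow> 'v \<Rightarrow> real) \<Rightarrow> ('v \<Rightarrow> 'v \<Rightarrow> ennreal) \<Rightarrow> 'v \<Rightarrow> 'v \<Rightarrow> ennreal" where
  "best R l h u v = (INF w\<in>{w. R v w \<and> w \<noteq> u}. ennreal (l v w) - h v w)"

text \<open>
  Because of the cap \<open>Suc n\<close> only the edges at \<open>v\<close> of bounded length influence the next iterate; this
  makes the iterates semicontinuous for local convergence. The cap is harmless in the limit.
\<close>

fun low :: "('v \<Rightarrow> 'v \<Rightarrow> bool) \<Rightarrow> ('v \<Rightarrow> 'v \<Rightarrow> real) \<Rightarrow> nat \<Rightarrow> 'v \<Rightarrow> 'v \<Rightarrow> ennreal" where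
  "low R l 0 = (\<lambda>u v. 0)"
| "low R l (Suc n) = (\<lambda>u v. min (of_nat (Suc n)) (best R l (best R l (low R l n)) u v))"

definition upp :: "('v \<Rightarrow> 'v \<Rightarrow> bool) \<Rightarrow> ('v \<Rightarrow> 'v \<Rightarrow> real) \<Rightarrow> nat \<Rightarrow> 'v \<Rightarrow> 'v \<Rightarrow> ennreal" where
  "upp R l n = best R l (low R l n)"

lemma low_Suc: "low R l (Suc n) u v = min (of_nat (Suc n)) (best R l (upp R l n) u v)"
  by (simp add: upp_def)

lemma low_le: "low R l n u v \<le> of_nat n"
  by (cases n) auto

section \<open>Semicontinuity for local convergence\<close>

lemma ennreal_diff_less_iff:
  assumes "a < \<top>"
  shows "a - b < c \<longleftrightarrow> 0 < c \<and> a < c + (b::ennreal)"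
proof (cases "b \<le> a")
  case True
  then have b: "b < \<top>" using assms by (rule le_less_trans)
  show ?thesis
  proof
    assume h: "a - b < c"
    have "0 < c" using h by (rule le_less_trans[rotated]) simp
    moreover have "a < c + b"
    proof -
      have "a = b + (a - b)" using True by (simp add: add_diff_inverse_ennreal)
      also have "\<dots> < b + c" using b h by (simp add: ennreal_add_left_cancel_less)
      finally show ?thesis by (simp add: add.commute)
    qed
    ultimately show "0 < c \<and> a < c + b" by simp
  next
    assume h: "0 < c \<and> a < c + b"
    show "a - b < c"
    proof (rule ccontr)
      assume "\<not> a - b < c"
      then have "c + b \<le> (a - b) + b" by (intro add_right_mono) simp
      also have "\<dots> = a" using True by (simp add: diff_add_cancel_ennreal)
      finally show False using h leD by blast
    qed
  qed
next
  case False
  then have "a - b = 0" "a < b" using assms by (auto simp: diff_eq_0_iff_ennreal less_imp_le)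
  moreover have "b \<le> c + b" by simp
  ultimately show ?thesis using less_le_trans[of a b "c + b"] by auto
qed

lemma eventually_ennreal_greater:
  "b < ennreal l \<Longrightarrow> \<forall>\<^sub>F l' in nhds l. b < ennreal l'"
  by (rule order_tendstoD(1)[OF tendsto_ennrealI]) (simp_all add: tendsto_ident_at filterlim_ident)

lemma eventually_ennreal_less:
  "ennreal l < b \<Longrightarrow> \<forall>\<^sub>F l' in nhds l. ennreal l' < b"
  by (rule order_tendstoD(2)[OF tendsto_ennrealI]) (simp_all add: tendsto_ident_at filterlim_ident)

text \<open>The length and the subtracted iterate are controlled by different facts, so joint
  semicontinuity is split into a neighbourhood for the first and a threshold for the second.\<close>

lemma ennreal_diff_lsc:
  assumes "c < ennreal l - s"
  obtains s' where "s < s'" "\<forall>\<^sub>F l' in nhds l. \<forall>t<s'. c < ennreal l' - t"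
proof -
  have "c + s < ennreal l" using assms by (simp add: less_diff_eq_ennreal)
  moreover have "c < \<top>" using assms by (rule less_le_trans) simp
  ultimately have "s < ennreal l - c" by (simp add: less_diff_eq_ennreal add.commute)
  then obtain s' where s': "s < s'" "s' < ennreal l - c" using dense by blast
  then have "s' + c < ennreal l" by (simp add: less_diff_eq_ennreal)
  then have "\<forall>\<^sub>F l' in nhds l. s' + c < ennreal l'" by (rule eventually_ennreal_greater)
  then have "\<forall>\<^sub>F l' in nhds l. \<forall>t<s'. c < ennreal l' - t"
  proof eventually_elim
    case (elim l')
    then have "c < ennreal l' - s'" by (simp add: less_diff_eq_ennreal add.commute)
    then show ?case by (meson ennreal_minus_mono less_imp_le less_le_trans order_refl)
  qed
  with s'(1) show thesis by (rule that)
qed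

text \<open>Below \<open>s = 0\<close> there is no room for a threshold; \<open>low_usc\<close>
  treats that case by dropping the subtracted term.\<close>

lemma ennreal_diff_usc:
  assumes "ennreal l - s < c" "0 < s"
  obtains s' where "s' < s" "\<forall>\<^sub>F l' in nhds l. \<forall>t>s'. ennreal l' - t < c"
proof -
  have c: "0 < c" "ennreal l < c + s" using assms(1) by (simp_all add: ennreal_diff_less_iff)
  have "\<exists>s'<s. ennreal l < c + s'"
  proof (cases "c = \<top>")
    case True
    then show ?thesis using assms(2) by (intro exI[of _ 0]) auto
  next
    case False
    have "ennreal l - c < s" using c assms(2) False by (subst ennreal_diff_less_iff) (auto simp: add.commute)
    then obtain s' where "ennreal l - c < s'" "s' < s" using dense by blast
    then show ?thesis by (auto simp: ennreal_diff_less_iff add.commute)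
  qed
  then obtain s' where s': "s' < s" "ennreal l < c + s'" by blast
  from s'(2) have "\<forall>\<^sub>F l' in nhds l. ennreal l' < c + s'" by (rule eventually_ennreal_less)
  then have "\<forall>\<^sub>F l' in nhds l. \<forall>t>s'. ennreal l' - t < c"
  proof eventually_elim
    case (elim l')
    then have "ennreal l' - s' < c" using c by (simp add: ennreal_diff_less_iff)
    then show ?case by (auto intro: le_less_trans[rotated] ennreal_minus_mono less_imp_le)
  qed
  with s'(1) show thesis by (rule that)
qed

section \<open>Distances and short edges in a network\<close>

lemma is_networkD:
  assumes "is_network G"
  shows "adj G u v \<Longrightarrow> u \<in> verts G" "adj G u v \<Longrightarrow> v \<in> verts G" "adj G u v \<Longrightarrow> u \<noteq> v"
    "adj G u v \<Longrightarrow> adj G v u" "adj G u v \<Longrightarrow> 0 < len G u v"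
    "u \<in> verts G \<Longrightarrow> v \<in> verts G \<Longrightarrow> \<exists>p. walk G u v p"
    "u \<in> verts G \<Longrightarrow> finite (net_ball G u r)"
  using assms unfolding is_network_def by blast+

lemma walk_len_nonneg:
  assumes "is_network G" "walk G u v p"
  shows "0 \<le> walk_len G p"
  unfolding walk_len_def
proof (rule sum_nonneg)
  fix i assume "i \<in> {..<length p - 1}"
  then have "adj G (p ! i) (p ! Suc i)"
    using assms(2) by (auto simp: walk_def successively_conv_nth)
  then show "0 \<le> len G (p ! i) (p ! Suc i)"
    using is_networkD(5)[OF assms(1)] by (simp add: less_imp_le)
qed

lemma net_dist_le_walk_len:
  assumes "is_network G" "walk G u v p"
  shows "net_dist G u v \<le> walk_len G p"
  unfolding net_dist_def
  by (rule cInf_lower) (use assms walk_len_nonneg in \<open>auto intro!: bdd_belowI[of _ 0]\<close>)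

lemma net_dist_refl:
  assumes "is_network G" "u \<in> verts G"
  shows "net_dist G u u \<le> 0"
  using net_dist_le_walk_len[OF assms(1), of u u "[u]"] assms(2) by (simp add: walk_def walk_len_def)

lemma net_dist_adj:
  assumes G: "is_network G" and u: "u \<in> verts G" and vw: "adj G v w"
  shows "net_dist G u w \<le> net_dist G u v + len G v w"
proof -
  have "net_dist G u w - len G v w \<le> Inf {walk_len G p | p. walk G u v p}"
  proof (rule cInf_greatest)
    show "{walk_len G p | p. walk G u v p} \<noteq> {}"
      using is_networkD(6)[OF G u is_networkD(1)[OF G vw]] by auto
    fix x assume "x \<in> {walk_len G p | p. walk G u v p}"
    then obtain p where p: "walk G u v p" "x = walk_len G p" by blast
    have "walk G u w (p @ [w])"
      using p(1) vw is_networkD(2)[OF G vw] by (auto simp: walk_def successively_append_iff)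
    moreover have "walk_len G (p @ [w]) = walk_len G p + len G v w"
    proof -
      from p(1) have "p \<noteq> []" "last p = v" by (auto simp: walk_def)
      then obtain q where q: "p = q @ [v]" by (metis append_butlast_last_id)
      show ?thesis
        unfolding walk_len_def q by (simp add: nth_append cong: sum.cong) (rule sum.cong, auto simp: nth_append)
    qed
    ultimately show "net_dist G u w - len G v w \<le> x"
      using net_dist_le_walk_len[OF G, of u w "p @ [w]"] p(2) by simp
  qed
  then show ?thesis by (simp add: net_dist_def)
qed

lemma finite_short_edges:
  assumes G: "is_network G" and "v \<in> verts G"
  shows "finite {w. adj G v w \<and> len G v w \<le> K}"
proof (rule finite_subset)
  show "{w. adj G v w \<and> len G v w \<le> K} \<subseteq> net_ball G v K"
    using net_dist_adj[OF G assms(2), of v] net_dist_refl[OF G assms(2)] is_networkD(2)[OF G]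
    by (force simp: net_ball_def)
qed (rule is_networkD(7)[OF assms])

lemma walk_induct:
  assumes "walk G u v p" "P u" and step: "\<And>x y. P x \<Longrightarrow> adj G x y \<Longrightarrow> P y"
  shows "P v"
  using assms(1)
proof (induction p arbitrary: v rule: rev_induct)
  case Nil
  then show ?case by (simp add: walk_def)
next
  case (snoc x p)
  show ?case
  proof (cases "p = []")
    case True
    then show ?thesis using snoc.prems assms(2) by (auto simp: walk_def)
  next
    case False
    then have "walk G u (last p) p" "adj G (last p) v"
      using snoc.prems by (auto simp: walk_def successively_append_iff)
    then show ?thesis using snoc.IH step by blast
  qed
qed

section \<open>Transport of edges and neighbourhoods along charts\<close>

context
  fixes S :: "nat \<Rightarrow> 'v network2" and G :: "'v network" and a b :: 'v
  assumes G: "is_network G" and a: "a \<in> verts G" and b: "b \<in> verts G"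
    and S: "range S \<subseteq> networks2" and conv: "local_conv S (G, a, b)"
begin

definition net_of :: "nat \<Rightarrow> 'v network" where "net_of n = fst (S n)"

definition root_of :: "nat \<Rightarrow> 'v" where "root_of n = fst (snd (S n))"

definition chart :: "real \<Rightarrow> (nat \<Rightarrow> 'v \<Rightarrow> 'v) \<Rightarrow> bool" where
  "chart r \<gamma> \<longleftrightarrow>
     (\<forall>\<^sub>F n in sequentially. marked_iso_on G (net_ball G a r) (net_of n) (net_ball (net_of n) (root_of n) r) (\<gamma> n)
        \<and> \<gamma> n a = root_of n \<and> \<gamma> n b = snd (snd (S n))) \<and>
     (\<forall>u\<in>net_ball G a r. \<forall>v\<in>net_ball G a r. adj G u v \<longrightarrow>
        (\<lambda>n. len (net_of n) (\<gamma> n u) (\<gamma> n v)) \<longlonglongrightarrow> len G u v)"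

text \<open>
  The isomorphisms that witness local convergence for different radii need not be compatible, so
  \<open>ev_chart\<close> asks for a property along all charts of sufficiently large radius.
\<close>

definition ev_chart :: "(real \<Rightarrow> nat \<Rightarrow> ('v \<Rightarrow> 'v) \<Rightarrow> bool) \<Rightarrow> bool" where
  "ev_chart P \<longleftrightarrow> (\<exists>r0. \<forall>r\<ge>r0. \<forall>\<gamma>. chart r \<gamma> \<longrightarrow> (\<forall>\<^sub>F n in sequentially. P r n (\<gamma> n)))"

lemma net_of_network: "is_network (net_of n)" and root_of_verts: "root_of n \<in> verts (net_of n)"
proof -
  have "S n \<in> networks2" using S by auto
  then show "is_network (net_of n)" "root_of n \<in> verts (net_of n)"
    by (cases "S n"; simp add: net_of_def root_of_def networks2_def)+
qed

lemma ex_chart: "\<exists>r\<ge>r0. \<exists>\<gamma>. chart r \<gamma>"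
proof -
  define r1 where "r1 = max r0 (net_dist G a b)"
  have "finite (net_dist G a ` net_ball G a (r1 + 1))"
    using is_networkD(7)[OF G a] by simp
  moreover have "infinite {r1<..<r1+1}" by simp
  ultimately have "\<not> {r1<..<r1+1} \<subseteq> net_dist G a ` net_ball G a (r1 + 1)"
    using finite_subset by metis
  then obtain r where r: "r \<in> {r1<..<r1+1}" "r \<notin> net_dist G a ` net_ball G a (r1 + 1)"
    by blast
  have 1: "\<forall>v\<in>verts G. net_dist G a v \<noteq> r"
  proof
    fix v assume "v \<in> verts G"
    then show "net_dist G a v \<noteq> r" using r by (cases "v \<in> net_ball G a (r1 + 1)") (auto simp: net_ball_def)
  qed
  have 2: "net_dist G a b < r" using r(1) by (simp add: r1_def)
  obtain \<gamma> where "\<forall>\<^sub>F n in sequentially. case S n of (H, c, d) \<Rightarrow>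
               marked_iso_on G (net_ball G a r) H (net_ball H c r) (\<gamma> n) \<and>
               \<gamma> n a = c \<and> \<gamma> n b = d"
      and 4: "\<forall>u\<in>net_ball G a r. \<forall>v\<in>net_ball G a r. adj G u v \<longrightarrow>
               (\<lambda>n. len (fst (S n)) (\<gamma> n u) (\<gamma> n v)) \<longlonglongrightarrow> len G u v"
    using conv 1 2 unfolding local_conv_def by blast
  then have "chart r \<gamma>"
    unfolding chart_def net_of_def root_of_def by (simp add: case_prod_beta)
  moreover have "r0 \<le> r" using r(1) by (simp add: r1_def)
  ultimately show ?thesis by blast
qed

lemma ev_chart_mono:
  assumes "ev_chart P" and PQ: "\<And>r n \<gamma>. P r n \<gamma> \<Longrightarrow> Q r n \<gamma>"
  shows "ev_chart Q"
proof -
  from assms(1) obtain r0 where r0: "\<forall>r\<ge>r0. \<forall>\<gamma>. chart r \<gamma> \<longrightarrow> (\<forall>\<^sub>F n in sequentially. P r n (\<gamma> n))"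
    unfolding ev_chart_def by blast
  have "\<forall>\<^sub>F n in sequentially. Q r n (\<gamma> n)" if "r \<ge> r0" "chart r \<gamma>" for r \<gamma>
  proof (rule eventually_mono)
    show "\<forall>\<^sub>F n in sequentially. P r n (\<gamma> n)" using r0 that by blast
  qed (rule PQ)
  then show ?thesis unfolding ev_chart_def by blast
qed

lemma ev_chart_True: "(\<And>r n \<gamma>. P r n \<gamma>) \<Longrightarrow> ev_chart P"
  unfolding ev_chart_def by simp

lemma ev_chart_conj: 
  assumes "ev_chart P" "ev_chart Q" shows "ev_chart (\<lambda>r n \<gamma>. P r n \<gamma> \<and> Q r n \<gamma>)"
proof -
  from assms obtain r1 r2 where 
    "\<forall>r\<ge>r1. \<forall>\<gamma>. chart r \<gamma> \<longrightarrow> (\<forall>\<^sub>F n in sequentially. P r n (\<gamma> n))"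
    "\<forall>r\<ge>r2. \<forall>\<gamma>. chart r \<gamma> \<longrightarrow> (\<forall>\<^sub>F n in sequentially. Q r n (\<gamma> n))"
    unfolding ev_chart_def by blast
  then show ?thesis unfolding ev_chart_def
    by (intro exI[of _ "max r1 r2"]) (simp add: eventually_conj_iff)
qed

lemma ev_chart_ball_finite:
  assumes "finite A" "\<And>x. x \<in> A \<Longrightarrow> ev_chart (P x)"
  shows "ev_chart (\<lambda>r n \<gamma>. \<forall>x\<in>A. P x r n \<gamma>)"
  using assms
proof induction
  case empty
  then show ?case by (intro ev_chart_True) simp
next
  case (insert x A)
  then show ?case using ev_chart_conj[of "P x" "\<lambda>r n \<gamma>. \<forall>x\<in>A. P x r n \<gamma>"] by simp
qed

lemma ev_chart_mem: 
  assumes "v \<in> verts G" shows "ev_chart (\<lambda>r n \<gamma>. v \<in> net_ball G a r)"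
  unfolding ev_chart_def using assms by (auto intro!: exI[of _ "net_dist G a v"] simp: net_ball_def)

lemma ev_chart_iso:
  "ev_chart (\<lambda>r n \<gamma>. marked_iso_on G (net_ball G a r) (net_of n) (net_ball (net_of n) (root_of n) r) \<gamma>
        \<and> \<gamma> a = root_of n \<and> \<gamma> b = snd (snd (S n)))"
  unfolding ev_chart_def chart_def by simp

lemma ev_chart_len:
  assumes "adj G u v" and ev: "eventually Q (nhds (len G u v))"
  shows "ev_chart (\<lambda>r n \<gamma>. Q (len (net_of n) (\<gamma> u) (\<gamma> v)))"
proof -
  have uv: "u \<in> verts G" "v \<in> verts G" using is_networkD(1,2)[OF G assms(1)] by auto
  show ?thesis unfolding ev_chart_def
  proof (intro exI[of _ "max (net_dist G a u) (net_dist G a v)"] allI impI)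
    fix r \<gamma> assume r: "max (net_dist G a u) (net_dist G a v) \<le> r" and c: "chart r \<gamma>"
    then have "u \<in> net_ball G a r" "v \<in> net_ball G a r" using uv by (auto simp: net_ball_def)
    then have "(\<lambda>n. len (net_of n) (\<gamma> n u) (\<gamma> n v)) \<longlonglongrightarrow> len G u v"
      using c assms(1) by (auto simp: chart_def)
    from this ev show "\<forall>\<^sub>F n in sequentially. Q (len (net_of n) (\<gamma> n u) (\<gamma> n v))"
      by (rule eventually_compose_filterlim[rotated])
  qed
qed

lemma ev_chart_adj:
  assumes "u \<in> verts G" "v \<in> verts G"
  shows "ev_chart (\<lambda>r n \<gamma>. adj (net_of n) (\<gamma> u) (\<gamma> v) = adj G u v \<and> (\<gamma> u = \<gamma> v \<longrightarrow> u = v)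
            \<and> (adj G u v \<longrightarrow> mark (net_of n) (\<gamma> u) (\<gamma> v) = mark G u v))"
  by (rule ev_chart_mono[OF ev_chart_conj[OF ev_chart_iso ev_chart_conj[OF ev_chart_mem[OF assms(1)] ev_chart_mem[OF assms(2)]]]])
    (auto simp: marked_iso_on_def bij_betw_def inj_on_def)

text \<open>A chart of radius r alone bounds this distance only by r. A bound independent of r comes
  from adding up the limiting lengths along a walk from \<open>a\<close>, with slack 1 per
  edge.\<close>

lemma ev_chart_dist:
  assumes "v \<in> verts G" 
  shows "\<exists>D. ev_chart (\<lambda>r n \<gamma>. net_dist (net_of n) (root_of n) (\<gamma> v) < D)"
proof -
  obtain p where "walk G a v p" using is_networkD(6)[OF G a assms] by blast
  then show ?thesis
  proof (rule walk_induct[where P = "\<lambda>v. \<exists>D. ev_chart (\<lambda>r n \<gamma>. net_dist (net_of n) (root_of n) (\<gamma> v) < D)"])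
    show "\<exists>D. ev_chart (\<lambda>r n \<gamma>. net_dist (net_of n) (root_of n) (\<gamma> a) < D)"
      by (intro exI[of _ 1] ev_chart_mono[OF ev_chart_iso])
        (use net_dist_refl[OF net_of_network root_of_verts] in \<open>auto intro: le_less_trans[OF _ zero_less_one]\<close>)
  next
    fix x y assume ih: "\<exists>D. ev_chart (\<lambda>r n \<gamma>. net_dist (net_of n) (root_of n) (\<gamma> x) < D)" and xy: "adj G x y"
    from ih obtain D where D: "ev_chart (\<lambda>r n \<gamma>. net_dist (net_of n) (root_of n) (\<gamma> x) < D)" by blast
    have v: "x \<in> verts G" "y \<in> verts G" using is_networkD(1,2)[OF G xy] by auto
    have l: "ev_chart (\<lambda>r n \<gamma>. len (net_of n) (\<gamma> x) (\<gamma> y) < len G x y + 1)"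
      by (rule ev_chart_len[OF xy]) (simp add: eventually_nhds, rule exI[of _ "{..<len G x y + 1}"], auto)
    show "\<exists>D. ev_chart (\<lambda>r n \<gamma>. net_dist (net_of n) (root_of n) (\<gamma> y) < D)"
    proof (intro exI, rule ev_chart_mono[OF ev_chart_conj[OF D ev_chart_conj[OF l ev_chart_adj[OF v]]]])
      fix r n \<gamma>
      assume *: "net_dist (net_of n) (root_of n) (\<gamma> x) < D \<and> len (net_of n) (\<gamma> x) (\<gamma> y) < len G x y + 1 \<and>
         adj (net_of n) (\<gamma> x) (\<gamma> y) = adj G x y \<and> (\<gamma> x = \<gamma> y \<longrightarrow> x = y)
            \<and> (adj G x y \<longrightarrow> mark (net_of n) (\<gamma> x) (\<gamma> y) = mark G x y)"
      then show "net_dist (net_of n) (root_of n) (\<gamma> y) < D + (len G x y + 1)"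
        using net_dist_adj[OF net_of_network root_of_verts, of n "\<gamma> x" "\<gamma> y"] xy by simp
    qed
  qed
qed

text \<open>A neighbour across an edge shorter than K lies within \<open>D + K\<close> of the root,
  hence in the image of every chart of at least that radius. A limiting length equal to K may be
  approached from below, so \<open><\<close> turns into \<open>\<le>\<close>.\<close>

lemma ev_chart_nbrs:
  assumes v: "v \<in> verts G"
  shows "ev_chart (\<lambda>r n \<gamma>. \<forall>w'. adj (net_of n) (\<gamma> v) w' \<and> len (net_of n) (\<gamma> v) w' < K \<longrightarrow>
    (\<exists>w. adj G v w \<and> len G v w \<le> K \<and> w' = \<gamma> w))"
proof -
  obtain D where "ev_chart (\<lambda>r n \<gamma>. net_dist (net_of n) (root_of n) (\<gamma> v) < D)"
    using ev_chart_dist[OF v] by blast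
  then obtain r0 where r0: "\<And>r \<gamma>. r \<ge> r0 \<Longrightarrow> chart r \<gamma> \<Longrightarrow> 
      (\<forall>\<^sub>F n in sequentially. net_dist (net_of n) (root_of n) (\<gamma> n v) < D)"
    unfolding ev_chart_def by blast
  show ?thesis
    unfolding ev_chart_def
  proof (intro exI[of _ "max r0 (max (net_dist G a v) (D + K))"] allI impI)
    fix r \<gamma> assume "max r0 (max (net_dist G a v) (D + K)) \<le> r" and c: "chart r \<gamma>"
    then have r: "r \<ge> r0" "net_dist G a v \<le> r" "D + K \<le> r" by auto
    have vb: "v \<in> net_ball G a r" using v r(2) by (simp add: net_ball_def)
    have iso: "\<forall>\<^sub>F n in sequentially. marked_iso_on G (net_ball G a r) (net_of n) (net_ball (net_of n) (root_of n) r) (\<gamma> n)"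
      using c unfolding chart_def by (auto simp: eventually_conj_iff)
    \<comment> \<open>The ball is finite, so the strict inequalities for its long edges survive the
      perturbation simultaneously.\<close>
    have "\<forall>\<^sub>F n in sequentially. \<forall>w\<in>{w \<in> net_ball G a r. adj G v w \<and> K < len G v w}. 
        K < len (net_of n) (\<gamma> n v) (\<gamma> n w)"
    proof (rule eventually_ball_finite)
      show "finite {w \<in> net_ball G a r. adj G v w \<and> K < len G v w}"
        using is_networkD(7)[OF G a] by simp
      show "\<forall>w\<in>{w \<in> net_ball G a r. adj G v w \<and> K < len G v w}. 
          \<forall>\<^sub>F n in sequentially. K < len (net_of n) (\<gamma> n v) (\<gamma> n w)"
        using c vb by (auto simp: chart_def order_tendsto_iff)
    qed
    with iso r0[OF r(1) c]
    show "\<forall>\<^sub>F n in sequentially. \<forall>w'. adj (net_of n) (\<gamma> n v) w' \<and> len (net_of n) (\<gamma> n v) w' < K \<longrightarrow>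
        (\<exists>w. adj G v w \<and> len G v w \<le> K \<and> w' = \<gamma> n w)"
    proof eventually_elim
      case (elim n)
      show ?case
      proof (intro allI impI)
        fix w' assume w': "adj (net_of n) (\<gamma> n v) w' \<and> len (net_of n) (\<gamma> n v) w' < K"
        have "net_dist (net_of n) (root_of n) w' \<le> r"
          using net_dist_adj[OF net_of_network root_of_verts, of n "\<gamma> n v" w'] w' elim(2) r(3) by simp
        then have "w' \<in> net_ball (net_of n) (root_of n) r"
          using w' is_networkD(2)[OF net_of_network] by (auto simp: net_ball_def)
        moreover have "net_ball (net_of n) (root_of n) r = \<gamma> n ` net_ball G a r"
          using elim(1) by (simp add: marked_iso_on_def bij_betw_def)
        ultimately obtain w where w: "w \<in> net_ball G a r" "w' = \<gamma> n w"
          by blast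
        then have "adj G v w" using elim(1) vb w' by (auto simp: marked_iso_on_def)
        moreover have "len G v w \<le> K" using elim(3) w w' calculation by force
        ultimately show "\<exists>w. adj G v w \<and> len G v w \<le> K \<and> w' = \<gamma> n w" using w(2) by blast
      qed
    qed
  qed
qed

abbreviation "lowG \<equiv> low (adj G) (len G)"
abbreviation "uppG \<equiv> upp (adj G) (len G)"
abbreviation "lowS n \<equiv> low (adj (net_of n)) (len (net_of n))"
abbreviation "uppS n \<equiv> upp (adj (net_of n)) (len (net_of n))"

text \<open>The assumption is the induction hypothesis of \<open>low_usc\<close>, whose induction
  calls this step. The infimum runs over infinitely many neighbours: the finitely many short edges
  are followed one by one, the long ones are handled by the cap.\<close>

lemma upp_lsc_step:
  assumes low_usc: "\<And>u v c. u \<in> verts G \<Longrightarrow> v \<in> verts G \<Longrightarrow> lowG k u v < c \<Longrightarrow>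
      ev_chart (\<lambda>r n \<gamma>. lowS n k (\<gamma> u) (\<gamma> v) < c)"
    and uv: "u \<in> verts G" "v \<in> verts G" and c: "c < uppG k u v"
  shows "ev_chart (\<lambda>r n \<gamma>. c < uppS n k (\<gamma> u) (\<gamma> v))"
proof -
  \<comment> \<open>An infimum of terms above \<open>c'\<close> is only known to be at least
    \<open>c'\<close>, hence the room between \<open>c\<close> and \<open>c'\<close>.\<close>
  obtain c' where c': "c < c'" "c' < uppG k u v" using dense[OF c] by blast
  then have "c' < \<top>" by (meson less_le_trans top_greatest)
  then obtain \<kappa> where \<kappa>: "c' = ennreal \<kappa>" "0 \<le> \<kappa>" by (cases c') auto
  \<comment> \<open>\<open>low\<close> at stage k is at most k, so an edge of length at least
    \<open>\<kappa> + k\<close> contributes at least \<open>\<kappa>\<close> whatever is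
    subtracted.\<close>
  define K where "K = \<kappa> + real k"
  define W where "W = {w. adj G v w \<and> len G v w \<le> K}"
  have "ev_chart (\<lambda>r n \<gamma>. w \<noteq> u \<longrightarrow> c' < ennreal (len (net_of n) (\<gamma> v) (\<gamma> w)) - lowS n k (\<gamma> v) (\<gamma> w))"
    if w: "w \<in> W" for w
  proof (cases "w = u")
    case False
    have vw: "adj G v w" using w by (simp add: W_def)
    have "c' < ennreal (len G v w) - lowG k v w"
      using c'(2) unfolding upp_def best_def
      by (rule less_le_trans) (use vw False in \<open>auto intro: INF_lower\<close>)
    then obtain s' where s': "lowG k v w < s'"
      "\<forall>\<^sub>F l' in nhds (len G v w). \<forall>t<s'. c' < ennreal l' - t" by (rule ennreal_diff_lsc)
    show ?thesis
      by (rule ev_chart_mono[OF ev_chart_conj[OF low_usc[OF uv(2) is_networkD(2)[OF G vw] s'(1)] ev_chart_len[OF vw s'(2)]]]) blast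
  qed (auto intro: ev_chart_True)
  moreover have "finite W" unfolding W_def by (rule finite_short_edges[OF G uv(2)])
  ultimately have 1: "ev_chart (\<lambda>r n \<gamma>. \<forall>w\<in>W. w \<noteq> u \<longrightarrow> 
      c' < ennreal (len (net_of n) (\<gamma> v) (\<gamma> w)) - lowS n k (\<gamma> v) (\<gamma> w))"
    by (intro ev_chart_ball_finite)
  show ?thesis
  proof (rule ev_chart_mono[OF ev_chart_conj[OF 1 ev_chart_nbrs[OF uv(2), of K]]])
    fix r n \<gamma>
    assume *: "(\<forall>w\<in>W. w \<noteq> u \<longrightarrow> c' < ennreal (len (net_of n) (\<gamma> v) (\<gamma> w)) - lowS n k (\<gamma> v) (\<gamma> w)) \<and>
      (\<forall>w'. adj (net_of n) (\<gamma> v) w' \<and> len (net_of n) (\<gamma> v) w' < K \<longrightarrow>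
        (\<exists>w. adj G v w \<and> len G v w \<le> K \<and> w' = \<gamma> w))"
    have "c' \<le> uppS n k (\<gamma> u) (\<gamma> v)"
      unfolding upp_def best_def
    proof (rule INF_greatest)
      fix w' assume w': "w' \<in> {w. adj (net_of n) (\<gamma> v) w \<and> w \<noteq> \<gamma> u}"
      show "c' \<le> ennreal (len (net_of n) (\<gamma> v) w') - lowS n k (\<gamma> v) w'"
      proof (cases "len (net_of n) (\<gamma> v) w' < K")
        case True
        then obtain w where "w \<in> W" "w' = \<gamma> w" using * w' by (auto simp: W_def)
        then show ?thesis using * w' by (auto intro: less_imp_le)
      next
        case False
        have "c' = ennreal K - ennreal (real k)" 
          using \<kappa> by (simp add: K_def ennreal_minus)
        also have "\<dots> \<le> ennreal (len (net_of n) (\<gamma> v) w') - lowS n k (\<gamma> v) w'"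
          using False low_le[of _ _ k] by (intro ennreal_minus_mono) (auto simp: ennreal_leI ennreal_of_nat_eq_real_of_nat)
        finally show ?thesis .
      qed
    qed
    with c'(1) show "c < uppS n k (\<gamma> u) (\<gamma> v)" by (rule less_le_trans)
  qed
qed

text \<open>That an infimum is below c is witnessed by a single neighbour, and charts of large
  radius carry this neighbour along.\<close>

lemma low_usc:
  "u \<in> verts G \<Longrightarrow> v \<in> verts G \<Longrightarrow> lowG k u v < c \<Longrightarrow> ev_chart (\<lambda>r n \<gamma>. lowS n k (\<gamma> u) (\<gamma> v) < c)"
proof (induction k arbitrary: u v c)
  case 0
  then show ?case by (intro ev_chart_True) simp
next
  case (Suc k)
  show ?case
  proof (cases "of_nat (Suc k) < c")
    case True
    show ?thesis by (intro ev_chart_True) (use True in \<open>simp only: low_Suc min_less_iff_disj simp_thms\<close>)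
  next
    case False
    then have "best (adj G) (len G) (uppG k) u v < c"
      using Suc.prems(3) unfolding low_Suc min_less_iff_disj by blast
    then obtain w where w: "adj G v w" "w \<noteq> u" "ennreal (len G v w) - uppG k v w < c"
      unfolding best_def INF_less_iff by blast
    have wv: "w \<in> verts G" using is_networkD(2)[OF G w(1)] .
    have "ev_chart (\<lambda>r n \<gamma>. ennreal (len (net_of n) (\<gamma> v) (\<gamma> w)) - uppS n k (\<gamma> v) (\<gamma> w) < c)"
    proof (cases "uppG k v w = 0")
      case True
      then have "\<forall>\<^sub>F l' in nhds (len G v w). ennreal l' < c"
        using w(3) by (intro eventually_ennreal_less) simp
      from ev_chart_len[OF w(1) this] show ?thesis
        by (rule ev_chart_mono) (rule le_less_trans[rotated], assumption, simp add: diff_le_self_ennreal)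
    next
      case False
      then have "0 < uppG k v w" by (simp add: zero_less_iff_neq_zero)
      then obtain s' where s': "s' < uppG k v w" "\<forall>\<^sub>F l' in nhds (len G v w). \<forall>t>s'. ennreal l' - t < c"
        using w(3) ennreal_diff_usc by blast
      show ?thesis
        by (rule ev_chart_mono[OF ev_chart_conj[OF upp_lsc_step[OF Suc.IH Suc.prems(2) wv s'(1)] ev_chart_len[OF w(1) s'(2)]]])
          blast+
    qed
    from ev_chart_conj[OF this ev_chart_conj[OF ev_chart_adj[OF Suc.prems(2) wv] ev_chart_adj[OF wv Suc.prems(1)]]]
    show ?thesis
      unfolding low_Suc min_less_iff_disj best_def INF_less_iff
      by (rule ev_chart_mono) (use w(1,2) in blast)
  qed
qed

lemma upp_lsc:
  "u \<in> verts G \<Longrightarrow> v \<in> verts G \<Longrightarrow> c < uppG k u v \<Longrightarrow> ev_chart (\<lambda>r n \<gamma>. c < uppS n k (\<gamma> u) (\<gamma> v))"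
  by (rule upp_lsc_step[OF low_usc])

lemma ev_chart_eventually:
  assumes "ev_chart (\<lambda>r n \<gamma>. Q n (\<gamma> a) (\<gamma> b))"
  shows "\<forall>\<^sub>F n in sequentially. Q n (root_of n) (snd (snd (S n)))"
proof -
  from ev_chart_conj[OF assms ev_chart_iso] obtain r0 where
    r0: "\<And>r \<gamma>. r \<ge> r0 \<Longrightarrow> chart r \<gamma> \<Longrightarrow> \<forall>\<^sub>F n in sequentially. Q n (\<gamma> n a) (\<gamma> n b) \<and>
      marked_iso_on G (net_ball G a r) (net_of n) (net_ball (net_of n) (root_of n) r) (\<gamma> n)
        \<and> \<gamma> n a = root_of n \<and> \<gamma> n b = snd (snd (S n))"
    unfolding ev_chart_def by blast
  obtain r \<gamma> where "r \<ge> r0" "chart r \<gamma>" using ex_chart by blast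
  from r0[OF this] show ?thesis by (rule eventually_mono) auto
qed

end

text \<open>The topology is defined by convergent sequences, so a property that eventually persists
  along them defines an open set. The measurability of the basic functions on networks is reduced to
  this.\<close>

lemma borel_open:
  assumes "\<And>G a b. (G, a, b) \<in> networks2 \<Longrightarrow> Q G a b \<Longrightarrow> (\<And>S. range S \<subseteq> networks2 \<Longrightarrow> local_conv S (G, a, b) \<Longrightarrow>
     \<forall>\<^sub>F n in sequentially. Q (fst (S n)) (fst (snd (S n))) (snd (snd (S n))))"
  shows "{g \<in> space network2_borel. Q (fst g) (fst (snd g)) (snd (snd g))} \<in> sets (network2_borel :: 'v network2 measure)"
proof -
  let ?O = "{U :: 'v network2 set. openin local_topology U}"
  have sub: "?O \<subseteq> Pow networks2"
    by (auto simp: openin_local_topology local_open_def)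
  have sp: "space network2_borel = (networks2 :: 'v network2 set)"
    "sets network2_borel = sigma_sets networks2 ?O"
    using sub by (simp_all add: network2_borel_def space_measure_of sets_measure_of)
  have "local_open {g \<in> networks2. Q (fst g) (fst (snd g)) (snd (snd g))}"
    unfolding local_open_def
  proof (intro conjI ballI allI impI)
    fix g S assume g: "g \<in> {g \<in> networks2. Q (fst g) (fst (snd g)) (snd (snd g))}"
      and S: "range S \<subseteq> networks2 \<and> local_conv S g"
    obtain G a b where [simp]: "g = (G, a, b)" by (cases g)
    have "\<forall>\<^sub>F n in sequentially. Q (fst (S n)) (fst (snd (S n))) (snd (snd (S n)))"
      using g S by (intro assms[of G a b]) auto
    then show "\<forall>\<^sub>F n in sequentially. S n \<in> {g \<in> networks2. Q (fst g) (fst (snd g)) (snd (snd g))}"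
      by (rule eventually_mono) (use S in auto)
  qed auto
  then show ?thesis unfolding sp by (intro sigma_sets.Basic) (simp add: openin_local_topology)
qed

section \<open>Borel functions of a network with two distinguished vertices\<close>

definition net_low :: "nat \<Rightarrow> 'v network2 \<Rightarrow> ennreal" where
  "net_low k = (\<lambda>(G, a, b). low (adj G) (len G) k a b)"

definition net_upp :: "nat \<Rightarrow> 'v network2 \<Rightarrow> ennreal" where
  "net_upp k = (\<lambda>(G, a, b). upp (adj G) (len G) k a b)"

definition net_swap :: "'v network2 \<Rightarrow> 'v network2" where
  "net_swap = (\<lambda>(G, a, b). (G, b, a))"

lemma networks2D: "(G, a, b) \<in> networks2 \<Longrightarrow> is_network G" "(G, a, b) \<in> networks2 \<Longrightarrow> a \<in> verts G"
  "(G, a, b) \<in> networks2 \<Longrightarrow> b \<in> verts G"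
  by (auto simp: networks2_def)

lemma measurable_net_low [measurable]: "net_low k \<in> borel_measurable (network2_borel :: 'v network2 measure)"
proof (rule borel_measurableI_less)
  fix c show "{g \<in> space (network2_borel :: 'v network2 measure). net_low k g < c} \<in> sets network2_borel"
    unfolding net_low_def case_prod_beta
  proof (rule borel_open[where Q = "\<lambda>(G::'v network) a b. low (adj G) (len G) k a b < c"])
    fix G :: "'v network" and a b S
    assume g: "(G, a, b) \<in> networks2" "low (adj G) (len G) k a b < c" 
      and S: "range S \<subseteq> networks2" "local_conv S (G, a, b)"
    note ctx = networks2D[OF g(1)] S
    show "\<forall>\<^sub>F n in sequentially. low (adj (fst (S n))) (len (fst (S n))) k (fst (snd (S n))) (snd (snd (S n))) < c"
      using ev_chart_eventually[OF ctx low_usc[OF ctx ctx(2,3) g(2)]]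
      by (simp add: net_of_def[OF ctx] root_of_def[OF ctx])
  qed
qed

text \<open>\<open>local_conv\<close> centres its balls at the first vertex, so exchanging the
  vertices is not an obvious symmetry of the topology. But \<open>low_usc\<close> holds for all
  pairs of vertices and also gives the exchanged version.\<close>

lemma measurable_net_low_swap [measurable]: "(\<lambda>g. net_low k (net_swap g)) \<in> borel_measurable (network2_borel :: 'v network2 measure)"
proof (rule borel_measurableI_less)
  fix c show "{g \<in> space (network2_borel :: 'v network2 measure). net_low k (net_swap g) < c} \<in> sets network2_borel"
    unfolding net_low_def net_swap_def case_prod_beta fst_conv snd_conv
  proof (rule borel_open[where Q = "\<lambda>(G::'v network) a b. low (adj G) (len G) k b a < c"])
    fix G :: "'v network" and a b S
    assume g: "(G, a, b) \<in> networks2" "low (adj G) (len G) k b a < c" 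
      and S: "range S \<subseteq> networks2" "local_conv S (G, a, b)"
    note ctx = networks2D[OF g(1)] S
    show "\<forall>\<^sub>F n in sequentially. low (adj (fst (S n))) (len (fst (S n))) k (snd (snd (S n))) (fst (snd (S n))) < c"
      using ev_chart_eventually[OF ctx low_usc[OF ctx ctx(3,2) g(2)]]
      by (simp add: net_of_def[OF ctx] root_of_def[OF ctx])
  qed
qed

lemma measurable_net_upp [measurable]: "net_upp k \<in> borel_measurable (network2_borel :: 'v network2 measure)"
proof (rule borel_measurableI_greater)
  fix c show "{g \<in> space (network2_borel :: 'v network2 measure). c < net_upp k g} \<in> sets network2_borel"
    unfolding net_upp_def case_prod_beta
  proof (rule borel_open[where Q = "\<lambda>(G::'v network) a b. c < upp (adj G) (len G) k a b"])
    fix G :: "'v network" and a b S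
    assume g: "(G, a, b) \<in> networks2" "c < upp (adj G) (len G) k a b" 
      and S: "range S \<subseteq> networks2" "local_conv S (G, a, b)"
    note ctx = networks2D[OF g(1)] S
    show "\<forall>\<^sub>F n in sequentially. c < upp (adj (fst (S n))) (len (fst (S n))) k (fst (snd (S n))) (snd (snd (S n)))"
      using ev_chart_eventually[OF ctx upp_lsc[OF ctx ctx(2,3) g(2)]]
      by (simp add: net_of_def[OF ctx] root_of_def[OF ctx])
  qed
qed

lemma measurable_net_mark [measurable]: 
  "Measurable.pred (network2_borel :: 'v network2 measure) (\<lambda>g. adj (fst g) (fst (snd g)) (snd (snd g)) \<and> mark (fst g) (fst (snd g)) (snd (snd g)))"
  unfolding pred_def
proof (rule borel_open)
  fix G :: "'v network" and a b S
  assume g: "(G, a, b) \<in> networks2" "adj G a b \<and> mark G a b" 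
    and S: "range S \<subseteq> networks2" "local_conv S (G, a, b)"
  note ctx = networks2D[OF g(1)] S
  have "ev_chart S G a b (\<lambda>r n \<gamma>. adj (net_of S n) (\<gamma> a) (\<gamma> b) \<and> mark (net_of S n) (\<gamma> a) (\<gamma> b))"
    using ev_chart_mono[OF ctx ev_chart_adj[OF ctx ctx(2,3)]] g(2) by simp
  from ev_chart_eventually[OF ctx this]
  show "\<forall>\<^sub>F n in sequentially. adj (fst (S n)) (fst (snd (S n))) (snd (snd (S n))) \<and> 
      mark (fst (S n)) (fst (snd (S n))) (snd (snd (S n)))"
    by (simp add: net_of_def[OF ctx] root_of_def[OF ctx])
qed

text \<open>Values of \<open>len\<close> on non-adjacent pairs are arbitrary and not preserved by
  isomorphisms; the default 0 removes them.\<close>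

definition net_len :: "'v network2 \<Rightarrow> ennreal" where
  "net_len = (\<lambda>(G, a, b). if adj G a b then ennreal (len G a b) else 0)"

lemma measurable_net_len [measurable]: "net_len \<in> borel_measurable (network2_borel :: 'v network2 measure)"
proof (rule borel_measurableI_greater)
  fix c :: ennreal
  have *: "c < net_len g \<longleftrightarrow> adj (fst g) (fst (snd g)) (snd (snd g)) \<and> c < ennreal (len (fst g) (fst (snd g)) (snd (snd g)))" for g :: "'v network2"
    by (auto simp: net_len_def case_prod_beta)
  show "{g \<in> space (network2_borel :: 'v network2 measure). c < net_len g} \<in> sets network2_borel"
    unfolding *
  proof (rule borel_open[where Q = "\<lambda>(G::'v network) a b. adj G a b \<and> c < ennreal (len G a b)"])
    fix G :: "'v network" and a b S
    assume g: "(G, a, b) \<in> networks2" "adj G a b \<and> c < ennreal (len G a b)" 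
      and S: "range S \<subseteq> networks2" "local_conv S (G, a, b)"
    note ctx = networks2D[OF g(1)] S
    have ab: "adj G a b" and c: "\<forall>\<^sub>F l' in nhds (len G a b). c < ennreal l'" 
      using g(2) by (auto intro: eventually_ennreal_greater)
    have "ev_chart S G a b (\<lambda>r n \<gamma>. adj (net_of S n) (\<gamma> a) (\<gamma> b) \<and> c < ennreal (len (net_of S n) (\<gamma> a) (\<gamma> b)))"
      using ev_chart_mono[OF ctx ev_chart_conj[OF ctx ev_chart_adj[OF ctx ctx(2,3)] ev_chart_len[OF ctx ab c]]] ab by simp
    from ev_chart_eventually[OF ctx this]
    show "\<forall>\<^sub>F n in sequentially. adj (fst (S n)) (fst (snd (S n))) (snd (snd (S n))) \<and> 
        c < ennreal (len (fst (S n)) (fst (snd (S n))) (snd (snd (S n))))"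
      by (simp add: net_of_def[OF ctx] root_of_def[OF ctx])
  qed
qed

section \<open>Void probabilities of the Poisson process\<close>

text \<open>The bound makes the difference quotient between two points at most their distance, so
  the derivative vanishes.\<close>

lemma constant_if_quadratic:
  fixes f :: "real \<Rightarrow> real"
  assumes f: "\<And>s t. 0 \<le> s \<Longrightarrow> s \<le> t \<Longrightarrow> \<bar>f s - f t\<bar> \<le> (t - s)\<^sup>2" and "0 \<le> s" "0 \<le> t"
  shows "f s = f t"
proof -
  have "\<exists>c. \<forall>x\<in>{0..}. f x = c"
  proof (rule has_field_derivative_zero_constant)
    fix x :: real assume x: "x \<in> {0..}"
    show "(f has_field_derivative 0) (at x within {0..})"
      unfolding has_field_derivative_iff
    proof (rule Lim_null_comparison)
      have "\<bar>f y - f x\<bar> \<le> \<bar>y - x\<bar>\<^sup>2" if "y \<in> {0..}" for y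
        using f[of x y] f[of y x] that x by (cases "x \<le> y") (auto simp: abs_minus_commute power2_commute)
      then have "norm ((f y - f x) / (y - x)) \<le> \<bar>y - x\<bar>" if "y \<in> {0..}" "y \<noteq> x" for y
        using that by (simp add: divide_le_eq power2_eq_square)
      then show "\<forall>\<^sub>F y in at x within {0..}. norm ((f y - f x) / (y - x)) \<le> \<bar>y - x\<bar>"
        by (auto simp: eventually_at_filter)
      show "((\<lambda>y. \<bar>y - x\<bar>) \<longlongrightarrow> 0) (at x within {0..})"
        by (rule tendsto_eq_intros refl tendsto_ident_at | simp)+
    qed
  qed simp
  then show ?thesis using assms(2,3) by auto
qed

section \<open>Exponential gaps\<close>

lemma tendsto_exp_minus: "((\<lambda>t::real. exp (- t)) \<longlongrightarrow> 0) at_top"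
  by (rule filterlim_compose[OF exp_at_bot filterlim_uminus_at_bot_at_top])

definition expo :: "real measure" where
  "expo = density lborel (\<lambda>x. ennreal (exponential_density 1 x))"

lemma sets_expo [measurable_cong, simp]: "sets expo = sets borel"
  and space_expo [simp]: "space expo = UNIV"
  by (simp_all add: expo_def)

lemma prob_space_expo: "prob_space expo"
  unfolding expo_def by (rule prob_space_exponential_density) simp

lemma nn_integral_expo:
  assumes [measurable]: "f \<in> borel_measurable borel"
  shows "(\<integral>\<^sup>+t. f t \<partial>expo) = (\<integral>\<^sup>+t. indicator {0..} t * ennreal (exp (- t)) * f t \<partial>lborel)"
  unfolding expo_def
  by (subst nn_integral_density)
    (auto intro!: nn_integral_cong simp: exponential_density_def split: split_indicator)

lemma AE_expo: "AE t in expo. 0 < t"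
proof -
  have "AE t in lborel. t \<noteq> (0::real)" by (rule AE_lborel_singleton)
  then show ?thesis unfolding expo_def
    by (subst AE_density) (auto simp: exponential_density_def elim!: eventually_mono)
qed

lemma emeasure_expo_less:
  assumes "0 \<le> r" shows "emeasure expo {..<r} = ennreal (1 - exp (- r))"
proof -
  have "emeasure expo {..<r} = emeasure expo {..r}"
    unfolding expo_def
    by (subst (1 2) emeasure_density)
      (auto intro!: nn_integral_cong_AE eventually_mono[OF AE_lborel_singleton[of r]] split: split_indicator)
  also have "\<dots> = ennreal (erlang_CDF 0 1 r)"
    unfolding expo_def
    using emeasure_erlang_density[of 1 0 r] by simp
  also have "\<dots> = ennreal (1 - exp (- r))"
    using assms by (simp add: erlang_CDF_def)
  finally show ?thesis .
qed

definition gaps :: "(nat \<Rightarrow> real) measure" where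
  "gaps = PiM UNIV (\<lambda>_. expo)"

lemma sets_gaps [measurable_cong]: "sets gaps = sets (PiM UNIV (\<lambda>_. borel))"
  unfolding gaps_def by (intro sets_PiM_cong) auto

lemma space_gaps [simp]: "space gaps = UNIV"
  by (simp add: gaps_def space_PiM)

lemma prob_space_gaps: "prob_space gaps"
  unfolding gaps_def by (intro prob_space_PiM prob_space_expo)

text \<open>
  With \<open>1 - q t\<close> the probability of keeping a point at \<open>t\<close>, this is the probability that all of the
  first \<open>J\<close> points of a Poisson process on \<open>[s, \<infinity>)\<close> are kept.
\<close>

definition void_fn :: "(real \<Rightarrow> real) \<Rightarrow> nat \<Rightarrow> real \<Rightarrow> ennreal" where
  "void_fn q J s = (\<integral>\<^sup>+\<omega>. (\<Prod>j<J. ennreal (1 - q (s + (\<Sum>i\<le>j. \<omega> i)))) \<partial>gaps)"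

text \<open>Renewal at the first point: an independent exponential gap put in front of a gap
  sequence gives a gap sequence again.\<close>

lemma void_fn_Suc:
  assumes [measurable]: "q \<in> borel_measurable borel"
  shows "void_fn q (Suc J) s = (\<integral>\<^sup>+t. ennreal (1 - q (s + t)) * void_fn q J (s + t) \<partial>expo)"
proof -
  interpret E: prob_space expo by (rule prob_space_expo)
  interpret sequence_space expo by unfold_locales
  interpret P: pair_sigma_finite expo gaps
    unfolding gaps_def by unfold_locales
  have D: "distr (expo \<Otimes>\<^sub>M gaps) gaps (\<lambda>(t, \<omega>). case_nat t \<omega>) = gaps"
    using PiM_iter unfolding gaps_def .
  have [measurable]: "(\<lambda>(t, \<omega>). case_nat t \<omega>) \<in> expo \<Otimes>\<^sub>M gaps \<rightarrow>\<^sub>M gaps"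
    unfolding gaps_def by measurable
  have [measurable]: "(\<lambda>\<omega>. \<omega> i) \<in> gaps \<rightarrow>\<^sub>M borel" for i
    by measurable
  have "void_fn q (Suc J) s = (\<integral>\<^sup>+x. (\<Prod>j<Suc J. ennreal (1 - q (s + (\<Sum>i\<le>j. (case x of (t, \<omega>) \<Rightarrow> case_nat t \<omega>) i)))) \<partial>(expo \<Otimes>\<^sub>M gaps))"
    unfolding void_fn_def by (subst D[symmetric], subst nn_integral_distr) (auto)
  also have "\<dots> = (\<integral>\<^sup>+x. (case x of (t, \<omega>) \<Rightarrow> ennreal (1 - q (s + t)) * (\<Prod>j<J. ennreal (1 - q (s + t + (\<Sum>i\<le>j. \<omega> i))))) \<partial>(expo \<Otimes>\<^sub>M gaps))"
    by (intro nn_integral_cong)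
      (simp del: prod.lessThan_Suc sum.atMost_Suc add: prod.lessThan_Suc_shift sum.atMost_Suc_shift add.assoc split: prod.split)
  also have "\<dots> = (\<integral>\<^sup>+t. \<integral>\<^sup>+\<omega>. ennreal (1 - q (s + t)) * (\<Prod>j<J. ennreal (1 - q (s + t + (\<Sum>i\<le>j. \<omega> i)))) \<partial>gaps \<partial>expo)"
    by (subst P.M2.nn_integral_fst[symmetric]) auto
  also have "\<dots> = (\<integral>\<^sup>+t. ennreal (1 - q (s + t)) * void_fn q J (s + t) \<partial>expo)"
    unfolding void_fn_def by (intro nn_integral_cong nn_integral_cmult) auto
  finally show ?thesis .
qed

section \<open>Solution of the renewal equation\<close>

locale void =
  fixes q :: "real \<Rightarrow> real"
  assumes q_int: "integrable lborel q" and q0: "\<And>t. 0 \<le> q t" and q1: "\<And>t. q t \<le> 1"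
begin

lemma q_meas [measurable]: "q \<in> borel_measurable borel"
  using borel_measurable_integrable[OF q_int] by simp

text \<open>The mean number of points after s that a rate 1 process loses when a point at t is
  dropped with probability \<open>q t\<close>.\<close>

definition H :: "real \<Rightarrow> real" where "H s = (\<integral>u. indicator {s..} u * q u \<partial>lborel)"

lemma int_ind: "A \<in> sets borel \<Longrightarrow> integrable lborel (\<lambda>u. indicator A u * q u)"
  using integrable_mult_indicator[of A lborel q] q_int by simp

lemma H_nonneg: "0 \<le> H s"
  unfolding H_def by (intro Bochner_Integration.integral_nonneg) (simp add: q0)

lemma H_diff:
  assumes "s \<le> t"
  shows "H s - H t = (\<integral>u. indicator {s..<t} u * q u \<partial>lborel)"
  unfolding H_def using assms
  by (subst Bochner_Integration.integral_diff[symmetric])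
    (auto intro!: int_ind Bochner_Integration.integral_cong split: split_indicator)

lemma H_diff_bounds:
  assumes "s \<le> t" shows "0 \<le> H s - H t" "H s - H t \<le> t - s"
proof -
  show "0 \<le> H s - H t"
    unfolding H_diff[OF assms] by (intro Bochner_Integration.integral_nonneg) (simp add: q0)
  have "(\<integral>u. indicator {s..<t} u * q u \<partial>lborel) \<le> (\<integral>u. indicator {s..<t} u \<partial>lborel)"
    using assms by (intro integral_mono int_ind) (auto simp: q1 split: split_indicator)
  then show "H s - H t \<le> t - s"
    unfolding H_diff[OF assms] using assms by simp
qed

lemma H_tendsto: "(H \<longlongrightarrow> 0) at_top"
proof -
  have "((\<lambda>s. \<integral>u. indicator {s..} u * q u \<partial>lborel) \<longlongrightarrow> (\<integral>u. 0 \<partial>(lborel::real measure))) at_top"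
  proof (rule integral_dominated_convergence_at_top[where w = q])
    show "\<forall>\<^sub>F s in at_top. AE u in lborel. norm (indicator {s..} u * q u) \<le> q u"
      by (auto split: split_indicator simp: q0)
    show "AE u in lborel. ((\<lambda>s. indicator {s..} u * q u) \<longlongrightarrow> 0) at_top"
    proof (rule AE_I2)
      fix u :: real
      have "\<forall>\<^sub>F s in at_top. indicator {s..} u * q u = 0"
        using eventually_gt_at_top[of u] by eventually_elim simp
      then show "((\<lambda>s. indicator {s..} u * q u) \<longlongrightarrow> 0) at_top" by (rule tendsto_eventually)
    qed
  qed (auto intro: q_int int_ind)
  then show ?thesis by (simp add: H_def[abs_def])
qed

lemma H_mono: "s \<le> t \<Longrightarrow> H t \<le> H s"
  using H_diff_bounds(1) by force

lemma H_meas [measurable]: "H \<in> borel_measurable borel"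
proof -
  have "(\<lambda>s. - H s) \<in> borel_measurable borel"
    by (rule borel_measurable_mono) (auto intro!: monoI H_mono)
  then have "(\<lambda>s. - (- H s)) \<in> borel_measurable borel" by measurable
  then show ?thesis by simp
qed

text \<open>After multiplication by \<open>exp (- s)\<close>, the renewal equation
  \<open>exp_H_fixed_point\<close> for \<open>exp (- H s)\<close> becomes
  \<open>W s = I s\<close>.\<close>

definition W :: "real \<Rightarrow> real" where "W s = exp (- s - H s)"
definition I :: "real \<Rightarrow> real" where "I s = (\<integral>u. indicator {s..} u * ((1 - q u) * W u) \<partial>lborel)"

lemma W_meas [measurable]: "W \<in> borel_measurable borel"
  unfolding W_def by measurable

lemma W_le: "W s \<le> exp (- s)" "0 < W s"
  using H_nonneg by (simp_all add: W_def)

lemma W_mono: "s \<le> t \<Longrightarrow> W t \<le> W s"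
  using H_diff_bounds(2)[of s t] by (simp add: W_def)

lemma fixes s :: real shows exp_int: "integrable lborel (\<lambda>u. indicator {s..} u * exp (- u))" 
  and exp_integral: "(\<integral>u. indicator {s..} u * exp (- u) \<partial>lborel) = exp (- s)"
proof -
  have "(\<integral>\<^sup>+u. ennreal (exp (- u)) * indicator {s..} u \<partial>lborel) = ennreal (0 - (- exp (- s)))"
    by (rule nn_integral_FTC_atLeast[where F = "\<lambda>u. - exp (- u)"])
      (use tendsto_minus[OF tendsto_exp_minus] in \<open>auto intro!: derivative_eq_intros\<close>)
  then have "has_bochner_integral lborel (\<lambda>u. exp (- u) * indicator {s..} u) (exp (- s))"
    by (intro has_bochner_integral_nn_integral) (auto simp: ennreal_mult ennreal_indicator)
  then show "integrable lborel (\<lambda>u. indicator {s..} u * exp (- u))" 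
    "(\<integral>u. indicator {s..} u * exp (- u) \<partial>lborel) = exp (- s)"
    by (auto simp: has_bochner_integral_iff mult.commute)
qed

lemma I_int: "A \<in> sets borel \<Longrightarrow> A \<subseteq> {s..} \<Longrightarrow> integrable lborel (\<lambda>u. indicator A u * ((1 - q u) * W u))"
proof (rule Bochner_Integration.integrable_bound[OF exp_int[of s]])
  assume A: "A \<in> sets borel" "A \<subseteq> {s..}"
  then show "(\<lambda>u. indicator A u * ((1 - q u) * W u)) \<in> borel_measurable lborel" by measurable
  have "(1 - q u) * W u \<le> 1 * exp (- u)" for u
    using q0[of u] q1[of u] W_le[of u] by (intro mult_mono) auto
  then show "AE u in lborel. norm (indicator A u * ((1 - q u) * W u)) \<le> norm (indicator {s..} u * exp (- u))"
    using A q1 W_le(2) by (intro AE_I2) (auto split: split_indicator simp: less_imp_le)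
qed

lemma I_bounds: "0 \<le> I s" "I s \<le> exp (- s)"
proof -
  have le: "(1 - q u) * W u \<le> 1 * exp (- u)" for u
    using q0[of u] q1[of u] W_le[of u] by (intro mult_mono) auto
  have "I s \<le> (\<integral>u. indicator {s..} u * exp (- u) \<partial>lborel)"
    unfolding I_def using le by (intro integral_mono I_int exp_int) (auto split: split_indicator)
  then show "I s \<le> exp (- s)" by (simp add: exp_integral)
  show "0 \<le> I s" unfolding I_def
    using q1 W_le(2) by (intro Bochner_Integration.integral_nonneg) (auto simp: less_imp_le)
qed

text \<open>The integrand need not be continuous, so the fundamental theorem of calculus is replaced by
  an estimate showing that \<open>W - I\<close> varies quadratically.\<close>

lemma W_eq_I:
  assumes "0 \<le> s" shows "W s = I s"
proof -
  have quad: "\<bar>(W s - I s) - (W t - I t)\<bar> \<le> (t - s)\<^sup>2" if st: "0 \<le> s" "s \<le> t" for s t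
  proof -
    \<comment> \<open>This is the integral of \<open>1 - q\<close> over \<open>{s..<t}\<close>, and
      also the logarithm of \<open>W s / W t\<close>. Monotonicity of \<open>W\<close> puts
      \<open>I s - I t\<close> between \<open>W t * \<delta>\<close> and
      \<open>W s * \<delta>\<close>, so both differences equal \<open>W s * \<delta>\<close> up to a
      quadratic error.\<close>
    define \<delta> where "\<delta> = (t - s) - (H s - H t)"
    have \<delta>: "0 \<le> \<delta>" "\<delta> \<le> t - s" using H_diff_bounds[OF st(2)] by (auto simp: \<delta>_def)
    have Wt: "W t = W s * exp (- \<delta>)"
      by (simp add: W_def \<delta>_def flip: exp_add)
    have d: "\<delta> = (\<integral>u. indicator {s..<t} u * (1 - q u) \<partial>lborel)"
    proof -
      have "(\<integral>u. indicator {s..<t} u * (1 - q u) \<partial>lborel) = 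
          (\<integral>u. indicator {s..<t} u - indicator {s..<t} u * q u \<partial>lborel)"
        by (intro Bochner_Integration.integral_cong) (auto simp: algebra_simps)
      also have "\<dots> = \<delta>"
        using st by (subst Bochner_Integration.integral_diff) (auto intro!: int_ind simp: \<delta>_def H_diff)
      finally show ?thesis ..
    qed
    have int1: "integrable lborel (\<lambda>u. indicator {s..<t} u * (1 - q u))"
    proof -
      have "integrable lborel (\<lambda>u. indicator {s..<t} u - indicator {s..<t} u * q u)"
        using st by (intro Bochner_Integration.integrable_diff int_ind) auto
      then show ?thesis by (simp add: algebra_simps)
    qed
    have Id: "I s - I t = (\<integral>u. indicator {s..<t} u * ((1 - q u) * W u) \<partial>lborel)"
      unfolding I_def using st
      by (subst Bochner_Integration.integral_diff[symmetric])
        (auto intro!: I_int[where s = s] Bochner_Integration.integral_cong split: split_indicator)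
    have up: "I s - I t \<le> W s * \<delta>"
    proof -
      have "I s - I t \<le> (\<integral>u. W s * (indicator {s..<t} u * (1 - q u)) \<partial>lborel)"
        unfolding Id using int1 q1 W_mono[of s]
        by (intro integral_mono I_int[where s = s]) (auto split: split_indicator simp: mult.commute[of "W s"] intro!: mult_left_mono)
      then show ?thesis by (simp add: d)
    qed
    have lo: "W t * \<delta> \<le> I s - I t"
    proof -
      have "(\<integral>u. W t * (indicator {s..<t} u * (1 - q u)) \<partial>lborel) \<le> I s - I t"
        unfolding Id using int1 q1 W_mono[of _ t]
        by (intro integral_mono I_int[where s = s]) (auto split: split_indicator simp: mult.commute[of "W t"] intro!: mult_left_mono)
      then show ?thesis by (simp add: d)
    qed
    have e1: "1 - \<delta> \<le> exp (- \<delta>)" using exp_ge_add_one_self[of "- \<delta>"] by simp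
    have e2: "exp (- \<delta>) \<le> 1 - \<delta> + \<delta>\<^sup>2"
    proof -
      have "(1 + \<delta>) \<le> exp \<delta>" using exp_ge_add_one_self[of \<delta>] by simp
      then have "exp (- \<delta>) \<le> 1 / (1 + \<delta>)" using \<delta> by (simp add: exp_minus field_simps)
      also have "1 / (1 + \<delta>) \<le> 1 - \<delta> + \<delta>\<^sup>2" 
      proof -
        have "0 \<le> \<delta> ^ 3" using \<delta> by simp
        then have "1 \<le> (1 - \<delta> + \<delta>\<^sup>2) * (1 + \<delta>)" by (simp add: algebra_simps power2_eq_square power3_eq_cube)
        then show ?thesis using \<delta> by (simp add: divide_le_eq)
      qed
      finally show ?thesis .
    qed
    have W1: "W s \<le> 1" using W_le(1)[of s] st by (smt (verit) exp_le_one_iff)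
    have sq: "W s * \<delta>\<^sup>2 \<le> (t - s)\<^sup>2"
    proof -
      have "W s * \<delta>\<^sup>2 \<le> 1 * (t - s)\<^sup>2" using W1 \<delta> W_le(2)[of s] by (intro mult_mono power_mono) auto
      then show ?thesis by simp
    qed
    have "W s - W t - (I s - I t) \<le> W s * (1 - exp (- \<delta>)) - W s * exp (- \<delta>) * \<delta>"
      using lo unfolding Wt by (simp add: algebra_simps)
    also have "\<dots> = W s * (1 - exp (- \<delta>) * (1 + \<delta>))" by (simp add: algebra_simps)
    also have "\<dots> \<le> W s * \<delta>\<^sup>2"
    proof (rule mult_left_mono)
      have "(1 - \<delta>) * (1 + \<delta>) \<le> exp (- \<delta>) * (1 + \<delta>)" using e1 \<delta> by (intro mult_right_mono) auto
      then show "1 - exp (- \<delta>) * (1 + \<delta>) \<le> \<delta>\<^sup>2" by (simp add: algebra_simps power2_eq_square)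
    qed (use W_le(2)[of s] in simp)
    finally have A: "W s - W t - (I s - I t) \<le> (t - s)\<^sup>2" using sq by simp
    have "(I s - I t) - (W s - W t) \<le> W s * (\<delta> - 1 + exp (- \<delta>))"
      using up unfolding Wt by (simp add: algebra_simps)
    also have "\<dots> \<le> W s * \<delta>\<^sup>2" using e2 W_le(2)[of s] by (intro mult_left_mono) auto
    finally have "(I s - I t) - (W s - W t) \<le> (t - s)\<^sup>2" using sq by simp
    with A show ?thesis by (simp add: abs_le_iff)
  qed
  have const: "W s - I s = W t - I t" if "0 \<le> s" "0 \<le> t" for s t
    by (rule constant_if_quadratic[where f = "\<lambda>s. W s - I s", OF quad that])
  \<comment> \<open>Both functions decay exponentially, which identifies the constant difference as
    0.\<close>
  have "((\<lambda>t. W t - I t) \<longlongrightarrow> 0) at_top"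
  proof (rule Lim_null_comparison)
    show "\<forall>\<^sub>F t in at_top. norm (W t - I t) \<le> 2 * exp (- t)"
      by (rule always_eventually) (use W_le I_bounds in \<open>smt (verit) real_norm_def\<close>)
    show "((\<lambda>t::real. 2 * exp (- t)) \<longlongrightarrow> 0) at_top"
      using tendsto_mult_left[OF tendsto_exp_minus, of 2] by simp
  qed
  moreover have "((\<lambda>t. W t - I t) \<longlongrightarrow> W s - I s) at_top"
    by (rule tendsto_eventually) (use const[OF _ assms] in \<open>auto intro!: eventually_mono[OF eventually_ge_at_top[of 0]]\<close>)
  ultimately have "W s - I s = 0" by (intro tendsto_unique[of at_top]) auto
  then show ?thesis by simp
qed

lemma exp_H_fixed_point:
  assumes "0 \<le> s"
  shows "(\<integral>\<^sup>+t. ennreal (1 - q (s + t)) * ennreal (exp (- H (s + t))) \<partial>expo) = ennreal (exp (- H s))"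
proof -
  have "(\<integral>\<^sup>+t. ennreal (1 - q (s + t)) * ennreal (exp (- H (s + t))) \<partial>expo) =
    (\<integral>\<^sup>+t. indicator {0..} t * ennreal (exp (- t)) * (ennreal (1 - q (s + t)) * ennreal (exp (- H (s + t)))) \<partial>lborel)"
    by (subst nn_integral_expo) auto
  also have "\<dots> = (\<integral>\<^sup>+t. ennreal (exp s) * ennreal (indicator {s..} (s + t) * ((1 - q (s + t)) * W (s + t))) \<partial>lborel)"
    using q1 by (intro nn_integral_cong) (auto split: split_indicator simp: W_def exp_diff exp_minus exp_add divide_simps mult_ac simp flip: ennreal_mult)
  also have "\<dots> = ennreal (exp s) * (\<integral>\<^sup>+t. ennreal (indicator {s..} (s + t) * ((1 - q (s + t)) * W (s + t))) \<partial>lborel)"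
    by (intro nn_integral_cmult) auto
  also have "(\<integral>\<^sup>+t. ennreal (indicator {s..} (s + t) * ((1 - q (s + t)) * W (s + t))) \<partial>lborel) = 
     (\<integral>\<^sup>+u. ennreal (indicator {s..} u * ((1 - q u) * W u)) \<partial>lborel)"
    by (subst nn_integral_real_affine[where c = 1 and t = s]) auto
  also have "\<dots> = ennreal (I s)"
    unfolding I_def using q1 W_le(2)
    by (intro nn_integral_eq_integral I_int[where s = s]) (auto simp: less_imp_le)
  also have "ennreal (exp s) * ennreal (I s) = ennreal (exp (- H s))"
    unfolding W_eq_I[OF assms, symmetric] W_def by (simp flip: ennreal_mult exp_add)
  finally show ?thesis .
qed

text \<open>The renewal recursion is monotone, has \<open>exp (- H s)\<close> as a fixed point and
  starts at 1, which is above it.\<close>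

lemma void_fn_ge:
  "0 \<le> s \<Longrightarrow> ennreal (exp (- H s)) \<le> void_fn q J s"
proof (induction J arbitrary: s)
  case 0
  interpret prob_space gaps by (rule prob_space_gaps)
  show ?case using H_nonneg[of s] emeasure_space_1 by (simp add: void_fn_def)
next
  case (Suc J)
  have "AE t in expo. ennreal (1 - q (s + t)) * ennreal (exp (- H (s + t))) \<le> ennreal (1 - q (s + t)) * void_fn q J (s + t)"
    using AE_expo by eventually_elim (use Suc in \<open>auto intro!: mult_left_mono\<close>)
  then show ?case
    unfolding void_fn_Suc[OF q_meas] exp_H_fixed_point[OF Suc.prems, symmetric]
    by (rule nn_integral_mono_AE)
qed

text \<open>Beyond R the factor \<open>exp (H R)\<close> lifts the fixed point above the trivial
  bound 1. Before R the second term pays for the event that the first J points stay below R, which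
  forces all J gaps to be smaller than R.\<close>

lemma void_fn_le:
  assumes R: "0 \<le> R"
  shows "0 \<le> s \<Longrightarrow> void_fn q J s \<le> ennreal (exp (H R)) * ennreal (exp (- H s)) + ennreal ((1 - exp (- R)) ^ J) * indicator {..<R} s"
proof (induction J arbitrary: s)
  case 0
  interpret prob_space gaps by (rule prob_space_gaps)
  have "1 \<le> ennreal (exp (H R)) * ennreal (exp (- H s))" if "R \<le> s"
    using H_mono[OF that] by (simp flip: ennreal_mult exp_add)
  then show ?case using emeasure_space_1 by (auto simp: void_fn_def split: split_indicator)
next
  case (Suc J)
  let ?c = "ennreal (exp (H R))" and ?p = "ennreal ((1 - exp (- R)) ^ J)"
  show ?case
  proof (cases "s < R")
    case False
    have "void_fn q (Suc J) s \<le> (\<integral>\<^sup>+\<omega>. 1 \<partial>gaps)"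
      unfolding void_fn_def using q0 by (intro nn_integral_mono prod_le_1) (auto simp: ennreal_le_1)
    also have "\<dots> = 1" using prob_space.emeasure_space_1[OF prob_space_gaps] by simp
    also have "1 \<le> ?c * ennreal (exp (- H s))"
      using H_mono[of R s] False by (simp flip: ennreal_mult exp_add)
    finally show ?thesis using False by simp
  next
    case True
    have "void_fn q (Suc J) s \<le> (\<integral>\<^sup>+t. ?c * (ennreal (1 - q (s + t)) * ennreal (exp (- H (s + t)))) + ?p * indicator {..<R} t \<partial>expo)"
      unfolding void_fn_Suc[OF q_meas]
    proof (rule nn_integral_mono_AE, use AE_expo in eventually_elim)
      fix t :: real assume t: "0 < t"
      have "ennreal (1 - q (s + t)) * void_fn q J (s + t) \<le> 
        ennreal (1 - q (s + t)) * (?c * ennreal (exp (- H (s + t))) + ?p * indicator {..<R} (s + t))"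
        using Suc.IH[of "s + t"] t Suc.prems by (intro mult_left_mono) auto
      also have "\<dots> = ?c * (ennreal (1 - q (s + t)) * ennreal (exp (- H (s + t)))) + ennreal (1 - q (s + t)) * (?p * indicator {..<R} (s + t))"
        by (simp add: distrib_left mult_ac)
      also have "\<dots> \<le> ?c * (ennreal (1 - q (s + t)) * ennreal (exp (- H (s + t)))) + 1 * (?p * indicator {..<R} t)"
        using q0 t Suc.prems by (intro add_left_mono mult_mono) (auto split: split_indicator simp: ennreal_le_1)
      finally show "ennreal (1 - q (s + t)) * void_fn q J (s + t) \<le> ?c * (ennreal (1 - q (s + t)) * ennreal (exp (- H (s + t)))) + ?p * indicator {..<R} t"
        by simp
    qed
    also have "\<dots> = ?c * ennreal (exp (- H s)) + ?p * emeasure expo {..<R}"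
      using exp_H_fixed_point[OF Suc.prems]
      by (subst nn_integral_add) (auto simp: nn_integral_cmult nn_integral_cmult_indicator)
    also have "?p * emeasure expo {..<R} = ennreal ((1 - exp (- R)) ^ Suc J)"
      using R by (simp add: emeasure_expo_less mult.commute flip: ennreal_mult)
    finally show ?thesis using True by simp
  qed
qed

lemma INF_void_fn: "(INF J. void_fn q J 0) = ennreal (exp (- H 0))"
proof (rule antisym)
  show "ennreal (exp (- H 0)) \<le> (INF J. void_fn q J 0)"
    by (intro INF_greatest void_fn_ge) simp
  \<comment> \<open>First J tends to infinity with R fixed, then R does.\<close>
  have *: "(INF J. void_fn q J 0) \<le> ennreal (exp (H R)) * ennreal (exp (- H 0))" if R: "0 < R" for R
  proof (rule tendsto_le[OF sequentially_bot _ tendsto_const])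
    show "\<forall>\<^sub>F J in sequentially. (INF J. void_fn q J 0) \<le> ennreal (exp (H R)) * ennreal (exp (- H 0)) + ennreal ((1 - exp (- R)) ^ J)"
      using R void_fn_le[of R 0] by (intro always_eventually allI INF_lower2[OF UNIV_I]) simp
    have "(\<lambda>J. ennreal ((1 - exp (- R)) ^ J)) \<longlonglongrightarrow> ennreal 0"
      using R by (intro tendsto_ennrealI LIMSEQ_power_zero) simp
    then have "(\<lambda>J. ennreal (exp (H R)) * ennreal (exp (- H 0)) + ennreal ((1 - exp (- R)) ^ J)) \<longlonglongrightarrow> ennreal (exp (H R)) * ennreal (exp (- H 0)) + ennreal 0"
      by (intro tendsto_add tendsto_const)
    then show "(\<lambda>J. ennreal (exp (H R)) * ennreal (exp (- H 0)) + ennreal ((1 - exp (- R)) ^ J)) \<longlonglongrightarrow> ennreal (exp (H R)) * ennreal (exp (- H 0))"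
      by simp
  qed
  show "(INF J. void_fn q J 0) \<le> ennreal (exp (- H 0))"
  proof (rule tendsto_le[OF trivial_limit_at_top_linorder _ tendsto_const])
    show "\<forall>\<^sub>F R in at_top. (INF J. void_fn q J 0) \<le> ennreal (exp (H R) * exp (- H 0))"
      using eventually_gt_at_top[of 0] by eventually_elim (use * in \<open>simp add: ennreal_mult\<close>)
    have "((\<lambda>R. exp (H R) * exp (- H 0)) \<longlongrightarrow> exp 0 * exp (- H 0)) at_top"
      by (intro tendsto_intros H_tendsto)
    then show "((\<lambda>R. ennreal (exp (H R) * exp (- H 0))) \<longlongrightarrow> ennreal (exp (- H 0))) at_top"
      by (intro tendsto_ennrealI) simp
  qed
qed

end

text \<open>Layer cake formula. The strict tails fit the marks that spoil a point, the non-strict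
  ones the events \<open>ennreal x \<le> branch_min a l\<close>.\<close>

lemma nn_integral_tail:
  assumes "sigma_finite_measure M" and f [measurable]: "f \<in> borel_measurable M"
  shows nn_integral_tail_ge: "(\<integral>\<^sup>+t. indicator {0<..} t * emeasure M {x \<in> space M. ennreal t \<le> f x} \<partial>lborel) = (\<integral>\<^sup>+x. f x \<partial>M)"
    and nn_integral_tail_gt: "(\<integral>\<^sup>+t. indicator {0<..} t * emeasure M {x \<in> space M. ennreal t < f x} \<partial>lborel) = (\<integral>\<^sup>+x. f x \<partial>M)"
proof -
  interpret sigma_finite_measure M by fact
  interpret pair_sigma_finite lborel M ..
  have line: "(\<integral>\<^sup>+t. indicator {0<..} t * indicator {t. ennreal t \<le> y} t \<partial>lborel) = y"
      "(\<integral>\<^sup>+t. indicator {0<..} t * indicator {t. ennreal t < y} t \<partial>lborel) = y" for y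
  proof -
    have "(\<integral>\<^sup>+t. indicator {0<..} t * indicator {t. ennreal t \<le> y} t \<partial>lborel) = y \<and>
      (\<integral>\<^sup>+t. indicator {0<..} t * indicator {t. ennreal t < y} t \<partial>lborel) = y"
    proof (cases y)
      case (real r)
      have "(\<lambda>t. indicator {0<..} t * indicator {t. ennreal t \<le> y} t) = (indicator {0<..r} :: real \<Rightarrow> ennreal)"
        "(\<lambda>t. indicator {0<..} t * indicator {t. ennreal t < y} t) = (indicator {0<..<r} :: real \<Rightarrow> ennreal)"
        using real by (auto simp: fun_eq_iff ennreal_less_iff split: split_indicator)
      then show ?thesis using real by simp
    next
      case top
      have "emeasure lborel {0::real<..} = \<top>"
      proof (rule ccontr)
        assume "emeasure lborel {0::real<..} \<noteq> \<top>"
        then obtain n where n: "emeasure lborel {0::real<..} < of_nat n"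
          using ennreal_Ex_less_of_nat by (auto simp: less_top)
        have "of_nat n = emeasure lborel {0::real<..real n}" by (simp add: ennreal_of_nat_eq_real_of_nat)
        also have "\<dots> \<le> emeasure lborel {0::real<..}" by (intro emeasure_mono) auto
        finally show False using n by simp
      qed
      then show ?thesis using top by simp
    qed
    then show "(\<integral>\<^sup>+t. indicator {0<..} t * indicator {t. ennreal t \<le> y} t \<partial>lborel) = y"
      "(\<integral>\<^sup>+t. indicator {0<..} t * indicator {t. ennreal t < y} t \<partial>lborel) = y" by auto
  qed
  have "(\<integral>\<^sup>+t. indicator {0<..} t * emeasure M {x \<in> space M. ennreal t \<le> f x} \<partial>lborel) =
    (\<integral>\<^sup>+t. \<integral>\<^sup>+x. indicator {0<..} t * indicator {t. ennreal t \<le> f x} t \<partial>M \<partial>lborel)"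
    by (subst nn_integral_cmult) (auto simp: nn_integral_indicator[symmetric] intro!: nn_integral_cong split: split_indicator simp del: nn_integral_indicator)
  also have "\<dots> = (\<integral>\<^sup>+x. \<integral>\<^sup>+t. indicator {0<..} t * indicator {t. ennreal t \<le> f x} t \<partial>lborel \<partial>M)"
    by (rule Fubini'[symmetric]) (auto simp: indicator_def)
  finally show "(\<integral>\<^sup>+t. indicator {0<..} t * emeasure M {x \<in> space M. ennreal t \<le> f x} \<partial>lborel) = (\<integral>\<^sup>+x. f x \<partial>M)"
    by (simp add: line)
  have "(\<integral>\<^sup>+t. indicator {0<..} t * emeasure M {x \<in> space M. ennreal t < f x} \<partial>lborel) =
    (\<integral>\<^sup>+t. \<integral>\<^sup>+x. indicator {0<..} t * indicator {t. ennreal t < f x} t \<partial>M \<partial>lborel)"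
    by (subst nn_integral_cmult) (auto simp: nn_integral_indicator[symmetric] intro!: nn_integral_cong split: split_indicator simp del: nn_integral_indicator)
  also have "\<dots> = (\<integral>\<^sup>+x. \<integral>\<^sup>+t. indicator {0<..} t * indicator {t. ennreal t < f x} t \<partial>lborel \<partial>M)"
    by (rule Fubini'[symmetric]) (auto simp: indicator_def)
  finally show "(\<integral>\<^sup>+t. indicator {0<..} t * emeasure M {x \<in> space M. ennreal t < f x} \<partial>lborel) = (\<integral>\<^sup>+x. f x \<partial>M)"
    by (simp add: line)
qed

section \<open>The law of the PWIT\<close>

definition points_law :: "(nat \<Rightarrow> real) measure" where
  "points_law = distr gaps (PiM UNIV (\<lambda>_. borel)) (\<lambda>\<omega> j. \<Sum>i\<le>j. \<omega> i)"

lemma sets_points_law [measurable_cong]: "sets points_law = sets (PiM UNIV (\<lambda>_. borel))"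
  and space_points_law [simp]: "space points_law = UNIV"
  by (simp_all add: points_law_def space_PiM)

lemma measurable_partial_sums [measurable]: 
  "(\<lambda>\<omega> j. \<Sum>i\<le>j. \<omega> i :: real) \<in> gaps \<rightarrow>\<^sub>M PiM UNIV (\<lambda>_. borel)"
  by (rule measurable_PiM_single') (auto simp: space_PiM)

lemma prob_space_points_law: "prob_space points_law"
  unfolding points_law_def by (rule prob_space.prob_space_distr[OF prob_space_gaps measurable_partial_sums])

lemma nn_integral_points_law_prod:
  assumes [measurable]: "q \<in> borel_measurable borel"
  shows "(\<integral>\<^sup>+t. (\<Prod>j<J. ennreal (1 - q (t j))) \<partial>points_law) = void_fn q J 0"
  unfolding points_law_def void_fn_def by (subst nn_integral_distr) auto

lemma AE_points_law: "AE t in points_law. (\<forall>j. 0 < t j) \<and> (\<forall>j. t j < t (Suc j))"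
proof -
  have "AE \<omega> in gaps. \<forall>i. 0 < \<omega> i"
    unfolding gaps_def AE_all_countable
    by (intro allI AE_PiM_component prob_space_expo AE_expo) auto
  then have "AE \<omega> in gaps. (\<forall>j. 0 < (\<Sum>i\<le>j. \<omega> i)) \<and> (\<forall>j. (\<Sum>i\<le>j. \<omega> i) < (\<Sum>i\<le>Suc j. \<omega> i))"
    by eventually_elim (auto intro!: sum_pos)
  then show ?thesis
    unfolding points_law_def by (subst AE_distr_iff) auto
qed

text \<open>Prepending a fresh exponential gap preserves the law of the sequence, so an almost sure
  property may be checked by randomizing the first gap while the others are fixed.\<close>

lemma AE_gaps_iter:
  assumes [measurable]: "Measurable.pred gaps P"
    and ae: "AE \<omega> in gaps. AE t in expo. P (case_nat t \<omega>)"
  shows "AE \<omega> in gaps. P \<omega>"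
proof -
  interpret E: prob_space expo by (rule prob_space_expo)
  interpret G: prob_space gaps by (rule prob_space_gaps)
  interpret sequence_space expo by unfold_locales
  interpret Q: pair_sigma_finite expo gaps ..
  have D: "distr (expo \<Otimes>\<^sub>M gaps) gaps (\<lambda>(t, \<omega>). case_nat t \<omega>) = gaps"
    using PiM_iter unfolding gaps_def .
  have [measurable]: "(\<lambda>(t, \<omega>). case_nat t \<omega>) \<in> expo \<Otimes>\<^sub>M gaps \<rightarrow>\<^sub>M gaps"
    unfolding gaps_def by measurable
  have m: "Measurable.pred (expo \<Otimes>\<^sub>M gaps) (\<lambda>x. P ((\<lambda>(t, \<omega>). case_nat t \<omega>) x))"
    by measurable
  have m': "Measurable.pred (expo \<Otimes>\<^sub>M gaps) (\<lambda>(t, \<omega>). P (case_nat t \<omega>))"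
    using m by (simp add: case_prod_beta')
  have "AE t in expo. AE \<omega> in gaps. P (case_nat t \<omega>)"
    using ae by (subst Q.AE_commute) (use m' in \<open>simp_all add: pred_def case_prod_beta'\<close>)
  then have "AE x in expo \<Otimes>\<^sub>M gaps. P (case_nat (fst x) (snd x))"
    by (intro Q.AE_pair_measure) (use m in \<open>auto simp: case_prod_beta' pred_def\<close>)
  then show ?thesis
    using assms(1) by (subst D[symmetric], subst AE_distr_iff) (auto simp: case_prod_beta' pred_def)
qed

text \<open>The first gap has a density, so for fixed other gaps it avoids any given value. Blocks
  that start later are shifted to the front by the induction.\<close>

lemma AE_gaps_sum_neq: "j \<le> w \<Longrightarrow> AE \<omega> in gaps. (\<Sum>i=j..w. \<omega> i) \<noteq> c"
proof (induction j arbitrary: w)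
  case 0
  show ?case
  proof (rule AE_gaps_iter)
    show "AE \<omega> in gaps. AE t in expo. (\<Sum>i=0..w. case_nat t \<omega> i) \<noteq> c"
    proof (rule AE_I2)
      fix \<omega> :: "nat \<Rightarrow> real"
      have "AE t in lborel. t \<noteq> c - (\<Sum>i<w. \<omega> i)" by (rule AE_lborel_singleton)
      then have "AE t in expo. t \<noteq> c - (\<Sum>i<w. \<omega> i)"
        unfolding expo_def by (subst AE_density) auto
      then show "AE t in expo. (\<Sum>i=0..w. case_nat t \<omega> i) \<noteq> c"
        by eventually_elim (auto simp: atLeast0AtMost sum.atMost_shift)
    qed
  qed measurable
next
  case (Suc j)
  then obtain w' where w: "w = Suc w'" "j \<le> w'" by (cases w) auto
  show ?case
  proof (rule AE_gaps_iter)
    have "AE \<omega> in gaps. (\<Sum>i=j..w'. \<omega> i) \<noteq> c" by (rule Suc.IH[OF w(2)])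
    then show "AE \<omega> in gaps. AE t in expo. (\<Sum>i=Suc j..w. case_nat t \<omega> i) \<noteq> c"
      by eventually_elim (simp add: w(1) sum.shift_bounds_cl_Suc_ivl del: sum.cl_ivl_Suc)
  qed measurable
qed

lemma AE_points_law_diff_neq:
  assumes "i \<noteq> j" shows "AE t in points_law. t i - t j \<noteq> c"
proof -
  have *: "AE t in points_law. t w - t j \<noteq> c" if "j < w" for j w c
  proof -
    have "(\<Sum>i\<le>w. \<omega> i) - (\<Sum>i\<le>j. \<omega> i) = (\<Sum>i=Suc j..w. \<omega> i)" for \<omega> :: "nat \<Rightarrow> real"
    proof -
      have "{..w} = {..j} \<union> {Suc j..w}" using that by auto
      then show ?thesis by (simp add: sum.union_disjoint)
    qed
    then have "AE \<omega> in gaps. (\<Sum>i\<le>w. \<omega> i) - (\<Sum>i\<le>j. \<omega> i) \<noteq> c"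
      using AE_gaps_sum_neq[of "Suc j" w c] that by simp
    then show ?thesis unfolding points_law_def by (subst AE_distr_iff) auto
  qed
  show ?thesis
  proof (cases "j < i")
    case False
    then have "AE t in points_law. t j - t i \<noteq> - c" using assms by (intro *) auto
    then show ?thesis by eventually_elim auto
  qed (rule *)
qed

section \<open>The canonical law of all lengths\<close>

definition pwit_law :: "lengths measure" where
  "pwit_law = PiM UNIV (\<lambda>_. points_law)"

lemma sets_pwit_law: "sets pwit_law = sets (PiM UNIV (\<lambda>_. PiM UNIV (\<lambda>_. borel)))"
  unfolding pwit_law_def by (intro sets_PiM_cong sets_points_law) auto

lemma space_pwit_law [simp]: "space pwit_law = UNIV"
  by (simp add: pwit_law_def space_PiM)

lemma prob_space_pwit_law: "prob_space pwit_law"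
  unfolding pwit_law_def by (intro prob_space_PiM prob_space_points_law)

lemma measurable_length [measurable]: "(\<lambda>l. l v i) \<in> borel_measurable pwit_law"
proof -
  have "(\<lambda>l. l v) \<in> PiM UNIV (\<lambda>_. PiM UNIV (\<lambda>_. borel)) \<rightarrow>\<^sub>M PiM UNIV (\<lambda>_. borel)" by measurable
  then have "(\<lambda>l. l v) \<in> pwit_law \<rightarrow>\<^sub>M PiM UNIV (\<lambda>_. borel)" 
    by (simp add: measurable_cong_sets[OF sets_pwit_law refl])
  then show ?thesis by measurable
qed

lemma poisson_process_distr:
  assumes "prob_space M" "poisson_process M 1 T"
  shows "T \<in> M \<rightarrow>\<^sub>M PiM UNIV (\<lambda>_. borel)" "distr M (PiM UNIV (\<lambda>_. borel)) T = points_law"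
proof -
  interpret prob_space M by fact
  define gap where "gap = (\<lambda>i \<omega>. T \<omega> i - (case i of 0 \<Rightarrow> 0 | Suc j \<Rightarrow> T \<omega> j))"
  have ind: "indep_vars (\<lambda>_. borel) gap UNIV" and 
    dist: "\<And>i. distributed M lborel (gap i) (\<lambda>x. ennreal (exponential_density 1 x))"
    using assms(2) by (auto simp: poisson_process_def gap_def Let_def)
  have [measurable]: "gap i \<in> borel_measurable M" for i
    using distributed_measurable[OF dist[of i]] by simp
  have T: "T \<omega> j = (\<Sum>i\<le>j. gap i \<omega>)" for \<omega> j
    by (induction j) (simp_all add: gap_def)
  have T': "T = (\<lambda>\<omega> j. \<Sum>i\<le>j. gap i \<omega>)" by (intro ext) (rule T)
  have "(\<lambda>\<omega> j. \<Sum>i\<le>j. gap i \<omega>) \<in> M \<rightarrow>\<^sub>M PiM UNIV (\<lambda>_. borel)"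
    by (rule measurable_PiM_single') (auto simp: space_PiM)
  then show Tm: "T \<in> M \<rightarrow>\<^sub>M PiM UNIV (\<lambda>_. borel)" unfolding T' .
  have "distr M borel (gap i) = expo" for i
    using distributed_distr_eq_density[OF dist[of i]] unfolding expo_def
    by (metis (no_types, lifting) distr_cong sets_lborel)
  then have g: "distr M (PiM UNIV (\<lambda>_. borel)) (\<lambda>\<omega> i. gap i \<omega>) = gaps"
    using ind unfolding gaps_def by (subst (asm) indep_vars_iff_distr_eq_PiM) (auto simp: restrict_def)
  show "distr M (PiM UNIV (\<lambda>_. borel)) T = points_law"
    unfolding points_law_def g[symmetric] T'
    by (subst distr_distr) (auto simp: comp_def intro!: measurable_PiM_single' simp: space_PiM)
qed

text \<open>Integrals and almost sure statements can be settled on the canonical space and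
  transferred to any PWIT along this map.\<close>

lemma PWIT_distr:
  assumes "PWIT M \<xi>"
  shows "\<xi> \<in> M \<rightarrow>\<^sub>M pwit_law" "distr M pwit_law \<xi> = pwit_law"
proof -
  interpret prob_space M using assms by (simp add: PWIT_def)
  have pois: "poisson_process M 1 (\<lambda>\<omega>. \<xi> \<omega> v)" for v
    using assms by (simp add: PWIT_def)
  have ind: "indep_vars (\<lambda>_. PiM UNIV (\<lambda>_. borel)) (\<lambda>v \<omega>. \<xi> \<omega> v) UNIV"
    using assms by (simp add: PWIT_def)
  note p = poisson_process_distr[OF prob_space_axioms pois]
  have "\<xi> \<in> M \<rightarrow>\<^sub>M PiM UNIV (\<lambda>_. PiM UNIV (\<lambda>_. borel))"
    by (rule measurable_PiM_single') (use p(1) in \<open>auto simp: space_PiM\<close>)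
  then show m: "\<xi> \<in> M \<rightarrow>\<^sub>M pwit_law" by (simp add: measurable_cong_sets[OF refl sets_pwit_law])
  have "distr M (PiM UNIV (\<lambda>_. PiM UNIV (\<lambda>_. borel))) (\<lambda>\<omega> v. \<xi> \<omega> v) = pwit_law"
    using ind p unfolding pwit_law_def by (subst (asm) indep_vars_iff_distr_eq_PiM) (auto simp: restrict_def)
  moreover have "distr M pwit_law \<xi> = distr M (PiM UNIV (\<lambda>_. PiM UNIV (\<lambda>_. borel))) (\<lambda>\<omega> v. \<xi> \<omega> v)"
    by (intro distr_cong) (auto simp: sets_pwit_law)
  ultimately show "distr M pwit_law \<xi> = pwit_law" by simp
qed

section \<open>Independence of the branches at the root\<close>

definition subtree :: "vertex \<Rightarrow> lengths \<Rightarrow> lengths" where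
  "subtree v l = (\<lambda>w. l (v @ w))"

lemma distr_subtree: "subtree v \<in> pwit_law \<rightarrow>\<^sub>M pwit_law" "distr pwit_law pwit_law (subtree v) = pwit_law"
proof -
  show m: "subtree v \<in> pwit_law \<rightarrow>\<^sub>M pwit_law"
    unfolding subtree_def pwit_law_def by (rule measurable_PiM_single') (auto simp: space_PiM)
  have "distr (PiM UNIV (\<lambda>_. points_law)) (PiM UNIV (\<lambda>_. points_law)) (\<lambda>\<omega>. \<lambda>n\<in>UNIV. \<omega> (v @ n)) = PiM (UNIV::vertex set) (\<lambda>_. points_law)"
    by (rule distr_PiM_reindex) (auto simp: prob_space_points_law inj_on_def)
  then show "distr pwit_law pwit_law (subtree v) = pwit_law"
    by (simp add: pwit_law_def subtree_def[abs_def] restrict_def)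
qed

lemma measurable_subtree: "a \<in> pwit_law \<rightarrow>\<^sub>M N \<Longrightarrow> (\<lambda>l. a (subtree v l)) \<in> pwit_law \<rightarrow>\<^sub>M N"
  by (rule measurable_compose[OF distr_subtree(1)])

text \<open>The row of lengths at the root and the subtrees below its children use disjoint blocks
  of coordinates of the product, and each subtree is distributed like the whole tree.\<close>

lemma pwit_law_joint:
  fixes a :: "lengths \<Rightarrow> ennreal"
  assumes [measurable]: "a \<in> borel_measurable pwit_law"
  shows "distr pwit_law (PiM UNIV (\<lambda>_. borel) \<Otimes>\<^sub>M PiM UNIV (\<lambda>_. borel)) (\<lambda>l. (l [], \<lambda>j::nat. a (subtree [j] l))) =
    points_law \<Otimes>\<^sub>M PiM UNIV (\<lambda>_. distr pwit_law borel a)"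
proof -
  interpret P: prob_space pwit_law by (rule prob_space_pwit_law)
  note [measurable] = distr_subtree(1) measurable_subtree[OF assms]
  have comp: "distr pwit_law points_law (\<lambda>l. l v) = points_law" for v
    unfolding pwit_law_def by (rule distr_PiM_component) (auto simp: prob_space_points_law)
  have coord [measurable]: "(\<lambda>l. l v) \<in> pwit_law \<rightarrow>\<^sub>M points_law" for v
    unfolding pwit_law_def by measurable
  have ind: "P.indep_vars (\<lambda>_. points_law) (\<lambda>v l. l v) UNIV"
    by (subst P.indep_vars_iff_distr_eq_PiM) 
      (auto simp: comp restrict_def coord, auto simp: pwit_law_def distr_id)
  define B :: "vertex set" where "B = {v. v \<noteq> []}"
  define K :: "nat \<Rightarrow> vertex set" where "K = (\<lambda>j. {j # w | w. True})"
  have sub: "(\<lambda>f w. f (j # w)) \<in> PiM A (\<lambda>_. points_law) \<rightarrow>\<^sub>M pwit_law" if "K j \<subseteq> A" for A j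
    unfolding pwit_law_def using that
    by (intro measurable_PiM_single' measurable_component_singleton) (auto simp: K_def space_PiM)
  have "P.indep_var (PiM {[]} (\<lambda>_. points_law)) (\<lambda>l. \<lambda>v\<in>{[]}. l v) (PiM B (\<lambda>_. points_law)) (\<lambda>l. \<lambda>v\<in>B. l v)"
    by (rule P.indep_var_restrict[OF ind]) (auto simp: B_def)
  then have pair0: "distr pwit_law (PiM {[]} (\<lambda>_. points_law)) (\<lambda>l. \<lambda>v\<in>{[]}. l v) \<Otimes>\<^sub>M distr pwit_law (PiM B (\<lambda>_. points_law)) (\<lambda>l. \<lambda>v\<in>B. l v) =
      distr pwit_law (PiM {[]} (\<lambda>_. points_law) \<Otimes>\<^sub>M PiM B (\<lambda>_. points_law)) (\<lambda>l. (\<lambda>v\<in>{[]}. l v, \<lambda>v\<in>B. l v))"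
    by (simp add: P.indep_var_distribution_eq)
  define f where "f = (\<lambda>f :: vertex \<Rightarrow> nat \<Rightarrow> real. f [])"
  define g where "g = (\<lambda>f (j::nat). a (\<lambda>w. f (j # w)))"
  have "(\<lambda>f. f []) \<in> PiM {[]::vertex} (\<lambda>_. points_law) \<rightarrow>\<^sub>M points_law" by measurable
  then have f [measurable]: "f \<in> PiM {[]::vertex} (\<lambda>_. points_law) \<rightarrow>\<^sub>M PiM UNIV (\<lambda>_. borel)"
    by (simp add: measurable_cong_sets[OF refl sets_points_law] f_def)
  have g [measurable]: "g \<in> PiM B (\<lambda>_. points_law) \<rightarrow>\<^sub>M PiM UNIV (\<lambda>_. borel)"
    unfolding g_def
    by (intro measurable_PiM_single' measurable_compose[OF sub assms]) (auto simp: K_def B_def space_PiM)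
  have r [measurable]: "(\<lambda>l. \<lambda>v\<in>A. l v) \<in> pwit_law \<rightarrow>\<^sub>M PiM A (\<lambda>_. points_law)" for A :: "vertex set"
    by (intro measurable_restrict coord)
  have fr: "f (\<lambda>v\<in>{[]}. l v) = l []" and gr: "g (\<lambda>v\<in>B. l v) = (\<lambda>j. a (subtree [j] l))" for l
    by (auto simp: f_def g_def fun_eq_iff B_def subtree_def)
  have sf: "sigma_finite_measure (distr (distr pwit_law (PiM B (\<lambda>_. points_law)) (\<lambda>l. \<lambda>v\<in>B. l v)) (PiM UNIV (\<lambda>_. borel)) g)"
    by (intro prob_space_imp_sigma_finite prob_space.prob_space_distr P.prob_space_distr) simp_all
  have "distr (distr pwit_law (PiM {[]} (\<lambda>_. points_law)) (\<lambda>l. \<lambda>v\<in>{[]}. l v)) (PiM UNIV (\<lambda>_. borel)) f \<Otimes>\<^sub>M 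
      distr (distr pwit_law (PiM B (\<lambda>_. points_law)) (\<lambda>l. \<lambda>v\<in>B. l v)) (PiM UNIV (\<lambda>_. borel)) g =
     distr (distr pwit_law (PiM {[]} (\<lambda>_. points_law) \<Otimes>\<^sub>M PiM B (\<lambda>_. points_law)) (\<lambda>l. (\<lambda>v\<in>{[]}. l v, \<lambda>v\<in>B. l v)))
       (PiM UNIV (\<lambda>_. borel) \<Otimes>\<^sub>M PiM UNIV (\<lambda>_. borel)) (\<lambda>(x, y). (f x, g y))"
    unfolding pair0[symmetric] by (rule pair_measure_distr[OF _ _ sf]) simp_all
  then have pair: "distr pwit_law (PiM UNIV (\<lambda>_. borel)) (\<lambda>l. l []) \<Otimes>\<^sub>M distr pwit_law (PiM UNIV (\<lambda>_. borel)) (\<lambda>l j. a (subtree [j] l)) =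
    distr pwit_law (PiM UNIV (\<lambda>_. borel) \<Otimes>\<^sub>M PiM UNIV (\<lambda>_. borel)) (\<lambda>l. (l [], \<lambda>j::nat. a (subtree [j] l)))"
    by (simp add: distr_distr comp_def fr gr)
  have "P.indep_vars (\<lambda>j. PiM (K j) (\<lambda>_. points_law)) (\<lambda>j l. \<lambda>v\<in>K j. l v) UNIV"
    by (rule P.indep_vars_restrict[OF ind]) (auto simp: K_def disjoint_family_on_def)
  then have "P.indep_vars (\<lambda>j. borel) (\<lambda>j. (\<lambda>f. a (\<lambda>w. f (j # w))) \<circ> (\<lambda>l. \<lambda>v\<in>K j. l v)) UNIV"
    by (rule P.indep_vars_compose) (intro measurable_compose[OF sub assms] order_refl)
  also have "(\<lambda>j. (\<lambda>f. a (\<lambda>w. f (j # w))) \<circ> (\<lambda>l. \<lambda>v\<in>K j. l v)) = (\<lambda>j l. a (subtree [j] l))"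
    by (auto simp: fun_eq_iff K_def subtree_def)
  finally have marks0: "distr pwit_law (PiM UNIV (\<lambda>_. borel)) (\<lambda>l j. a (subtree [j] l)) = PiM UNIV (\<lambda>j. distr pwit_law borel (\<lambda>l. a (subtree [j] l)))"
    by (subst (asm) P.indep_vars_iff_distr_eq_PiM) (auto simp: restrict_def)
  have "distr pwit_law borel (\<lambda>l. a (subtree [j] l)) = distr (distr pwit_law pwit_law (subtree [j])) borel a" for j
    by (subst distr_distr) (auto simp: comp_def)
  then have marks: "distr pwit_law (PiM UNIV (\<lambda>_. borel)) (\<lambda>l j. a (subtree [j] l)) = PiM UNIV (\<lambda>j. distr pwit_law borel a)"
    by (simp add: marks0 distr_subtree(2))
  have "distr pwit_law (PiM UNIV (\<lambda>_. borel)) (\<lambda>l. l []) = points_law"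
    using comp[of "[]"] distr_cong[OF refl sets_points_law, of pwit_law "\<lambda>l. l []" "\<lambda>l. l []"] by simp
  then show ?thesis using pair marks by simp
qed

text \<open>This is \<open>best\<close> on an edge that enters the root of \<open>l\<close> from a
  parent outside \<open>l\<close>, so that exactly the children compete.\<close>

definition branch_min :: "(lengths \<Rightarrow> ennreal) \<Rightarrow> lengths \<Rightarrow> ennreal" where
  "branch_min a l = (INF j. ennreal (l [] j) - a (subtree [j] l))"

lemma measurable_branch_min [measurable]:
  assumes "a \<in> borel_measurable pwit_law" shows "branch_min a \<in> borel_measurable pwit_law"
proof -
  note [measurable] = measurable_subtree[OF assms]
  show ?thesis unfolding branch_min_def by measurable
qed

text \<open>A point t with mark y spoils the event iff \<open>t - y < x\<close>; as x is positive,
  truncation does not matter. The mean number of such points is the integral over t of the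
  probability of \<open>y > t - x\<close>, which is x plus the mean mark, and the void probability
  is the exponential of its negative.\<close>

lemma emeasure_branch_min:
  assumes [measurable]: "a \<in> borel_measurable pwit_law"
    and e: "(\<integral>\<^sup>+l. a l \<partial>pwit_law) = ennreal e" "0 \<le> e" and x: "0 < x"
  shows "emeasure pwit_law {l. ennreal x \<le> branch_min a l} = ennreal (exp (- (x + e)))"
proof -
  interpret P: prob_space pwit_law by (rule prob_space_pwit_law)
  interpret T: prob_space points_law by (rule prob_space_points_law)
  define D where "D = distr pwit_law borel a"
  interpret D: prob_space D unfolding D_def by (rule P.prob_space_distr) simp
  have [measurable_cong, simp]: "sets D = sets borel" by (simp add: D_def)
  have [simp]: "space D = UNIV" by (simp add: D_def)
  interpret DD: product_prob_space "\<lambda>_::nat. D" UNIV ..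
  interpret TD: pair_sigma_finite points_law "PiM UNIV (\<lambda>_::nat. D)" ..
  \<comment> \<open>Points before x always spoil the event. They need their own case because
    \<open>ennreal (t - x)\<close> collapses to 0 there and would spare a mark equal to 0. The value
    0 on negative t makes q integrable.\<close>
  define q where "q t = (if t < 0 then 0 else if t < x then 1 else measure D {y. ennreal (t - x) < y})" for t
  have qanti: "(\<lambda>t. measure D {y. ennreal (t - x) < y}) \<in> borel_measurable borel"
  proof -
    have "(\<lambda>t. - measure D {y. ennreal (t - x) < y}) \<in> borel_measurable borel"
      by (rule borel_measurable_mono)
        (auto intro!: monoI D.finite_measure_mono simp: ennreal_leI elim!: le_less_trans[rotated])
    then have "(\<lambda>t. - (- measure D {y. ennreal (t - x) < y})) \<in> borel_measurable borel" by measurable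
    then show ?thesis by simp
  qed
  have qm [measurable]: "q \<in> borel_measurable borel" 
    unfolding q_def using qanti by measurable
  have q01: "0 \<le> q t" "q t \<le> 1" for t by (auto simp: q_def)
  have "(\<integral>\<^sup>+t. ennreal (q t) \<partial>lborel) = (\<integral>\<^sup>+t. indicator {0..<x} t + indicator {x..} t * emeasure D {y. ennreal (t - x) < y} \<partial>lborel)"
    using x by (intro nn_integral_cong) (auto simp: q_def D.emeasure_eq_measure split: split_indicator)
  also have "\<dots> = ennreal x + (\<integral>\<^sup>+t. indicator {x..} t * emeasure D {y. ennreal (t - x) < y} \<partial>lborel)"
    using x qanti by (subst nn_integral_add) (auto simp: D.emeasure_eq_measure)
  also have "(\<integral>\<^sup>+t. indicator {x..} t * emeasure D {y. ennreal (t - x) < y} \<partial>lborel) = 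
      (\<integral>\<^sup>+t. indicator {x..} (x + t) * emeasure D {y. ennreal t < y} \<partial>lborel)"
    using qanti by (subst nn_integral_real_affine[where c = 1 and t = x]) (auto simp: D.emeasure_eq_measure)
  also have "\<dots> = (\<integral>\<^sup>+t. indicator {0<..} t * emeasure D {y \<in> space D. ennreal t < y} \<partial>lborel)"
    by (intro nn_integral_cong_AE eventually_mono[OF AE_lborel_singleton[of 0]]) (auto split: split_indicator)
  also have "\<dots> = (\<integral>\<^sup>+y. y \<partial>D)"
    by (rule nn_integral_tail_gt) (auto intro: D.sigma_finite_measure_axioms)
  also have "\<dots> = ennreal e"
    unfolding D_def by (subst nn_integral_distr) (auto simp: e)
  finally have qint: "(\<integral>\<^sup>+t. ennreal (q t) \<partial>lborel) = ennreal (x + e)"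
    using x e by simp
  interpret V: void q
  proof
    show "integrable lborel q"
      using qint q01 by (intro integrableI_nonneg) auto
  qed (use q01 in auto)
  have "V.H 0 = (\<integral>t. q t \<partial>lborel)"
    unfolding V.H_def by (intro Bochner_Integration.integral_cong) (auto simp: q_def)
  also have "\<dots> = x + e"
    using qint q01 x e by (subst integral_eq_nn_integral) auto
  finally have H0: "V.H 0 = x + e" .
  \<comment> \<open>Only the first J points are inspected, so that \<open>void_fn\<close> applies;
    the events decrease to the one in question.\<close>
  define A where "A J = {l. \<forall>j<J. ennreal x \<le> ennreal (l [] j) - a (subtree [j] l)}" for J :: nat
  note [measurable] = measurable_subtree[OF assms(1)]
  have A_sets [measurable]: "A J \<in> sets pwit_law" for J
  proof -
    have "{l \<in> space pwit_law. \<forall>j<J. ennreal x \<le> ennreal (l [] j) - a (subtree [j] l)} \<in> sets pwit_law"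
      by measurable
    then show ?thesis by (simp add: A_def)
  qed
  have A: "emeasure pwit_law (A J) = void_fn q J 0" for J
  proof -
    define B where "B = {z \<in> space (PiM UNIV (\<lambda>_. borel) \<Otimes>\<^sub>M PiM UNIV (\<lambda>_. borel)). \<forall>j<J. ennreal x \<le> ennreal (fst z j) - snd z (j::nat)}"
    have B: "B \<in> sets (PiM UNIV (\<lambda>_. borel) \<Otimes>\<^sub>M PiM UNIV (\<lambda>_. borel))"
      unfolding B_def by measurable
    have B': "B \<in> sets (points_law \<Otimes>\<^sub>M PiM UNIV (\<lambda>_. D))"
      using B by (subst sets_pair_measure_cong[OF sets_points_law sets_PiM_cong[OF refl]]) auto
    have "A J = (\<lambda>l. (l [], \<lambda>j::nat. a (subtree [j] l))) -` B \<inter> space pwit_law"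
      by (auto simp: A_def B_def space_pair_measure space_PiM)
    moreover have "(\<lambda>l. (l [], \<lambda>j::nat. a (subtree [j] l))) \<in> pwit_law \<rightarrow>\<^sub>M PiM UNIV (\<lambda>_. borel) \<Otimes>\<^sub>M PiM UNIV (\<lambda>_. borel)"
      by (intro measurable_Pair measurable_PiM_single') (auto simp: space_PiM)
    ultimately have "emeasure pwit_law (A J) = emeasure (distr pwit_law (PiM UNIV (\<lambda>_. borel) \<Otimes>\<^sub>M PiM UNIV (\<lambda>_. borel)) (\<lambda>l. (l [], \<lambda>j::nat. a (subtree [j] l)))) B"
      using B by (subst emeasure_distr) auto
    also have "\<dots> = emeasure (points_law \<Otimes>\<^sub>M PiM UNIV (\<lambda>_. D)) B"
      by (simp add: pwit_law_joint D_def)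
    also have "\<dots> = (\<integral>\<^sup>+t. emeasure (PiM UNIV (\<lambda>_. D)) (Pair t -` B) \<partial>points_law)"
      by (rule DD.emeasure_pair_measure_alt[OF B'])
    also have "\<dots> = (\<integral>\<^sup>+t. (\<Prod>j<J. ennreal (1 - q (t j))) \<partial>points_law)"
    proof (rule nn_integral_cong_AE, use AE_points_law in eventually_elim)
      fix t :: "nat \<Rightarrow> real" assume t: "(\<forall>j. 0 < t j) \<and> (\<forall>j. t j < t (Suc j))"
      have "Pair t -` B = {y \<in> space (PiM UNIV (\<lambda>_. D)). \<forall>j\<in>{..<J}. y j \<in> {y. ennreal x \<le> ennreal (t j) - y}}"
        by (auto simp: B_def space_pair_measure space_PiM)
      then have "emeasure (PiM UNIV (\<lambda>_. D)) (Pair t -` B) = (\<Prod>j<J. emeasure D {y. ennreal x \<le> ennreal (t j) - y})"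
        by (simp only:) (rule DD.emeasure_PiM_Collect, auto)
      also have "\<dots> = (\<Prod>j<J. ennreal (1 - q (t j)))"
      proof (rule prod.cong)
        fix j
        have tj: "0 < t j" using t by simp
        show "emeasure D {y. ennreal x \<le> ennreal (t j) - y} = ennreal (1 - q (t j))"
        proof (cases "t j < x")
          case True
          have "\<not> ennreal x \<le> ennreal (t j) - y" for y
          proof
            assume "ennreal x \<le> ennreal (t j) - y"
            also have "\<dots> \<le> ennreal (t j)" by (rule diff_le_self_ennreal)
            finally show False using True tj by (simp add: ennreal_le_iff)
          qed
          then show ?thesis using True tj by (simp add: q_def)
        next
          case False
          have "ennreal x \<le> ennreal (t j) - y \<longleftrightarrow> \<not> ennreal (t j - x) < y" for y
          proof (cases y)
            case (real r)
            then show ?thesis using False x by (auto simp: ennreal_minus ennreal_le_iff2 ennreal_less_iff)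
          qed (use x in auto)
          then have "{y. ennreal x \<le> ennreal (t j) - y} = space D - {y. ennreal (t j - x) < y}" by auto
          moreover have "D.prob (space D - {y. ennreal (t j - x) < y}) = 1 - D.prob {y. ennreal (t j - x) < y}"
            by (rule D.prob_compl) simp
          ultimately show ?thesis using False tj
            by (simp add: D.emeasure_eq_measure q_def)
        qed
      qed simp
      finally show "emeasure (PiM UNIV (\<lambda>_. D)) (Pair t -` B) = (\<Prod>j<J. ennreal (1 - q (t j)))" .
    qed
    also have "\<dots> = void_fn q J 0" by (rule nn_integral_points_law_prod) measurable
    finally show ?thesis .
  qed
  have "{l. ennreal x \<le> branch_min a l} = (\<Inter>J. A J)"
    by (auto simp: A_def branch_min_def le_INF_iff)
  then have "emeasure pwit_law {l. ennreal x \<le> branch_min a l} = (INF J. emeasure pwit_law (A J))"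
  proof -
    have "decseq A" by (auto simp: decseq_def A_def)
    then have "(INF J. emeasure pwit_law (A J)) = emeasure pwit_law (\<Inter>J. A J)"
      using A_sets by (intro INF_emeasure_decseq) (auto simp: P.emeasure_eq_measure)
    then show ?thesis by (simp add: \<open>{l. ennreal x \<le> branch_min a l} = (\<Inter>J. A J)\<close>)
  qed
  also have "\<dots> = ennreal (exp (- (x + e)))"
    by (simp add: A V.INF_void_fn H0)
  finally show ?thesis .
qed

text \<open>Integrate the exponential tail. A cap at k stops the integration at k, which is the
  origin of the factor \<open>1 - exp (- real k)\<close>.\<close>

lemma nn_integral_branch_min:
  assumes [measurable]: "a \<in> borel_measurable pwit_law"
    and e: "(\<integral>\<^sup>+l. a l \<partial>pwit_law) = ennreal e" "0 \<le> e"
  shows "(\<integral>\<^sup>+l. branch_min a l \<partial>pwit_law) = ennreal (exp (- e))"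
    and "(\<integral>\<^sup>+l. min (of_nat k) (branch_min a l) \<partial>pwit_law) = ennreal (exp (- e) * (1 - exp (- real k)))"
proof -
  interpret P: prob_space pwit_law by (rule prob_space_pwit_law)
  have "(\<integral>\<^sup>+l. branch_min a l \<partial>pwit_law) = (\<integral>\<^sup>+t. indicator {0<..} t * emeasure pwit_law {l \<in> space pwit_law. ennreal t \<le> branch_min a l} \<partial>lborel)"
    by (rule nn_integral_tail_ge[symmetric]) (auto intro: P.sigma_finite_measure_axioms)
  also have "\<dots> = (\<integral>\<^sup>+t. ennreal (exp (- e) * exp (- t)) * indicator {0..} t \<partial>lborel)"
    by (intro nn_integral_cong_AE eventually_mono[OF AE_lborel_singleton[of 0]])
      (auto simp: emeasure_branch_min[OF assms] exp_add[symmetric] add.commute split: split_indicator)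
  also have "\<dots> = ennreal (0 - (- (exp (- e) * exp (- 0))))"
    by (rule nn_integral_FTC_atLeast[where F = "\<lambda>u. - (exp (- e) * exp (- u))"])
      (use tendsto_minus[OF tendsto_mult_left[OF tendsto_exp_minus]] in \<open>auto intro!: derivative_eq_intros\<close>)
  finally show "(\<integral>\<^sup>+l. branch_min a l \<partial>pwit_law) = ennreal (exp (- e))" by simp
  have "(\<integral>\<^sup>+l. min (of_nat k) (branch_min a l) \<partial>pwit_law) = 
     (\<integral>\<^sup>+t. indicator {0<..} t * emeasure pwit_law {l \<in> space pwit_law. ennreal t \<le> min (of_nat k) (branch_min a l)} \<partial>lborel)"
    by (rule nn_integral_tail_ge[symmetric]) (auto intro: P.sigma_finite_measure_axioms)
  also have "\<dots> = (\<integral>\<^sup>+t. ennreal (exp (- e) * exp (- t)) * indicator {0..real k} t \<partial>lborel)"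
    by (intro nn_integral_cong_AE eventually_mono[OF AE_lborel_singleton[of 0]])
      (auto simp: emeasure_branch_min[OF assms] exp_add[symmetric] add.commute ennreal_of_nat_eq_real_of_nat ennreal_le_iff split: split_indicator)
  also have "\<dots> = ennreal (- (exp (- e) * exp (- real k)) - (- (exp (- e) * exp (- 0))))"
    by (rule nn_integral_FTC_Icc[where F = "\<lambda>u. - (exp (- e) * exp (- u))"])
      (auto intro!: derivative_eq_intros)
  finally show "(\<integral>\<^sup>+l. min (of_nat k) (branch_min a l) \<partial>pwit_law) = ennreal (exp (- e) * (1 - exp (- real k)))"
    by (simp add: algebra_simps)
qed

section \<open>Convergence of the iterates\<close>

lemma best_antimono:
  assumes "\<And>v w. R v w \<Longrightarrow> h v w \<le> h' v w"
  shows "best R l h' u v \<le> best R l h u v"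
  unfolding best_def by (intro INF_mono) (use assms in \<open>auto intro!: ennreal_minus_mono\<close>)

lemma low_le_Suc: "low R l n u v \<le> low R l (Suc n) u v"
proof (induction n arbitrary: u v)
  case (Suc n)
  have "best R l (upp R l n) u v \<le> best R l (upp R l (Suc n)) u v"
    by (rule best_antimono) (unfold upp_def, rule best_antimono, rule Suc)
  moreover have "of_nat (Suc n) \<le> (of_nat (Suc (Suc n)) :: ennreal)" by (intro of_nat_mono) simp
  ultimately show ?case unfolding low_Suc by (rule min.mono[rotated])
qed simp

lemma low_mono: "m \<le> n \<Longrightarrow> low R l m u v \<le> low R l n u v"
  by (rule lift_Suc_mono_le[of "\<lambda>n. low R l n u v"]) (rule low_le_Suc)

lemma upp_antimono: "m \<le> n \<Longrightarrow> upp R l n u v \<le> upp R l m u v"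
  unfolding upp_def by (rule best_antimono) (rule low_mono)

lemma low_le_upp: "low R l n u v \<le> upp R l n u v"
proof (induction n arbitrary: u v)
  case (Suc n)
  have 1: "best R l (upp R l n) u v \<le> upp R l n u v" for u v
    unfolding upp_def[of R l n] by (rule best_antimono) (unfold upp_def[symmetric], rule Suc)
  have "low R l (Suc n) u v \<le> best R l (upp R l n) u v" unfolding low_Suc by simp
  also have "\<dots> \<le> upp R l (Suc n) u v"
    unfolding upp_def[of R l "Suc n"]
  proof (rule best_antimono)
    fix v w
    have "low R l (Suc n) v w \<le> best R l (upp R l n) v w" unfolding low_Suc by simp
    also note 1
    finally show "low R l (Suc n) v w \<le> upp R l n v w" .
  qed
  finally show ?case .
qed simp

definition lowlim :: "('v \<Rightarrow> 'v \<Rightarrow> bool) \<Rightarrow> ('v \<Rightarrow> 'v \<Rightarrow> real) \<Rightarrow> 'v \<Rightarrow> 'v \<Rightarrow> ennreal" where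
  "lowlim R l u v = (SUP n. low R l n u v)"

definition upplim :: "('v \<Rightarrow> 'v \<Rightarrow> bool) \<Rightarrow> ('v \<Rightarrow> 'v \<Rightarrow> real) \<Rightarrow> 'v \<Rightarrow> 'v \<Rightarrow> ennreal" where
  "upplim R l u v = (INF n. upp R l n u v)"

text \<open>Two infima commute, and subtraction turns the supremum into an infimum. Expressing the
  lower limit by the upper one in the same way would mean exchanging a supremum with an
  infimum.\<close>

lemma upplim_eq: "upplim R l u v = best R l (lowlim R l) u v"
proof -
  have "upplim R l u v = (INF w\<in>{w. R v w \<and> w \<noteq> u}. INF n. ennreal (l v w) - low R l n v w)"
    unfolding upplim_def upp_def best_def by (rule INF_commute)
  also have "\<dots> = best R l (lowlim R l) u v"
    unfolding best_def lowlim_def by (intro INF_cong refl ennreal_SUP_const_minus) auto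
  finally show ?thesis .
qed

lemma low_le_fixed_point_le_upp:
  assumes fp: "\<And>u v. R u v \<Longrightarrow> y u v = best R l y u v"
  shows "R u v \<Longrightarrow> low R l n u v \<le> y u v" "R u v \<Longrightarrow> y u v \<le> upp R l n u v"
proof -
  have "(\<forall>u v. R u v \<longrightarrow> low R l n u v \<le> y u v) \<and> (\<forall>u v. R u v \<longrightarrow> y u v \<le> upp R l n u v)"
  proof (induction n)
    case 0
    have "y u v \<le> upp R l 0 u v" if "R u v" for u v
      unfolding upp_def fp[OF that] by (rule best_antimono) simp
    then show ?case by simp
  next
    case (Suc n)
    have 1: "low R l (Suc n) u v \<le> y u v" if "R u v" for u v
    proof -
      have "low R l (Suc n) u v \<le> best R l (upp R l n) u v" unfolding low_Suc by simp
      also have "\<dots> \<le> y u v" unfolding fp[OF that] by (rule best_antimono) (use Suc in blast)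
      finally show ?thesis .
    qed
    have "y u v \<le> upp R l (Suc n) u v" if "R u v" for u v
      unfolding upp_def fp[OF that] by (rule best_antimono) (rule 1)
    with 1 show ?case by blast
  qed
  then show "R u v \<Longrightarrow> low R l n u v \<le> y u v" "R u v \<Longrightarrow> y u v \<le> upp R l n u v" by blast+
qed

text \<open>
  On an edge that points away from the root, \<open>low n\<close> only depends on the subtree below that edge.
\<close>

fun down_low :: "nat \<Rightarrow> lengths \<Rightarrow> ennreal" where
  "down_low 0 = (\<lambda>l. 0)"
| "down_low (Suc n) = (\<lambda>l. min (of_nat (Suc n)) (branch_min (branch_min (down_low n)) l))"

lemma best_tree:
  assumes "\<And>v j. h v (v @ [j]) = a (subtree (v @ [j]) l)"
  shows "best tree_adj (edge_len l) h v (v @ [j]) = branch_min a (subtree (v @ [j]) l)"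
proof -
  have n: "{w. tree_adj (v @ [j]) w \<and> w \<noteq> v} = range (\<lambda>i. (v @ [j]) @ [i])"
    by (auto simp: tree_adj_def)
  show ?thesis
    unfolding best_def n branch_min_def image_image edge_len_child assms
    by (simp add: subtree_def)
qed

lemma low_tree: "low tree_adj (edge_len l) n v (v @ [j]) = down_low n (subtree (v @ [j]) l)"
proof (induction n arbitrary: v j)
  case (Suc n)
  show ?case
    by (simp add: best_tree[where a = "branch_min (down_low n)"] best_tree[where a = "down_low n"] Suc)
qed simp

lemma upp_tree: "upp tree_adj (edge_len l) n v (v @ [j]) = branch_min (down_low n) (subtree (v @ [j]) l)"
  unfolding upp_def by (rule best_tree) (rule low_tree)

lemma measurable_down_low [measurable]: "down_low n \<in> borel_measurable pwit_law"
  by (induction n) (auto intro!: measurable_branch_min borel_measurable_min)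

text \<open>Any tree can be planted below an edge of another one; thus order properties of
  \<open>low\<close> and \<open>upp\<close> pass to \<open>down_low\<close> and
  \<open>branch_min\<close>.\<close>

lemma subtree_shift: "\<exists>l'. subtree [0] l' = l"
  by (rule exI[of _ "\<lambda>w. l (tl w)"]) (simp add: subtree_def)

lemma down_low_mono: "m \<le> n \<Longrightarrow> down_low m l \<le> down_low n l"
  and down_low_le: "down_low n l \<le> branch_min (down_low n) l"
  and branch_min_antimono: "m \<le> n \<Longrightarrow> branch_min (down_low n) l \<le> branch_min (down_low m) l"
proof -
  obtain l' where l': "subtree [0] l' = l" using subtree_shift by blast
  show "m \<le> n \<Longrightarrow> down_low m l \<le> down_low n l" "down_low n l \<le> branch_min (down_low n) l"
     "m \<le> n \<Longrightarrow> branch_min (down_low n) l \<le> branch_min (down_low m) l"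
    using low_mono[of m n tree_adj "edge_len l'" "[]" "[] @ [0]"] low_le_upp[of tree_adj "edge_len l'" n "[]" "[] @ [0]"]
      upp_antimono[of m n tree_adj "edge_len l'" "[]" "[] @ [0]"]
    unfolding low_tree upp_tree by (simp_all add: l')
qed

text \<open>The inner exponential is the uncapped step to \<open>upp\<close>; the outer one, with
  the last factor, is the step capped at \<open>Suc n\<close>.\<close>

fun mean_low :: "nat \<Rightarrow> real" where
  "mean_low 0 = 0"
| "mean_low (Suc n) = exp (- exp (- mean_low n)) * (1 - exp (- real (Suc n)))"

lemma mean_low_nonneg: "0 \<le> mean_low n"
  by (cases n) auto

lemma nn_integral_down_low:
  "(\<integral>\<^sup>+l. down_low n l \<partial>pwit_law) = ennreal (mean_low n)"
  "(\<integral>\<^sup>+l. branch_min (down_low n) l \<partial>pwit_law) = ennreal (exp (- mean_low n))"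
proof -
  show 1: "(\<integral>\<^sup>+l. down_low n l \<partial>pwit_law) = ennreal (mean_low n)"
  proof (induction n)
    case (Suc n)
    have "(\<integral>\<^sup>+l. branch_min (down_low n) l \<partial>pwit_law) = ennreal (exp (- mean_low n))"
      by (rule nn_integral_branch_min(1)[OF _ Suc]) (auto simp: mean_low_nonneg)
    from nn_integral_branch_min(2)[OF _ this, of "Suc n"] show ?case
      by (simp add: measurable_branch_min)
  qed simp
  show "(\<integral>\<^sup>+l. branch_min (down_low n) l \<partial>pwit_law) = ennreal (exp (- mean_low n))"
    by (rule nn_integral_branch_min(1)[OF _ 1]) (auto simp: mean_low_nonneg)
qed

text \<open>The monotone limit at first only satisfies \<open>a = exp (- exp (- a))\<close>. A
  2-cycle is impossible because the map contracts strictly on the positive reals: if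
  \<open>d = exp (- a) - a\<close> were positive, then
  \<open>d = exp (- a) - exp (- (a + d)) \<le> exp (- a) * d < d\<close>.\<close>

lemma mean_low_limit:
  obtains a where "mean_low \<longlonglongrightarrow> a" "a = exp (- a)"
proof -
  have mono: "mean_low m \<le> mean_low n" if "m \<le> n" for m n
  proof -
    have "ennreal (mean_low m) \<le> ennreal (mean_low n)"
      unfolding nn_integral_down_low(1)[symmetric] by (intro nn_integral_mono down_low_mono that)
    then show ?thesis by (simp add: mean_low_nonneg)
  qed
  have bound: "mean_low n \<le> exp (- mean_low n)" for n
  proof -
    have "ennreal (mean_low n) \<le> ennreal (exp (- mean_low n))"
      unfolding nn_integral_down_low[symmetric] by (intro nn_integral_mono down_low_le)
    then show ?thesis by simp
  qed
  have "\<forall>n. mean_low n \<le> 1"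
    using bound mean_low_nonneg by (smt (verit) exp_le_one_iff)
  moreover have "incseq mean_low" using mono by (simp add: incseq_def)
  ultimately obtain a where a: "mean_low \<longlonglongrightarrow> a"
    using incseq_convergent by metis
  have "(\<lambda>n. exp (- real (Suc n))) \<longlonglongrightarrow> 0"
    by (rule filterlim_compose[OF tendsto_exp_minus filterlim_compose[OF filterlim_real_sequentially filterlim_Suc]])
  then have "(\<lambda>n. mean_low (Suc n)) \<longlonglongrightarrow> exp (- exp (- a)) * (1 - 0)"
    unfolding mean_low.simps by (intro tendsto_intros a)
  then have fp: "a = exp (- exp (- a))"
    using LIMSEQ_Suc[OF a] LIMSEQ_unique by fastforce
  have a0: "0 < a" by (subst fp) simp
  have le: "a \<le> exp (- a)"
    by (rule LIMSEQ_le[OF a tendsto_exp[OF tendsto_minus[OF a]]]) (use bound in auto)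
  have "a = exp (- a)"
  proof (rule ccontr)
    assume "a \<noteq> exp (- a)"
    define d where "d = exp (- a) - a"
    have d: "0 < d" using le \<open>a \<noteq> exp (- a)\<close> by (simp add: d_def)
    have "d = exp (- a) * (1 - exp (- d))"
    proof -
      have "a = exp (- (a + d))" using fp by (simp add: d_def)
      then have "d = exp (- a) - exp (- (a + d))" by (simp add: d_def)
      moreover have "exp (- (a + d)) = exp (- a) * exp (- d)" by (simp flip: exp_add)
      ultimately show ?thesis by (simp add: algebra_simps)
    qed
    also have "\<dots> \<le> exp (- a) * d"
      using exp_ge_add_one_self[of "- d"] by (intro mult_left_mono) auto
    also have "\<dots> < 1 * d"
      using a0 d by (intro mult_strict_right_mono) auto
    finally show False by simp
  qed
  with a show thesis by (rule that)
qed

text \<open>The two limits are ordered pointwise and the mean of the larger one does not exceed the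
  finite mean of the smaller one, so they agree almost surely.\<close>

lemma AE_down_limits:
  "AE l in pwit_law. (SUP n. down_low n l) = (INF n. branch_min (down_low n) l) \<and> (SUP n. down_low n l) < \<top>"
proof -
  obtain a where a: "mean_low \<longlonglongrightarrow> a" "a = exp (- a)" by (rule mean_low_limit)
  let ?L = "\<lambda>l. SUP n. down_low n l" and ?U = "\<lambda>l. INF n. branch_min (down_low n) l"
  have [measurable]: "branch_min (down_low n) \<in> borel_measurable pwit_law" for n
    by (rule measurable_branch_min) simp
  have "(\<integral>\<^sup>+l. ?L l \<partial>pwit_law) = (SUP n. \<integral>\<^sup>+l. down_low n l \<partial>pwit_law)"
    by (intro nn_integral_monotone_convergence_SUP) (auto simp: incseq_def le_fun_def down_low_mono)
  also have "\<dots> = (SUP n. ennreal (mean_low n))" by (simp add: nn_integral_down_low)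
  finally have L: "(\<integral>\<^sup>+l. ?L l \<partial>pwit_law) = (SUP n. ennreal (mean_low n))" .
  have "(\<lambda>n. ennreal (mean_low n)) \<longlonglongrightarrow> (SUP n. ennreal (mean_low n))"
    unfolding nn_integral_down_low(1)[symmetric]
    by (intro LIMSEQ_SUP) (auto simp: incseq_def intro!: nn_integral_mono down_low_mono)
  then have La: "(\<integral>\<^sup>+l. ?L l \<partial>pwit_law) = ennreal a"
    unfolding L using tendsto_ennrealI[OF a(1)] LIMSEQ_unique by blast
  have Ua: "(\<integral>\<^sup>+l. ?U l \<partial>pwit_law) \<le> ennreal a"
  proof (rule LIMSEQ_le_const)
    show "(\<lambda>n. ennreal (exp (- mean_low n))) \<longlonglongrightarrow> ennreal a"
      by (subst a(2)) (intro tendsto_intros tendsto_ennrealI a(1))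
    show "\<exists>N. \<forall>n\<ge>N. (\<integral>\<^sup>+l. ?U l \<partial>pwit_law) \<le> ennreal (exp (- mean_low n))"
      unfolding nn_integral_down_low(2)[symmetric] by (auto intro!: nn_integral_mono INF_lower)
  qed
  have LU: "?L l \<le> ?U l" for l
  proof (intro SUP_least INF_greatest)
    fix m n
    have "down_low m l \<le> down_low (max m n) l" by (rule down_low_mono) simp
    also have "\<dots> \<le> branch_min (down_low (max m n)) l" by (rule down_low_le)
    also have "\<dots> \<le> branch_min (down_low n) l" by (rule branch_min_antimono) simp
    finally show "down_low m l \<le> branch_min (down_low n) l" .
  qed
  have "AE l in pwit_law. ?U l \<noteq> \<infinity>"
    using Ua by (intro nn_integral_PInf_AE) (auto simp: top_unique)
  then have fin: "AE l in pwit_law. ?U l \<noteq> \<top>" by simp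
  have "(\<integral>\<^sup>+l. ?U l - ?L l \<partial>pwit_law) = (\<integral>\<^sup>+l. ?U l \<partial>pwit_law) - (\<integral>\<^sup>+l. ?L l \<partial>pwit_law)"
    using La LU by (intro nn_integral_diff) auto
  also have "\<dots> = 0" using Ua unfolding La by (simp add: diff_eq_0_iff_ennreal le_less_trans[OF Ua])
  finally have "AE l in pwit_law. ?U l - ?L l = 0"
    by (subst (asm) nn_integral_0_iff_AE) auto
  with fin show ?thesis
  proof eventually_elim
    case (elim l)
    then have "?U l \<le> ?L l" by (simp add: diff_eq_0_iff_ennreal)
    with LU[of l] have eq: "?L l = ?U l" by (rule antisym)
    have "?U l < \<top>" using elim(1) by (simp only: less_top)
    then show ?case by (simp only: eq)
  qed
qed

section \<open>Limits on the edges of the tree\<close>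

lemma AE_subtree:
  assumes "AE l in pwit_law. P l" shows "AE l in pwit_law. P (subtree v l)"
  by (rule AE_distrD[OF distr_subtree(1)]) (unfold distr_subtree(2), rule assms)

abbreviation "tlow l \<equiv> lowlim tree_adj (edge_len l)"
abbreviation "tupp l \<equiv> upplim tree_adj (edge_len l)"

lemma tlow_child: "tlow l v (v @ [j]) = (SUP n. down_low n (subtree (v @ [j]) l))"
  unfolding lowlim_def low_tree ..

lemma tupp_child: "tupp l v (v @ [j]) = (INF n. branch_min (down_low n) (subtree (v @ [j]) l))"
  unfolding upplim_def upp_tree ..

lemma AE_tlow_child: "AE l in pwit_law. \<forall>v j. tlow l v (v @ [j]) = tupp l v (v @ [j]) \<and> tlow l v (v @ [j]) < \<top>"
  unfolding AE_all_countable tlow_child tupp_child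
  by (intro allI AE_subtree[OF AE_down_limits])

lemma measurable_edge_len [measurable]: "(\<lambda>l. edge_len l u v) \<in> borel_measurable pwit_law"
  unfolding edge_len_def by measurable

lemma measurable_best:
  assumes "\<And>v w. (\<lambda>l. h l v w) \<in> borel_measurable pwit_law"
  shows "(\<lambda>l. best tree_adj (edge_len l) (h l) u v) \<in> borel_measurable pwit_law"
  unfolding best_def using assms
  by (intro borel_measurable_INF) (auto intro: countableI_type)

lemma measurable_low [measurable]: "(\<lambda>l. low tree_adj (edge_len l) n u v) \<in> borel_measurable pwit_law"
  by (induction n arbitrary: u v) (auto intro!: borel_measurable_min measurable_best)

lemma measurable_tlow [measurable]: "(\<lambda>l. tlow l u v) \<in> borel_measurable pwit_law"
  unfolding lowlim_def by measurable

lemma measurable_tupp [measurable]: "(\<lambda>l. tupp l u v) \<in> borel_measurable pwit_law"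
  unfolding upplim_def upp_def by (intro borel_measurable_INF measurable_best measurable_low) auto

lemma distr_root_points: "distr pwit_law points_law (\<lambda>l. l []) = points_law" and measurable_root_points: "(\<lambda>l. l []) \<in> pwit_law \<rightarrow>\<^sub>M points_law"
  unfolding pwit_law_def by (auto intro!: distr_PiM_component prob_space_points_law)

lemma AE_root_points: "AE t in points_law. P t \<Longrightarrow> AE l in pwit_law. P (l [])"
  by (rule AE_distrD[OF measurable_root_points]) (unfold distr_root_points)

text \<open>The subtracted values depend on the subtrees only, hence are independent of the root
  points. For fixed values a tie prescribes the difference of two points, which has no
  atoms.\<close>

lemma AE_no_ties:
  assumes ij: "i \<noteq> j"
  shows "AE l in pwit_law. l [] i - enn2real (tlow l [] [i]) \<noteq> l [] j - enn2real (tlow l [] [j])"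
proof -
  define a where "a l = (SUP n. down_low n l)" for l
  have [measurable]: "a \<in> borel_measurable pwit_law" unfolding a_def by measurable
  interpret P: prob_space pwit_law by (rule prob_space_pwit_law)
  interpret T: prob_space points_law by (rule prob_space_points_law)
  let ?S = "PiM UNIV (\<lambda>_. borel) \<Otimes>\<^sub>M PiM UNIV (\<lambda>_. borel) :: ((nat \<Rightarrow> real) \<times> (nat \<Rightarrow> ennreal)) measure"
  define D where "D = PiM (UNIV::nat set) (\<lambda>_. distr pwit_law borel a)"
  interpret D: prob_space D unfolding D_def by (intro prob_space_PiM P.prob_space_distr) simp
  interpret TD: pair_sigma_finite points_law D ..
  have sD: "sets D = sets (PiM UNIV (\<lambda>_. borel))" unfolding D_def by (intro sets_PiM_cong) auto
  have sTD: "sets (points_law \<Otimes>\<^sub>M D) = sets ?S" by (intro sets_pair_measure_cong sets_points_law sD)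
  have sp: "space D = UNIV" by (simp add: D_def space_PiM)
  let ?Q = "\<lambda>z. fst z i - enn2real (snd z i) \<noteq> fst z j - enn2real (snd z j)"
  have "(\<lambda>z. fst z k - enn2real (snd z k)) \<in> borel_measurable ?S" for k by measurable
  then have m: "{z \<in> space ?S. ?Q z} \<in> sets ?S" by (intro borel_measurable_neq)
  then have m': "{z \<in> space (points_law \<Otimes>\<^sub>M D). ?Q z} \<in> sets (points_law \<Otimes>\<^sub>M D)"
    by (simp add: sTD sets_eq_imp_space_eq[OF sTD])
  have "AE y in D. AE t in points_law. ?Q (t, y)"
  proof (rule AE_I2)
    fix y :: "nat \<Rightarrow> ennreal"
    have "AE t in points_law. t i - t j \<noteq> enn2real (y i) - enn2real (y j)" by (rule AE_points_law_diff_neq[OF ij])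
    then show "AE t in points_law. ?Q (t, y)" by eventually_elim auto
  qed
  then have "AE t in points_law. AE y in D. ?Q (t, y)"
    using m' by (subst TD.AE_commute) auto
  then have "AE z in points_law \<Otimes>\<^sub>M D. ?Q z"
    by (rule TD.AE_pair_measure[OF m'])
  then have "AE z in distr pwit_law ?S (\<lambda>l. (l [], \<lambda>j::nat. a (subtree [j] l))). ?Q z"
    unfolding pwit_law_joint[OF \<open>a \<in> borel_measurable pwit_law\<close>] D_def .
  moreover have "(\<lambda>l. (l [], \<lambda>j::nat. a (subtree [j] l))) \<in> pwit_law \<rightarrow>\<^sub>M ?S"
    using measurable_root_points
    by (intro measurable_Pair measurable_PiM_single') (auto simp: space_PiM measurable_subtree measurable_cong_sets[OF refl sets_points_law])
  ultimately have "AE l in pwit_law. ?Q (l [], \<lambda>j. a (subtree [j] l))"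
    by (rule AE_distrD[rotated])
  then show ?thesis
    using tlow_child[of _ "[]"] by (simp add: a_def)
qed

lemma nn_integral_root_point: "(\<integral>\<^sup>+l. ennreal (l [] i) \<partial>pwit_law) < \<top>"
proof -
  have expo: "(\<integral>\<^sup>+t. ennreal t \<partial>expo) = 1"
  proof -
    have "(\<integral>\<^sup>+t. ennreal t \<partial>expo) = (\<integral>\<^sup>+t. ennreal (t ^ 1 * exp (- t)) * indicator {0..} t \<partial>lborel)"
      by (subst nn_integral_expo) (auto intro!: nn_integral_cong simp: mult.commute split: split_indicator simp flip: ennreal_mult)
    also have "\<dots> = 1" by (subst nn_intergal_power_times_exp_Ici) simp
    finally show ?thesis .
  qed
  have comp: "distr gaps expo (\<lambda>\<omega>. \<omega> k) = expo" and compm: "(\<lambda>\<omega>. \<omega> k) \<in> gaps \<rightarrow>\<^sub>M expo" for k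
    unfolding gaps_def by (auto intro!: distr_PiM_component prob_space_expo)
  have g: "(\<integral>\<^sup>+\<omega>. ennreal (\<omega> k) \<partial>gaps) = 1" for k
    using nn_integral_distr[OF compm[of k], of ennreal] expo by (simp add: comp measurable_cong_sets[OF sets_expo refl])
  have gm: "(\<lambda>\<omega>. ennreal (\<omega> k)) \<in> borel_measurable gaps" for k
    by (rule measurable_compose[OF compm]) (simp add: measurable_cong_sets[OF sets_expo refl])
  have pos: "AE \<omega> in gaps. \<forall>k. 0 < \<omega> k"
    unfolding gaps_def AE_all_countable
    by (intro allI AE_PiM_component prob_space_expo AE_expo) auto
  have "(\<lambda>t. ennreal (t i)) \<in> borel_measurable points_law"
    unfolding measurable_cong_sets[OF sets_points_law refl]
    by (rule measurable_compose[OF _ measurable_ennreal], rule measurable_component_singleton) simp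
  then have "(\<integral>\<^sup>+l. ennreal (l [] i) \<partial>pwit_law) = (\<integral>\<^sup>+t. ennreal (t i) \<partial>points_law)"
    using nn_integral_distr[OF measurable_root_points, of "\<lambda>t. ennreal (t i)"] by (simp add: distr_root_points)
  also have "\<dots> = (\<integral>\<^sup>+\<omega>. ennreal (\<Sum>k\<le>i. \<omega> k) \<partial>gaps)"
    unfolding points_law_def by (subst nn_integral_distr) auto
  also have "\<dots> = (\<integral>\<^sup>+\<omega>. (\<Sum>k\<le>i. ennreal (\<omega> k)) \<partial>gaps)"
    by (intro nn_integral_cong_AE, use pos in eventually_elim) (auto simp: sum_ennreal less_imp_le)
  also have "\<dots> = (\<Sum>k\<le>i. \<integral>\<^sup>+\<omega>. ennreal (\<omega> k) \<partial>gaps)" by (rule nn_integral_sum) (rule gm)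
  also have "\<dots> < \<top>" by (simp add: g of_nat_less_top)
  finally show ?thesis .
qed

section \<open>The exchange inequality at the root\<close>

lemma suminf_le_except_two:
  fixes F G :: "nat \<Rightarrow> ennreal"
  assumes "p \<noteq> r" and le: "\<And>j. j \<noteq> p \<Longrightarrow> j \<noteq> r \<Longrightarrow> G j \<le> F j" and pr: "G p + G r \<le> F p + F r"
  shows "suminf G \<le> suminf F"
proof -
  have split: "suminf H = suminf (\<lambda>j. if j = p \<or> j = r then 0 else H j) + (H p + H r)" for H :: "nat \<Rightarrow> ennreal"
  proof -
    have single: "(\<Sum>j. if j = k then H j else 0) = H k" for k
      using sums_unique[OF sums_single[of k H]] by simp
    have "suminf H = (\<Sum>j. (if j = p \<or> j = r then 0 else H j) + ((if j = p then H j else 0) + (if j = r then H j else 0)))"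
      by (intro suminf_cong) (use assms(1) in auto)
    also have "\<dots> = suminf (\<lambda>j. if j = p \<or> j = r then 0 else H j) + ((\<Sum>j. if j = p then H j else 0) + (\<Sum>j. if j = r then H j else 0))"
      by (simp only: suminf_add[OF summableI summableI])
    finally show ?thesis by (simp only: single)
  qed
  show ?thesis
    unfolding split[of G] split[of F] using le
    by (intro add_mono pr suminf_le) auto
qed

text \<open>Subtracted terms stand on the opposite side, so all summands are nonnegative and
  infinite series cause no trouble. \<open>lower\<close> and \<open>greatest\<close> describe
  \<open>x' j\<close> as an infimum that need not be attained.\<close>

lemma cover_exchange:
  fixes \<xi> x x' :: "nat \<Rightarrow> real"
  assumes \<xi>: "\<And>j. 0 < \<xi> j" and x: "\<And>j. 0 \<le> x j"
    and lower: "\<And>j w. w \<noteq> j \<Longrightarrow> x' j \<le> max (\<xi> w - x w) 0"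
    and greatest: "\<And>j c. (\<And>w. w \<noteq> j \<Longrightarrow> c \<le> max (\<xi> w - x w) 0) \<Longrightarrow> c \<le> x' j"
    and ties: "\<And>i j. i \<noteq> j \<Longrightarrow> \<xi> i - x i \<noteq> \<xi> j - x j"
    and opt: "Opt = {j. \<xi> j \<le> x j + x' j}"
  shows "A \<noteq> {} \<Longrightarrow> (\<Sum>j. ennreal ((if j \<in> Opt then \<xi> j + x' j else 0) + (if j \<in> A then x j else 0))) \<le>
      (\<Sum>j. ennreal ((if j \<in> A then \<xi> j + x' j else 0) + (if j \<in> Opt then x j else 0)))" (is "_ \<Longrightarrow> suminf ?G \<le> suminf ?F")
    and "(\<Sum>j. if j \<in> Opt then ennreal (x' j) else 0) \<le> ennreal (\<xi> 0) + ennreal (\<xi> 1)"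
proof -
  have x': "0 \<le> x' j" for j by (rule greatest) simp
  \<comment> \<open>Without ties, two minimizers can only share the truncated value 0, and then each
    forces \<open>x'\<close> to vanish at the other.\<close>
  have two: "\<xi> j \<le> x j \<and> x' j = 0" if "j \<in> Opt" "w \<in> Opt" "j \<noteq> w" for j w
  proof -
    have j: "\<xi> j - x j \<le> max (\<xi> w - x w) 0" and w: "\<xi> w - x w \<le> max (\<xi> j - x j) 0"
      using lower[of w j] lower[of j w] that by (auto simp: opt)
    have "\<xi> j \<le> x j" "\<xi> w \<le> x w" using j w ties[OF that(3)] by auto
    then show ?thesis using lower[of w j] that(3) x'[of j] by simp
  qed
  show "suminf ?G \<le> suminf ?F" if A: "A \<noteq> {}"
  \<comment> \<open>An element of A outside Opt always contributes a positive amount. If moreover no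
    element of Opt outside A does, the comparison holds term by term.\<close>
  proof (cases "\<forall>j\<in>Opt - A. \<xi> j + x' j \<le> x j")
    case True
    show ?thesis
    proof (intro suminf_le ennreal_leI summableI)
      fix j
      show "(if j \<in> Opt then \<xi> j + x' j else 0) + (if j \<in> A then x j else 0) \<le>
          (if j \<in> A then \<xi> j + x' j else 0) + (if j \<in> Opt then x j else 0)"
        using True x'[of j] by (cases "j \<in> Opt"; cases "j \<in> A") (auto simp: opt)
    qed
  next
    case False
    \<comment> \<open>A minimizer with a positive contribution is the only one, by
      \<open>two\<close>. It is compared with an arbitrary \<open>r\<close> in A; the remaining
      indices still compare term by term.\<close>
    then obtain p where p: "p \<in> Opt" "p \<notin> A" "x p < \<xi> p + x' p" by auto
    have uniq: "w = p" if "w \<in> Opt" for w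
    proof (rule ccontr)
      assume "w \<noteq> p"
      then have "\<xi> p \<le> x p \<and> x' p = 0" using two[OF p(1) that] by simp
      then show False using p(3) by simp
    qed
    obtain r where r: "r \<in> A" using A by auto
    have rp: "p \<noteq> r" "r \<notin> Opt" using r p(2) uniq[of r] by blast+
    \<comment> \<open>As \<open>r\<close> is no minimizer, \<open>\<xi> r - x r\<close> is positive
      and truncation leaves it unchanged.\<close>
    have yr: "x' r < \<xi> r - x r" using rp(2) by (auto simp: opt)
    have "x' p \<le> \<xi> r - x r" using lower[of r p] yr x'[of r] rp(1) by auto
    moreover have "\<xi> p - x p \<le> x' r"
    proof (rule greatest)
      fix w assume "w \<noteq> r"
      show "\<xi> p - x p \<le> max (\<xi> w - x w) 0"
        using lower[of w p] p(1) by (cases "w = p") (auto simp: opt)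
    qed
    ultimately have key: "\<xi> p + x' p + x r \<le> \<xi> r + x' r + x p" by simp
    show ?thesis
    proof (rule suminf_le_except_two[OF rp(1)])
      show "?G j \<le> ?F j" if "j \<noteq> p" "j \<noteq> r" for j
        using uniq[of j] that x'[of j] by (intro ennreal_leI) (auto simp: opt)
      have "ennreal (\<xi> p + x' p) + ennreal (x r) \<le> ennreal (x p) + ennreal (\<xi> r + x' r)"
        using key \<xi>[of p] \<xi>[of r] x x' by (simp add: ennreal_plus[symmetric] less_imp_le del: ennreal_plus)
      then show "?G p + ?G r \<le> ?F p + ?F r" using p r rp by simp
    qed
  qed
  \<comment> \<open>By \<open>two\<close> at most one minimizer has a nonzero \<open>x'\<close>, and
    this value is at most the length of whichever of the points 0 and 1 is a different one.\<close>
  show "(\<Sum>j. if j \<in> Opt then ennreal (x' j) else 0) \<le> ennreal (\<xi> 0) + ennreal (\<xi> 1)"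
  proof (cases "\<exists>p. \<forall>j\<in>Opt. j \<noteq> p \<longrightarrow> x' j = 0")
    case True
    then obtain p where p: "\<And>j. j \<in> Opt \<Longrightarrow> j \<noteq> p \<Longrightarrow> x' j = 0" by blast
    have "(\<Sum>j. if j \<in> Opt then ennreal (x' j) else 0) \<le> (\<Sum>j. if j = p then ennreal (x' p) else 0)"
      by (intro suminf_le summableI) (auto simp: p)
    also have "\<dots> = ennreal (x' p)"
      using sums_unique[OF sums_single[of p "\<lambda>_. ennreal (x' p)"]] by simp
    also have "x' p \<le> \<xi> 0 + \<xi> 1"
    proof -
      obtain w where w: "w \<noteq> p" "w = 0 \<or> w = 1" by (metis zero_neq_one)
      then have "x' p \<le> max (\<xi> w) 0" using lower[of w p] x[of w] by (auto simp: max_def split: if_splits)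
      then show ?thesis using \<xi>[of 0] \<xi>[of 1] w(2) by auto
    qed
    finally show ?thesis using \<xi>[of 0] \<xi>[of 1] by (simp add: ennreal_leI less_imp_le flip: ennreal_plus)
  next
    case False
    then obtain p where "p \<in> Opt" "x' p \<noteq> 0" by blast
    then have "\<forall>j\<in>Opt. j \<noteq> p \<longrightarrow> x' j = 0" using two[of p] by blast
    then show ?thesis using False by blast
  qed
qed

definition sum_on :: "nat set \<Rightarrow> (nat \<Rightarrow> ennreal) \<Rightarrow> ennreal" where
  "sum_on A c = (\<Sum>j. if j \<in> A then c j else 0)"

lemma sum_on_add: "sum_on A c + sum_on A d = sum_on A (\<lambda>j. c j + d j)"
  unfolding sum_on_def suminf_add[OF summableI summableI] by (intro suminf_cong) simp

text \<open>The criterion of \<open>C_opt_at_iff\<close> with X replaced by the lower limit, so that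
  optimality becomes a function of the lengths alone.\<close>

definition opt_at_root :: "lengths \<Rightarrow> nat set" where
  "opt_at_root l = {j. ennreal (l [] j) \<le> tlow l [] [j] + tlow l [j] []}"

text \<open>Finiteness is asked only on edges leaving the root. On edges pointing to the root it
  follows, the value there being an infimum of truncated differences of finite numbers.\<close>

definition generic :: "lengths \<Rightarrow> bool" where
  "generic l \<longleftrightarrow> (\<forall>j. 0 < l [] j) \<and> (\<forall>j. l [] j < l [] (Suc j)) \<and>
     (\<forall>j. tlow l [] [j] = tupp l [] [j] \<and> tlow l [] [j] < \<top>) \<and> (\<forall>j. tlow l [j] [] = tupp l [j] []) \<and>
     (\<forall>i j. i \<noteq> j \<longrightarrow> l [] i - enn2real (tlow l [] [i]) \<noteq> l [] j - enn2real (tlow l [] [j]))"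

lemma tupp_root: "tupp l [j] [] = (INF i\<in>- {j}. ennreal (l [] i) - tlow l [] [i])"
proof -
  have "{w. tree_adj [] w \<and> w \<noteq> [j]} = (\<lambda>i. [i]) ` (- {j})" by (auto simp: tree_adj_def)
  then show ?thesis
    unfolding upplim_eq best_def using edge_len_child(1)[of l "[]"] by (simp add: image_image)
qed

lemma generic_exchange:
  assumes g: "generic l"
  shows "A \<noteq> {} \<Longrightarrow> sum_on (opt_at_root l) (\<lambda>j. ennreal (l [] j)) + sum_on (opt_at_root l) (\<lambda>j. tlow l [j] []) + sum_on A (\<lambda>j. tlow l [] [j]) \<le>
     sum_on A (\<lambda>j. ennreal (l [] j)) + sum_on A (\<lambda>j. tlow l [j] []) + sum_on (opt_at_root l) (\<lambda>j. tlow l [] [j])"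
    and "sum_on (opt_at_root l) (\<lambda>j. tlow l [j] []) \<le> ennreal (l [] 0) + ennreal (l [] 1)"
    and "sum_on A (\<lambda>j. tlow l [j] []) \<le> sum_on A (\<lambda>j. ennreal (l [] j)) + ennreal (l [] 1)"
proof -
  define \<xi> where "\<xi> j = l [] j" for j
  define x where "x j = enn2real (tlow l [] [j])" for j
  define x' where "x' j = enn2real (tlow l [j] [])" for j
  have \<xi>: "0 < \<xi> j" for j using g by (simp add: generic_def \<xi>_def)
  have X: "tlow l [] [j] = ennreal (x j)" for j 
    using g unfolding generic_def x_def by (metis ennreal_enn2real)
  have root: "tlow l [j] [] = (INF i\<in>- {j}. ennreal (max (\<xi> i - x i) 0))" for j
  proof -
    have "ennreal (\<xi> i) - ennreal (x i) = ennreal (max (\<xi> i - x i) 0)" for i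
      by (subst ennreal_minus) (auto simp: x_def max_def ennreal_neg)
    then show ?thesis using g tupp_root[of l j] by (simp add: generic_def X \<xi>_def)
  qed
  have le: "tlow l [j] [] \<le> ennreal (max (\<xi> i - x i) 0)" if "i \<noteq> j" for i j
    unfolding root using that by (intro INF_lower) auto
  have "tlow l [j] [] < \<top>" for j
    using le[of "Suc j" j] by (rule le_less_trans) auto
  then have X': "tlow l [j] [] = ennreal (x' j)" for j
    by (simp add: x'_def ennreal_enn2real)
  have nn: "0 \<le> x j" "0 \<le> x' j" for j by (simp_all add: x_def x'_def)
  have lower: "x' j \<le> max (\<xi> w - x w) 0" if "w \<noteq> j" for j w
    using le[OF that] unfolding X' by (subst (asm) ennreal_le_iff) auto
  have greatest: "c \<le> x' j" if "\<And>w. w \<noteq> j \<Longrightarrow> c \<le> max (\<xi> w - x w) 0" for j c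
  proof -
    have "ennreal c \<le> tlow l [j] []"
      unfolding root using that by (intro INF_greatest ennreal_leI) auto
    then show ?thesis by (simp add: X' nn ennreal_le_iff)
  qed
  have ties: "\<xi> i - x i \<noteq> \<xi> j - x j" if "i \<noteq> j" for i j
    using g that unfolding generic_def \<xi>_def x_def by blast
  have opt: "opt_at_root l = {j. \<xi> j \<le> x j + x' j}"
    using nn by (auto simp: opt_at_root_def X X' ennreal_le_iff \<xi>_def simp flip: ennreal_plus)
  note ex = cover_exchange[where \<xi> = \<xi> and x = x and x' = x', OF \<xi> nn(1) lower greatest ties opt]
  show "sum_on (opt_at_root l) (\<lambda>j. tlow l [j] []) \<le> ennreal (l [] 0) + ennreal (l [] 1)"
    using ex(2) by (simp add: sum_on_def X' \<xi>_def)
  have conv: "(\<Sum>j. ennreal ((if j \<in> P then \<xi> j + x' j else 0) + (if j \<in> Q then x j else 0))) = 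
     sum_on P (\<lambda>j. ennreal (l [] j)) + sum_on P (\<lambda>j. tlow l [j] []) + sum_on Q (\<lambda>j. tlow l [] [j])" for P Q
  proof -
    have "(\<Sum>j. ennreal ((if j \<in> P then \<xi> j + x' j else 0) + (if j \<in> Q then x j else 0))) = 
      (\<Sum>j. (if j \<in> P then ennreal (\<xi> j) + ennreal (x' j) else 0) + (if j \<in> Q then ennreal (x j) else 0))"
      using \<xi> nn by (intro suminf_cong) (auto simp: less_imp_le)
    also have "\<dots> = sum_on P (\<lambda>j. ennreal (\<xi> j) + ennreal (x' j)) + sum_on Q (\<lambda>j. ennreal (x j))"
      unfolding sum_on_def by (rule suminf_add[OF summableI summableI, symmetric])
    finally show ?thesis by (simp add: sum_on_add X X' \<xi>_def)
  qed
  show "A \<noteq> {} \<Longrightarrow> sum_on (opt_at_root l) (\<lambda>j. ennreal (l [] j)) + sum_on (opt_at_root l) (\<lambda>j. tlow l [j] []) + sum_on A (\<lambda>j. tlow l [] [j]) \<le>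
     sum_on A (\<lambda>j. ennreal (l [] j)) + sum_on A (\<lambda>j. tlow l [j] []) + sum_on (opt_at_root l) (\<lambda>j. tlow l [] [j])"
    using ex(1)[of A] unfolding conv by simp
  have mono: "l [] 0 \<le> l [] j" for j
  proof (rule lift_Suc_mono_le[of "l []"])
    show "l [] n \<le> l [] (Suc n)" for n using g unfolding generic_def by (blast intro: less_imp_le)
  qed simp
  \<comment> \<open>Another child of small length bounds the value: child 0, whose length is at most
    that of \<open>j\<close>, or child 1 if \<open>j = 0\<close>.\<close>
  have bound: "tlow l [j] [] \<le> ennreal (l [] j) + (if j = 0 then ennreal (l [] 1) else 0)" for j
  proof (cases "j = 0")
    case True
    have "tlow l [j] [] \<le> ennreal (max (\<xi> 1 - x 1) 0)" using True by (intro le) auto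
    also have "\<dots> \<le> ennreal (l [] 1)" using nn(1)[of 1] \<xi>[of 1] by (intro ennreal_leI) (auto simp: \<xi>_def)
    finally show ?thesis using True by (simp add: add_increasing)
  next
    case False
    have "tlow l [j] [] \<le> ennreal (max (\<xi> 0 - x 0) 0)" using False by (intro le) auto
    also have "\<dots> \<le> ennreal (l [] j)" using nn(1)[of 0] \<xi>[of j] mono[of j] by (intro ennreal_leI) (auto simp: \<xi>_def)
    finally show ?thesis using False by simp
  qed
  have "sum_on A (\<lambda>j. tlow l [j] []) \<le> (\<Sum>j. (if j \<in> A then ennreal (l [] j) else 0) + (if j = 0 then ennreal (l [] 1) else 0))"
    unfolding sum_on_def using bound by (intro suminf_le summableI) auto
  also have "\<dots> = sum_on A (\<lambda>j. ennreal (l [] j)) + (\<Sum>j::nat. if j = 0 then ennreal (l [] 1) else 0)"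
    unfolding sum_on_def by (rule suminf_add[OF summableI summableI, symmetric])
  also have "(\<Sum>j::nat. if j = 0 then ennreal (l [] 1) else 0) = ennreal (l [] 1)"
    using sums_unique[OF sums_single[of 0 "\<lambda>_. ennreal (l [] 1)"]] by simp
  finally show "sum_on A (\<lambda>j. tlow l [j] []) \<le> sum_on A (\<lambda>j. ennreal (l [] j)) + ennreal (l [] 1)" .
qed

section \<open>Involution invariance and optimality\<close>

definition net_lowlim :: "'v network2 \<Rightarrow> ennreal" where
  "net_lowlim = (\<lambda>(G, a, b). lowlim (adj G) (len G) a b)"

definition net_upplim :: "'v network2 \<Rightarrow> ennreal" where
  "net_upplim = (\<lambda>(G, a, b). upplim (adj G) (len G) a b)"

lemma net_lowlim_alt: "net_lowlim g = (SUP n. net_low n g)"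
  by (cases g) (simp add: net_lowlim_def net_low_def lowlim_def)

lemma net_upplim_alt: "net_upplim g = (INF n. net_upp n g)"
  by (cases g) (simp add: net_upplim_def net_upp_def upplim_def)

lemma measurable_net_lowlim [measurable]: "net_lowlim \<in> borel_measurable network2_borel"
  unfolding net_lowlim_alt[abs_def] by measurable

lemma measurable_net_lowlim_swap [measurable]: "(\<lambda>g. net_lowlim (net_swap g)) \<in> borel_measurable network2_borel"
  unfolding net_lowlim_alt by measurable

lemma measurable_net_upplim [measurable]: "net_upplim \<in> borel_measurable network2_borel"
  unfolding net_upplim_alt[abs_def] by measurable

lemma involution_sum:
  fixes f :: "vertex network2 \<Rightarrow> ennreal"
  assumes inv: "involution_invariant M \<xi> C" and f: "f \<in> borel_measurable network2_borel"
  shows "(\<integral>\<^sup>+\<omega>. (\<Sum>j. f (tree_network (\<xi> \<omega>) (C \<omega>), [], [j])) \<partial>M) = (\<integral>\<^sup>+\<omega>. (\<Sum>j. f (tree_network (\<xi> \<omega>) (C \<omega>), [j], [])) \<partial>M)"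
proof -
  have bij: "bij_betw (\<lambda>j. [j]) UNIV {x. tree_adj x []}"
    by (auto simp: bij_betw_def inj_on_def tree_adj_def)
  have "(\<integral>\<^sup>+x. h x \<partial>count_space {x. tree_adj x []}) = (\<Sum>j. h [j])" for h :: "vertex \<Rightarrow> ennreal"
    using nn_integral_bij_count_space[OF bij, of h] by (simp add: nn_integral_count_space_nat)
  then show ?thesis
    using inv f unfolding involution_invariant_def by simp
qed

lemma tree_network_simps [simp]:
  "net_lowlim (tree_network l F, u, v) = tlow l u v"
  "net_upplim (tree_network l F, u, v) = tupp l u v"
  "net_swap (tree_network l F, u, v) = (tree_network l F, v, u)"
  "adj (tree_network l F) = tree_adj" "len (tree_network l F) = edge_len l"
  "mark (tree_network l F) u v \<longleftrightarrow> {u, v} \<in> F"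
  by (simp_all add: net_lowlim_def net_upplim_def net_swap_def tree_network_def)

lemma tree_adj_root [simp]: "tree_adj [] [j]" "tree_adj [j] []"
  by (auto simp: tree_adj_def)

text \<open>
  Independence only gives \<open>tlow = tupp\<close> on the edges leaving the root; involution invariance
  transfers this to the edges that point to the root.
\<close>

lemma AE_generic:
  assumes M: "PWIT M \<xi>" and inv: "involution_invariant M \<xi> C"
  shows "AE l in pwit_law. generic l"
proof -
  note law = PWIT_distr[OF M]
  define f :: "vertex network2 \<Rightarrow> ennreal" where 
    "f g = (if net_lowlim g \<noteq> net_upplim g then 1 else 0)" for g
  have "{g \<in> space network2_borel. net_lowlim g \<noteq> net_upplim g} \<in> sets (network2_borel :: vertex network2 measure)"
    by (rule borel_measurable_neq[OF measurable_net_lowlim measurable_net_upplim])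
  then have f: "f \<in> borel_measurable network2_borel"
    unfolding f_def[abs_def] by (intro measurable_If measurable_const) simp_all
  have down: "AE l in pwit_law. \<forall>j. tlow l [] [j] = tupp l [] [j] \<and> tlow l [] [j] < \<top>"
    using AE_tlow_child by eventually_elim (metis append_Nil)
  have "AE \<omega> in M. \<forall>j. tlow (\<xi> \<omega>) [] [j] = tupp (\<xi> \<omega>) [] [j] \<and> tlow (\<xi> \<omega>) [] [j] < \<top>"
    by (rule AE_distrD[OF law(1)]) (unfold law(2), rule down)
  then have "(\<integral>\<^sup>+\<omega>. (\<Sum>j. f (tree_network (\<xi> \<omega>) (C \<omega>), [], [j])) \<partial>M) = (\<integral>\<^sup>+\<omega>. 0 \<partial>M)"
    by (intro nn_integral_cong_AE, elim eventually_mono) (simp add: f_def)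
  then have "(\<integral>\<^sup>+\<omega>. (\<Sum>j. f (tree_network (\<xi> \<omega>) (C \<omega>), [j], [])) \<partial>M) = 0"
    by (simp add: involution_sum[OF inv f])
  then have 0: "(\<integral>\<^sup>+\<omega>. (\<Sum>j. if tlow (\<xi> \<omega>) [j] [] \<noteq> tupp (\<xi> \<omega>) [j] [] then 1 else 0) \<partial>M) = 0"
    by (simp add: f_def)
  have m: "{l \<in> space pwit_law. tlow l [j] [] \<noteq> tupp l [j] []} \<in> sets pwit_law" for j
    by (rule borel_measurable_neq[OF measurable_tlow measurable_tupp])
  define h :: "lengths \<Rightarrow> ennreal" where "h l = (\<Sum>j. if tlow l [j] [] \<noteq> tupp l [j] [] then 1 else 0)" for l
  have h: "h \<in> borel_measurable pwit_law"
    unfolding h_def by (intro borel_measurable_suminf_order measurable_If m measurable_const) simp_all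
  have "(\<integral>\<^sup>+l. h l \<partial>pwit_law) = 0"
  proof -
    have "(\<integral>\<^sup>+l. h l \<partial>pwit_law) = (\<integral>\<^sup>+\<omega>. h (\<xi> \<omega>) \<partial>M)"
      using nn_integral_distr[OF law(1), of h] h by (simp add: law(2))
    also have "\<dots> = 0" using 0 by (simp add: h_def)
    finally show ?thesis .
  qed
  then have "AE l in pwit_law. h l = 0"
    using h by (simp add: nn_integral_0_iff_AE)
  then have up: "AE l in pwit_law. \<forall>j. tlow l [j] [] = tupp l [j] []"
    by eventually_elim (auto simp: h_def suminf_eq_zero_iff split: if_splits)
  have ties: "AE l in pwit_law. \<forall>i j. i \<noteq> j \<longrightarrow> l [] i - enn2real (tlow l [] [i]) \<noteq> l [] j - enn2real (tlow l [] [j])"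
    unfolding AE_all_countable
  proof (intro allI)
    fix i j :: nat
    show "AE l in pwit_law. i \<noteq> j \<longrightarrow> l [] i - enn2real (tlow l [] [i]) \<noteq> l [] j - enn2real (tlow l [] [j])"
    proof (cases "i = j")
      case False
      from AE_no_ties[OF this] show ?thesis by eventually_elim simp
    qed simp
  qed
  from AE_root_points[OF AE_points_law] down up ties show ?thesis
    by eventually_elim (unfold generic_def, blast)
qed

lemma measurable_sum_on:
  assumes "\<And>j. {x \<in> space M. j \<in> A x} \<in> sets M" "\<And>j. (\<lambda>x. c j x) \<in> borel_measurable M"
  shows "(\<lambda>x. sum_on (A x) (\<lambda>j. c j x)) \<in> borel_measurable M"
  unfolding sum_on_def
  by (intro borel_measurable_suminf_order measurable_If assms measurable_const) simp

lemma opt_at_root_sets: "{l \<in> space pwit_law. j \<in> opt_at_root l} \<in> sets pwit_law"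
  unfolding opt_at_root_def mem_Collect_eq
  by (intro borel_measurable_le borel_measurable_add measurable_tlow measurable_compose[OF measurable_length measurable_ennreal])

lemma measurable_opt_cost: "(\<lambda>l. sum_on (opt_at_root l) (\<lambda>j. ennreal (l [] j))) \<in> borel_measurable pwit_law"
  by (rule measurable_sum_on[OF opt_at_root_sets]) (rule measurable_compose[OF measurable_length measurable_ennreal])

lemma tree_edge_root: "{[], w} \<in> tree_edges \<longleftrightarrow> (\<exists>j. w = [j])"
proof
  assume "{[], w} \<in> tree_edges"
  then obtain u v where "{[], w} = {u, v}" "tree_adj u v" unfolding tree_edges_def by blast
  then show "\<exists>j. w = [j]" by (auto simp: doubleton_eq_iff tree_adj_def)
next
  assume "\<exists>j. w = [j]"
  then show "{[], w} \<in> tree_edges" unfolding tree_edges_def using tree_adj_root by blast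
qed

lemma nn_integral_cover_nbrs:
  assumes "F \<subseteq> tree_edges"
  shows "(\<integral>\<^sup>+v. h v \<partial>count_space (cover_nbrs F [])) = sum_on {j. {[], [j]} \<in> F} (\<lambda>j. h [j])"
proof -
  have "cover_nbrs F [] = (\<lambda>j. [j]) ` {j. {[], [j]} \<in> F}"
  proof (intro set_eqI iffI)
    fix w assume "w \<in> cover_nbrs F []"
    then have w: "{[], w} \<in> F" by (simp add: cover_nbrs_def)
    then obtain j where "w = [j]" using assms tree_edge_root[of w] by blast
    then show "w \<in> (\<lambda>j. [j]) ` {j. {[], [j]} \<in> F}" using w by blast
  qed (auto simp: cover_nbrs_def)
  then have bij: "bij_betw (\<lambda>j. [j]) {j. {[], [j]} \<in> F} (cover_nbrs F [])"
    by (auto simp: bij_betw_def inj_on_def)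
  have "(\<integral>\<^sup>+v. h v \<partial>count_space (cover_nbrs F [])) = (\<integral>\<^sup>+j. h [j] \<partial>count_space {j. {[], [j]} \<in> F})"
    by (rule nn_integral_bij_count_space[OF bij, symmetric])
  also have "\<dots> = (\<integral>\<^sup>+j. h [j] * indicator {j. {[], [j]} \<in> F} j \<partial>count_space UNIV)"
    by (rule nn_integral_count_space_indicator) simp
  also have "\<dots> = sum_on {j. {[], [j]} \<in> F} (\<lambda>j. h [j])"
    unfolding sum_on_def nn_integral_count_space_nat by (intro suminf_cong) auto
  finally show ?thesis .
qed

text \<open>The minima in \<open>recursion\<close> are attained, so X is a fixed point of
  \<open>best\<close> and lies between the two limits. On a generic tree these coincide at the root,
  which fixes X in both directions of every root edge.\<close>

lemma root_cost_C_opt: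
  assumes N: "PWIT N \<zeta>" and X: "stationary_process N \<zeta> X" and gen: "AE l in pwit_law. generic l"
  shows "root_cost N \<zeta> (\<lambda>\<omega>. C_opt (\<zeta> \<omega>) (X \<omega>)) = (\<integral>\<^sup>+l. sum_on (opt_at_root l) (\<lambda>j. ennreal (l [] j)) \<partial>pwit_law)"
proof -
  note law = PWIT_distr[OF N]
  have g: "AE \<omega> in N. generic (\<zeta> \<omega>)"
    by (rule AE_distrD[OF law(1)]) (unfold law(2), rule gen)
  have nn: "AE \<omega> in N. \<forall>u v. tree_adj u v \<longrightarrow> 0 \<le> X \<omega> u v" and rec: "AE \<omega> in N. recursion (\<zeta> \<omega>) (X \<omega>)"
    using X by (auto simp: stationary_process_def)
  have "root_cost N \<zeta> (\<lambda>\<omega>. C_opt (\<zeta> \<omega>) (X \<omega>)) = (\<integral>\<^sup>+\<omega>. sum_on (opt_at_root (\<zeta> \<omega>)) (\<lambda>j. ennreal (\<zeta> \<omega> [] j)) \<partial>N)"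
    unfolding root_cost_def
  proof (rule nn_integral_cong_AE, use g nn rec in eventually_elim)
    fix \<omega> assume g: "generic (\<zeta> \<omega>)" and nn: "\<forall>u v. tree_adj u v \<longrightarrow> 0 \<le> X \<omega> u v" and rec: "recursion (\<zeta> \<omega>) (X \<omega>)"
    let ?l = "\<zeta> \<omega>" and ?y = "\<lambda>u v. ennreal (X \<omega> u v)"
    have fp: "?y u v = best tree_adj (edge_len ?l) ?y u v" if uv: "tree_adj u v" for u v
    proof -
      have diff: "ennreal (edge_len ?l v w) - ?y v w = ennreal (max (edge_len ?l v w - X \<omega> v w) 0)" if "tree_adj v w" for w
        using nn that by (subst ennreal_minus) (auto simp: max_def ennreal_neg)
      have m: "is_minimum {max (edge_len ?l v w - X \<omega> v w) 0 | w. tree_adj v w \<and> w \<noteq> u} (X \<omega> u v)"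
        using rec uv by (simp add: recursion_def)
      show ?thesis
      proof (rule antisym)
        show "?y u v \<le> best tree_adj (edge_len ?l) ?y u v"
          unfolding best_def
        proof (rule INF_greatest)
          fix w assume w: "w \<in> {w. tree_adj v w \<and> w \<noteq> u}"
          then have "X \<omega> u v \<le> max (edge_len ?l v w - X \<omega> v w) 0"
            using m unfolding is_minimum_def by blast
          then show "?y u v \<le> ennreal (edge_len ?l v w) - ?y v w"
            using w diff by (simp only: mem_Collect_eq ennreal_leI)
        qed
        obtain w where "tree_adj v w" "w \<noteq> u" "X \<omega> u v = max (edge_len ?l v w - X \<omega> v w) 0"
          using m by (auto simp: is_minimum_def)
        then show "best tree_adj (edge_len ?l) ?y u v \<le> ?y u v"
          unfolding best_def by (intro INF_lower2[of w]) (auto simp: diff)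
      qed
    qed
    have sandwich: "tlow ?l u v \<le> ?y u v" "?y u v \<le> tupp ?l u v" if "tree_adj u v" for u v
      using low_le_fixed_point_le_upp[of tree_adj ?y "edge_len ?l", OF fp] that
      unfolding lowlim_def upplim_def by (auto intro: SUP_least INF_greatest)
    have eq: "?y [] [j] = tlow ?l [] [j]" "?y [j] [] = tlow ?l [j] []" for j
      using sandwich[of "[]" "[j]"] sandwich[of "[j]" "[]"] g by (auto simp: generic_def intro: antisym)
    have nn': "\<And>u v. tree_adj u v \<Longrightarrow> 0 \<le> X \<omega> u v" using nn by blast
    have nbrs: "cover_nbrs (C_opt ?l (X \<omega>)) [] = C_opt_at ?l (X \<omega>) []"
      by (rule cover_nbrs_C_opt[OF rec]) (rule nn')
    have sub: "C_opt ?l (X \<omega>) \<subseteq> tree_edges"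
      by (auto simp: C_opt_def C_opt_at_def tree_edges_def is_arg_min_def)
    have "{[], [j]} \<in> C_opt ?l (X \<omega>) \<longleftrightarrow> j \<in> opt_at_root ?l" for j
    proof -
      have "{[], [j]} \<in> C_opt ?l (X \<omega>) \<longleftrightarrow> [j] \<in> cover_nbrs (C_opt ?l (X \<omega>)) []"
        by (simp add: cover_nbrs_def)
      also have "\<dots> \<longleftrightarrow> edge_len ?l [] [j] \<le> X \<omega> [] [j] + X \<omega> [j] []"
        unfolding nbrs using C_opt_at_iff[OF rec nn', of "[j]" "[]"] by simp
      also have "\<dots> \<longleftrightarrow> ennreal (edge_len ?l [] [j]) \<le> ?y [] [j] + ?y [j] []"
        using nn'[of "[]" "[j]"] nn'[of "[j]" "[]"] by (simp add: ennreal_le_iff flip: ennreal_plus)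
      also have "\<dots> \<longleftrightarrow> j \<in> opt_at_root ?l"
        using edge_len_child(1)[of ?l "[]" j] by (simp add: opt_at_root_def eq)
      finally show ?thesis .
    qed
    then show "(\<integral>\<^sup>+v. ennreal (edge_len ?l [] v) \<partial>count_space (cover_nbrs (C_opt ?l (X \<omega>)) [])) = 
        sum_on (opt_at_root ?l) (\<lambda>j. ennreal (?l [] j))"
      using edge_len_child(1)[of ?l "[]"] by (simp add: nn_integral_cover_nbrs[OF sub])
  qed
  also have "\<dots> = (\<integral>\<^sup>+l. sum_on (opt_at_root l) (\<lambda>j. ennreal (l [] j)) \<partial>distr N pwit_law \<zeta>)"
    by (rule nn_integral_distr[OF law(1), symmetric]) (simp add: measurable_opt_cost)
  finally show ?thesis by (simp add: law(2))
qed

theorem theorem8: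
  fixes M :: "'a measure" and \<xi> :: "'a \<Rightarrow> lengths" and C :: "'a \<Rightarrow> vertex set set"
    and N :: "'b measure" and \<zeta> :: "'b \<Rightarrow> lengths" and X :: "'b \<Rightarrow> vertex \<Rightarrow> vertex \<Rightarrow> real"
  assumes "PWIT M \<xi>" and "random_edge_cover M C" and "involution_invariant M \<xi> C"
    and "PWIT N \<zeta>" and "stationary_process N \<zeta> X"
  shows "root_cost M \<xi> C \<ge> root_cost N \<zeta> (\<lambda>\<omega>. C_opt (\<zeta> \<omega>) (X \<omega>))"
proof (cases "root_cost M \<xi> C < \<top>")
  \<comment> \<open>An infinite cost leaves nothing to show; a finite one makes the terms finite
    that are cancelled at the end.\<close>
  case finite_cost: True
  note law = PWIT_distr[OF assms(1)]
  note gen = AE_generic[OF assms(1,3)]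
  have g: "AE \<omega> in M. generic (\<xi> \<omega>)"
    by (rule AE_distrD[OF law(1)]) (unfold law(2), rule gen)
  define A where "A \<omega> = {j. {[], [j]} \<in> C \<omega>}" for \<omega>
  define Opt where "Opt \<omega> = opt_at_root (\<xi> \<omega>)" for \<omega>
  define down where "down j \<omega> = tlow (\<xi> \<omega>) [] [j]" for j \<omega>
  define up where "up j \<omega> = tlow (\<xi> \<omega>) [j] []" for j \<omega>
  define length_at where "length_at j \<omega> = ennreal (\<xi> \<omega> [] j)" for j \<omega>
  have A_meas: "{\<omega> \<in> space M. j \<in> A \<omega>} \<in> sets M" for j
    using assms(2) tree_edge_root[of "[j]"] unfolding A_def random_edge_cover_def mem_Collect_eq by blast
  have Opt_meas: "{\<omega> \<in> space M. j \<in> Opt \<omega>} \<in> sets M" for j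
    using measurable_sets[OF law(1) opt_at_root_sets[of j]] by (simp add: Opt_def vimage_def Int_def conj_commute)
  have fn_meas: "down j \<in> borel_measurable M" "up j \<in> borel_measurable M" "length_at j \<in> borel_measurable M" for j
    unfolding down_def up_def length_at_def by (intro measurable_compose[OF law(1)], measurable)+
  note [measurable] = measurable_sum_on[OF A_meas fn_meas(1)] measurable_sum_on[OF A_meas fn_meas(2)]
    measurable_sum_on[OF A_meas fn_meas(3)] measurable_sum_on[OF Opt_meas fn_meas(1)]
    measurable_sum_on[OF Opt_meas fn_meas(2)] measurable_sum_on[OF Opt_meas fn_meas(3)] fn_meas
  let ?I = "\<lambda>P c. \<integral>\<^sup>+\<omega>. sum_on (P \<omega>) (\<lambda>j. c j \<omega>) \<partial>M"
  have cover: "AE \<omega> in M. C \<omega> \<subseteq> tree_edges \<and> A \<omega> \<noteq> {}"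
  proof -
    have "AE \<omega> in M. edge_cover UNIV tree_edges (C \<omega>)" using assms(2) by (simp add: random_edge_cover_def)
    then show ?thesis
    proof eventually_elim
      case (elim \<omega>)
      then obtain e where e: "e \<in> C \<omega>" "[] \<in> e" by (auto simp: edge_cover_def)
      then have "e \<in> tree_edges" using elim by (auto simp: edge_cover_def)
      moreover obtain w where w: "e = {[], w}"
        using \<open>e \<in> tree_edges\<close> e(2) unfolding tree_edges_def by blast
      ultimately obtain j where "w = [j]" using tree_edge_root[of w] by auto
      then have "j \<in> A \<omega>" using e(1) w by (simp add: A_def)
      then show ?case using elim unfolding edge_cover_def by blast
    qed
  qed
  have cost: "root_cost M \<xi> C = ?I A length_at"
    unfolding root_cost_def
  proof (rule nn_integral_cong_AE, use cover in eventually_elim)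
    fix \<omega> assume "C \<omega> \<subseteq> tree_edges \<and> A \<omega> \<noteq> {}"
    then show "(\<integral>\<^sup>+v. ennreal (edge_len (\<xi> \<omega>) [] v) \<partial>count_space (cover_nbrs (C \<omega>) [])) = sum_on (A \<omega>) (\<lambda>j. length_at j \<omega>)"
      using edge_len_child(1)[of "\<xi> \<omega>" "[]"] by (simp add: nn_integral_cover_nbrs A_def length_at_def)
  qed
  have opt_cost: "root_cost N \<zeta> (\<lambda>\<omega>. C_opt (\<zeta> \<omega>) (X \<omega>)) = ?I Opt length_at"
  proof -
    have "?I Opt length_at = (\<integral>\<^sup>+l. sum_on (opt_at_root l) (\<lambda>j. ennreal (l [] j)) \<partial>distr M pwit_law \<xi>)"
      unfolding Opt_def length_at_def
      by (rule nn_integral_distr[OF law(1), symmetric]) (simp add: measurable_opt_cost)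
    then show ?thesis by (simp add: root_cost_C_opt[OF assms(4,5) gen] law(2))
  qed
  have flip_A: "?I A down = ?I A up"
  proof -
    \<comment> \<open>The mark does not depend on the direction of the edge, so exchanging the two
      vertices only reverses the argument of \<open>net_lowlim\<close>.\<close>
    define f :: "vertex network2 \<Rightarrow> ennreal" where
      "f g = (if adj (fst g) (fst (snd g)) (snd (snd g)) \<and> mark (fst g) (fst (snd g)) (snd (snd g)) then net_lowlim g else 0)" for g
    have f: "f \<in> borel_measurable network2_borel"
      unfolding f_def[abs_def]
      by (intro measurable_If measurable_net_lowlim measurable_const measurable_net_mark[unfolded pred_def]) simp
    show ?thesis
      using involution_sum[OF assms(3) f] by (simp add: f_def sum_on_def A_def down_def up_def insert_commute cong: if_cong)
  qed
  have flip_Opt: "?I Opt down = ?I Opt up"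
  proof -
    \<comment> \<open>The selection criterion is symmetric in the two vertices, so both orders
      select the same edges at the root and only the summed value is reversed.\<close>
    define f :: "vertex network2 \<Rightarrow> ennreal" where
      "f g = (if net_len g \<le> net_lowlim g + net_lowlim (net_swap g) then net_lowlim g else 0)" for g
    have f: "f \<in> borel_measurable network2_borel"
      unfolding f_def[abs_def]
      by (intro measurable_If measurable_net_lowlim measurable_net_lowlim_swap measurable_net_len
          measurable_const borel_measurable_le borel_measurable_add) simp
    have len: "net_len (tree_network l F, [], [j]) = ennreal (l [] j)" "net_len (tree_network l F, [j], []) = ennreal (l [] j)" for l F j
      using edge_len_child[of l "[]" j] by (simp_all add: net_len_def)
    show ?thesis
      using involution_sum[OF assms(3) f] 
      by (simp add: f_def sum_on_def Opt_def opt_at_root_def down_def up_def len add.commute cong: if_cong)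
  qed
  have E: "(\<integral>\<^sup>+\<omega>. length_at j \<omega> \<partial>M) < \<top>" for j
    using nn_integral_distr[OF law(1), of "\<lambda>l. ennreal (l [] j)"] nn_integral_root_point[of j]
    by (simp add: law(2) length_at_def)
  have fin_A: "?I A up < \<top>"
  proof -
    have "?I A up \<le> (\<integral>\<^sup>+\<omega>. sum_on (A \<omega>) (\<lambda>j. length_at j \<omega>) + length_at 1 \<omega> \<partial>M)"
      by (rule nn_integral_mono_AE, use g in eventually_elim) (use generic_exchange(3) in \<open>simp add: up_def length_at_def\<close>)
    also have "\<dots> = ?I A length_at + (\<integral>\<^sup>+\<omega>. length_at 1 \<omega> \<partial>M)" by (rule nn_integral_add) simp_all
    also have "\<dots> < \<top>" using finite_cost E[of 1] by (simp add: cost)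
    finally show ?thesis .
  qed
  have fin_Opt: "?I Opt up < \<top>"
  proof -
    have "?I Opt up \<le> (\<integral>\<^sup>+\<omega>. length_at 0 \<omega> + length_at 1 \<omega> \<partial>M)"
      by (rule nn_integral_mono_AE, use g in eventually_elim) (use generic_exchange(2) in \<open>simp add: Opt_def up_def length_at_def\<close>)
    also have "\<dots> = (\<integral>\<^sup>+\<omega>. length_at 0 \<omega> \<partial>M) + (\<integral>\<^sup>+\<omega>. length_at 1 \<omega> \<partial>M)" by (rule nn_integral_add) simp_all
    also have "\<dots> < \<top>" using E by simp
    finally show ?thesis .
  qed
  have "(\<integral>\<^sup>+\<omega>. sum_on (Opt \<omega>) (\<lambda>j. length_at j \<omega>) + sum_on (Opt \<omega>) (\<lambda>j. up j \<omega>) + sum_on (A \<omega>) (\<lambda>j. down j \<omega>) \<partial>M) \<le>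
    (\<integral>\<^sup>+\<omega>. sum_on (A \<omega>) (\<lambda>j. length_at j \<omega>) + sum_on (A \<omega>) (\<lambda>j. up j \<omega>) + sum_on (Opt \<omega>) (\<lambda>j. down j \<omega>) \<partial>M)"
    by (rule nn_integral_mono_AE, use g cover in eventually_elim)
      (use generic_exchange(1) in \<open>simp add: Opt_def up_def down_def length_at_def\<close>)
  then have "?I Opt length_at + ?I Opt up + ?I A down \<le> ?I A length_at + ?I A up + ?I Opt down"
    by (simp add: nn_integral_add)
  \<comment> \<open>The flips turn both \<open>down\<close> terms into \<open>up\<close> terms; the
    resulting common summand is finite and cancels.\<close>
  then have "(?I Opt up + ?I A up) + ?I Opt length_at \<le> (?I Opt up + ?I A up) + ?I A length_at"
    by (simp add: flip_A flip_Opt ac_simps)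
  then show ?thesis
    using fin_A fin_Opt by (auto simp: cost opt_cost ennreal_add_left_cancel_le)
qed (simp add: less_top[symmetric] top_unique)

end
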